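(* Let $v:[0,1]\to[0,+\infty)$ be a Lipschitz and non-increasing function with $v(1)=0$. Let $\eta>0$ be fixed and let $w:[0,\eta]\to[0,+\infty)$ be a non-increasing Lipschitz function with $\int_0^\eta w(x)\,dx=1$. Let $\rho_0\in BV(\mathbb{R},[0,1])$ have compact support and $\int\rho_0(x)\,dx=1$. Fix any $T>0$. Then, for each $n\in\mathbb{N}$, $n\ge1$, the particle approximation $t\mapsto[\rho(t)]^n$ (defined in the context) is defined in $C^0([0,T],\mathcal{P}_c(\mathbb{R}))$, and, as $n\to\infty$, $[\rho(t)]^n$ converges weakly to $\rho(t)$ for $t\in[0,T]$, where $\rho\in C^0([0,T],\mathcal{P}_c(\mathbb{R}))$ is the unique (weak) solution of the Cauchy problem $$\begin{cases}\partial_t\rho+\partial_x\left(\rho\, v\left(\int_x^{x+\eta}\rho(t,y)\,w(y-x)\,dy\right)\right)=0, & x\in\mathbb{R},\ t>0,\\ \rho(0,x)=\rho_0(x), & x\in\mathbb{R}.\end{cases}$$ In particular, $\rho$ is defined for all times $t>0$, and it satisfies $$0\le\rho(t,x)\le\max\{\rho_0\}\qquad\text{for a.e. }x\in\mathbb{R},\ t>0.$$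
   Context: $\mathcal{P}_c(\mathbb{R})$ is the set of Borel probability measures on $\mathbb{R}$ with compact support, endowed with the $\infty$-Wasserstein distance $W_\infty(\mu,\nu)=\inf\{\pi\text{-}\mathrm{ess\,sup}\,|x-y| : \pi\in\Pi(\mu,\nu)\}$, where $\Pi(\mu,\nu)$ is the set of couplings of $\mu$ and $\nu$. Absolutely continuous measures are identified with their densities. $\max\{\rho_0\}$ means the (essential) supremum of $\rho_0$. The function $v$ is extended by $v(x)=0$ for $x>1$. Weak solution on $[0,T]$: $\mu\in C^0([0,T],\mathcal{P}_c(\mathbb{R}))$ with $\mu(0)=\rho_0$ and, for all $\varphi\in C_c^\infty((0,T)\times\mathbb{R})$, $\int_0^T\int_{\mathbb{R}}\big(\partial_t\varphi+\partial_x\varphi\; v(\int_{[x,x+\eta]}w(y-x)\,d\mu(t,y))\big)\,d\mu(t,x)\,dt=0$. Regularized kernel: for $\ell>0$, $w_\ell:\mathbb{R}\to[0,+\infty)$ is given by $w_\ell(x)=w(0)\frac{\ell+2x}{\ell}$ for $x\in[-\frac{\ell}{2},0]$; $w_\ell(x)=w(x)$ for $x\in[0,\eta]$; $w_\ell(x)=w(\eta)\frac{2\eta+\ell-2x}{\ell}$ for $x\in[\eta,\eta+\frac{\ell}{2}]$; $w_\ell(x)=0$ elsewhere. Discretization of $\rho_0$: $x_{1,0}=\sup\{x\in\mathbb{R} : \int_{-\infty}^x\rho_0<\frac1n\}$ and $x_{i+1,0}=\sup\{x\in\mathbb{R} : \int_{x_{i,0}}^x\rho_0<\frac1n\}$ for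 $i=1,\dots,n-1$. Particle approximation: with $\ell_n:=(n\|\rho_0\|_{L^\infty})^{-1}$, set $[\rho(t)]^n=\frac1n\sum_{i=1}^n\delta_{x_i(t)}$, where $(x_1(t),\dots,x_n(t))$ is the unique solution of $$\dot x_n=v(0),\qquad \dot x_i=v\Big(\tfrac1n\sum_{j=1}^n w_{\ell_n}(x_j-x_i)\Big)\ (i=1,\dots,n-1),\qquad x_i(0)=x_{i,0}\ (i=1,\dots,n).$$ *)

theory Defs
  imports "HOL-Probability.Probability"
begin

section \<open>Smoothness, test functions and functions of bounded variation\<close>

text \<open>On a finite-dimensional domain, requiring that all directional derivatives are of class
  \<open>C^k\<close> is the same as requiring that the derivative is of class \<open>C^k\<close>.\<close>

primrec C_k :: "nat \<Rightarrow> ('a::euclidean_space \<Rightarrow> real) \<Rightarrow> bool" where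
  "C_k 0 f \<longleftrightarrow> continuous_on UNIV f"
| "C_k (Suc k) f \<longleftrightarrow>
     (\<forall>x. f differentiable (at x)) \<and> (\<forall>h. C_k k (\<lambda>x. frechet_derivative f (at x) h))"

definition C_infinity :: "('a::euclidean_space \<Rightarrow> real) \<Rightarrow> bool" where
  "C_infinity f \<longleftrightarrow> (\<forall>k. C_k k f)"

definition supp :: "('a::euclidean_space \<Rightarrow> real) \<Rightarrow> 'a set" where
  "supp f = closure {x. f x \<noteq> 0}"

text \<open>\<open>C_c^\<infinity>((0,T) \<times> \<real>)\<close>, each function being extended by zero to the whole plane.\<close>

definition test_functions :: "real \<Rightarrow> (real \<times> real \<Rightarrow> real) set" where
  "test_functions T =
     {\<phi>. C_infinity \<phi> \<and> compact (supp \<phi>) \<and> supp \<phi> \<subseteq> {0<..<T} \<times> UNIV}"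

text \<open>\<open>BV(\<real>)\<close> in the \<open>L^1\<close> sense (finite total variation of the distributional derivative), so
  that the notion does not depend on the representative modulo null sets.\<close>

definition BV :: "(real \<Rightarrow> real) \<Rightarrow> bool" where
  "BV f \<longleftrightarrow> integrable lborel f \<and>
     (\<exists>C. \<forall>\<phi>. C_k 1 \<phi> \<and> compact (supp \<phi>) \<and> (\<forall>x. \<bar>\<phi> x\<bar> \<le> 1) \<longrightarrow>
        (LINT x|lborel. f x * deriv \<phi> x) \<le> C)"

definition Linf_norm :: "(real \<Rightarrow> real) \<Rightarrow> real" where
  "Linf_norm f = real_of_ereal (esssup lborel (\<lambda>x. ereal \<bar>f x\<bar>))"

section \<open>Compactly supported measures and the infinite Wasserstein distance\<close>

definition P_c :: "real measure set" where
  "P_c = {\<mu>. prob_space \<mu> \<and> sets \<mu> = sets borel \<and> (\<exists>K. compact K \<and> (AE x in \<mu>. x \<in> K))}"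

definition couplings :: "real measure \<Rightarrow> real measure \<Rightarrow> (real \<times> real) measure set" where
  "couplings \<mu> \<nu> =
     {\<pi>. prob_space \<pi> \<and> sets \<pi> = sets borel \<and> distr \<pi> borel fst = \<mu> \<and> distr \<pi> borel snd = \<nu>}"

definition W_inf :: "real measure \<Rightarrow> real measure \<Rightarrow> ereal" where
  "W_inf \<mu> \<nu> = (INF \<pi>\<in>couplings \<mu> \<nu>. esssup \<pi> (\<lambda>(x, y). ereal \<bar>x - y\<bar>))"

definition C0_P_c :: "real \<Rightarrow> (real \<Rightarrow> real measure) set" where
  "C0_P_c T = {\<mu>. \<forall>t\<in>{0..T}. \<mu> t \<in> P_c \<and> ((\<lambda>s. W_inf (\<mu> s) (\<mu> t)) \<longlongrightarrow> 0) (at t within {0..T})}"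

definition measure_with_density :: "(real \<Rightarrow> real) \<Rightarrow> real measure" where
  "measure_with_density r = density lborel (\<lambda>x. ennreal (r x))"

section \<open>The nonlocal conservation law\<close>

text \<open>The functions \<open>v\<close> and \<open>w\<close> below are only meaningful on \<open>[0,1]\<close> and \<open>[0,\<eta>]\<close>. The
  extended \<open>v\<close> is only ever evaluated at nonnegative arguments, and \<open>w\<close> only on \<open>[0,\<eta>]\<close>.\<close>

definition extend_v :: "(real \<Rightarrow> real) \<Rightarrow> real \<Rightarrow> real" where
  "extend_v v x = (if x > 1 then 0 else v x)"

definition nonlocal_velocity ::
    "(real \<Rightarrow> real) \<Rightarrow> (real \<Rightarrow> real) \<Rightarrow> real \<Rightarrow> real measure \<Rightarrow> real \<Rightarrow> real" where
  "nonlocal_velocity v w \<eta> \<mu> x = extend_v v (LINT y:{x..x+\<eta>}|\<mu>. w (y - x))"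

text \<open>For a curve in \<open>C0_P_c T\<close> and a Lipschitz, non-increasing, nonnegative \<open>w\<close>, the kernel
  \<open>w\<close> times the indicator of \<open>[0,\<eta>]\<close> is upper semicontinuous and bounded, so the velocity is a
  bounded Borel function of \<open>(t,x)\<close> and the integrals below are genuine (the convention that a
  non-integrable function has integral \<open>0\<close> plays no role).\<close>

definition weak_solution ::
    "(real \<Rightarrow> real) \<Rightarrow> (real \<Rightarrow> real) \<Rightarrow> real \<Rightarrow> (real \<Rightarrow> real) \<Rightarrow> real \<Rightarrow> (real \<Rightarrow> real measure) \<Rightarrow> bool"
  where
  "weak_solution v w \<eta> \<rho>\<^sub>0 T \<mu> \<longleftrightarrow>
     \<mu> \<in> C0_P_c T \<and> \<mu> 0 = measure_with_density \<rho>\<^sub>0 \<and>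
     (\<forall>\<phi>\<in>test_functions T.
        (LBINT t:{0..T}. (LINT x|\<mu> t.
            deriv (\<lambda>s. \<phi> (s, x)) t + deriv (\<lambda>y. \<phi> (t, y)) x * nonlocal_velocity v w \<eta> (\<mu> t) x)) = 0)"

section \<open>The particle approximation\<close>

definition reg_kernel :: "(real \<Rightarrow> real) \<Rightarrow> real \<Rightarrow> real \<Rightarrow> real \<Rightarrow> real" where
  "reg_kernel w \<eta> l x =
     (if x \<in> {-l/2..0} then w 0 * ((l + 2*x) / l)
      else if x \<in> {0..\<eta>} then w x
      else if x \<in> {\<eta>..\<eta> + l/2} then w \<eta> * ((2*\<eta> + l - 2*x) / l)
      else 0)"

text \<open>Particles are numbered \<open>1, \<dots>, n\<close>; the value at index \<open>0\<close> is a dummy.\<close>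

fun initial_position :: "(real \<Rightarrow> real) \<Rightarrow> nat \<Rightarrow> nat \<Rightarrow> real" where
  "initial_position \<rho>\<^sub>0 n 0 = 0"
| "initial_position \<rho>\<^sub>0 n (Suc 0) = Sup {x. (LBINT y:{..x}. \<rho>\<^sub>0 y) < 1 / real n}"
| "initial_position \<rho>\<^sub>0 n (Suc (Suc i)) =
     Sup {x. (LBINT y=initial_position \<rho>\<^sub>0 n (Suc i)..x. \<rho>\<^sub>0 y) < 1 / real n}"

definition particle_velocity ::
    "(real \<Rightarrow> real) \<Rightarrow> (real \<Rightarrow> real) \<Rightarrow> real \<Rightarrow> real \<Rightarrow> nat \<Rightarrow> (nat \<Rightarrow> real) \<Rightarrow> nat \<Rightarrow> real" where
  "particle_velocity v w \<eta> l n x i =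
     (if i = n then extend_v v 0
      else extend_v v ((1 / real n) * (\<Sum>j=1..n. reg_kernel w \<eta> l (x j - x i))))"

definition particle_solution ::
    "(real \<Rightarrow> real) \<Rightarrow> (real \<Rightarrow> real) \<Rightarrow> real \<Rightarrow> (real \<Rightarrow> real) \<Rightarrow> nat \<Rightarrow> real \<Rightarrow> (nat \<Rightarrow> real \<Rightarrow> real) \<Rightarrow> bool"
  where
  "particle_solution v w \<eta> \<rho>\<^sub>0 n T x \<longleftrightarrow>
     (\<forall>i\<in>{1..n}. x i 0 = initial_position \<rho>\<^sub>0 n i \<and>
        (\<forall>t\<in>{0..T}. (x i has_real_derivative
            particle_velocity v w \<eta> (1 / (real n * Linf_norm \<rho>\<^sub>0)) n (\<lambda>j. x j t) i) (at t within {0..T})))"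

text \<open>The measure \<open>(1/n) \<Sum>\<^sub>i \<delta>\<^bsub>x\<^sub>i(t)\<^esub>\<close>, as the law of a uniformly chosen particle.\<close>

definition empirical_measure :: "nat \<Rightarrow> (nat \<Rightarrow> real \<Rightarrow> real) \<Rightarrow> real \<Rightarrow> real measure" where
  "empirical_measure n x t = distr (uniform_count_measure {1..n}) borel (\<lambda>i. x i t)"

lemma measure_empirical_measure:
  assumes "n \<ge> 1" and A: "A \<in> sets borel"
  shows "measure (empirical_measure n x t) A = (1 / real n) * (\<Sum>i=1..n. measure (return borel (x i t)) A)"
proof -
  have "measure (empirical_measure n x t) A
      = measure (uniform_count_measure {1..n}) ((\<lambda>i. x i t) -` A \<inter> {1..n})"
    unfolding empirical_measure_def
    by (subst measure_distr) (use A in \<open>auto simp: space_uniform_count_measure\<close>)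
  also have "\<dots> = real (card ((\<lambda>i. x i t) -` A \<inter> {1..n})) / real n"
    by (subst measure_uniform_count_measure) auto
  also have "real (card ((\<lambda>i. x i t) -` A \<inter> {1..n})) = (\<Sum>i=1..n. indicator A (x i t))"
    by (simp add: sum.If_cases indicator_def Int_commute vimage_def Collect_conj_eq)
  also have "\<dots> = (\<Sum>i=1..n. measure (return borel (x i t)) A)"
    using A by (simp add: measure_return)
  finally show ?thesis by simp
qed

end

(*
  In one space dimension a solution is described by its monotone rearrangement X t : [0,1] -> R, which
  solves d/dt X t a = v (S (X t a)), where S x is the weighted mass of the law of X t in [x, x + eta].
  The superlevel sets of the kernel are intervals starting at x, so S depends on the distribution
  function F only through F (x + r) - F (x -). If X b - X a >= (b - a) / M for all labels a < b (density
  at most M), this gives S (X b) - S (X a) <= w 0 * (M * (X b - X a) - (b - a)): whenever the gap of two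
  labels is nearly minimal the one ahead is not much slower. Hence the Euler scheme preserves the
  density bound, on which S is Lipschitz in the uniform norm, and it converges. The same holds for the
  particles.

  A weak solution sigma is a priori only a measure, possibly with atoms. Testing the equation with steps
  that move at constant speed c shows that the mass to the left of the step increases while the velocity
  near the step is at most c, and decreases while it is at least c. Over a time step h this compares the
  rearrangement of sigma with X up to h * C * (distance + h), because sigma and X have close
  distribution functions and only X needs a bounded density. A discrete Gronwall argument gives
  sigma = law X. The distance of the i-th particle to X t (i / n) is estimated in the same way.
*)

theory Submission
  imports Defs
begin

section \<open>Euler schemes and a discrete Gronwall inequality\<close>

lemma discrete_gronwall:
  fixes P :: "real \<Rightarrow> real \<Rightarrow> bool"
  assumes P0: "P 0 0" and C: "0 \<le> C" and \<epsilon>: "0 \<le> \<epsilon>"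
    and step: "\<And>t h d. 0 \<le> t \<Longrightarrow> 0 \<le> h \<Longrightarrow> h \<le> 1 \<Longrightarrow> t + h \<le> T \<Longrightarrow> 0 \<le> d \<Longrightarrow> P t d
                 \<Longrightarrow> P (t + h) (d + h * (C * (d + h) + \<epsilon>))"
    and mono: "\<And>t d e. P t d \<Longrightarrow> d \<le> e \<Longrightarrow> P t e"
    and t: "0 \<le> t" "t \<le> T" and d: "\<epsilon> * t * exp (C * t) < d"
  shows "P t d"
proof -
  have "(\<lambda>N. exp (C * t) * (t * (C * (t / real N) + \<epsilon>))) \<longlonglongrightarrow> exp (C * t) * (t * (C * 0 + \<epsilon>))"
    by (intro tendsto_intros lim_const_over_n)
  moreover have "exp (C * t) * (t * (C * 0 + \<epsilon>)) < d"
    using d by (simp add: mult_ac)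
  ultimately have "\<forall>\<^sub>F N in sequentially. exp (C * t) * (t * (C * (t / real N) + \<epsilon>)) < d"
    by (rule order_tendstoD)
  moreover have "\<forall>\<^sub>F N in sequentially. t + 1 \<le> real N"
    using eventually_ge_at_top[of "nat \<lceil>t + 1\<rceil>"]
    by eventually_elim linarith
  ultimately have "\<forall>\<^sub>F N in sequentially. t + 1 \<le> real N \<and> exp (C * t) * (t * (C * (t / real N) + \<epsilon>)) < d"
    by eventually_elim simp
  then obtain N where N: "t + 1 \<le> real N" "exp (C * t) * (t * (C * (t / real N) + \<epsilon>)) < d"
    using eventually_happens'[OF sequentially_bot] by blast
  define h where "h = t / real N"
  have Npos: "0 < real N" using N t by linarith
  have h: "0 \<le> h" "h \<le> 1" "real N * h = t"
    using N t Npos by (auto simp: h_def field_simps)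
  define \<beta> where "\<beta> = C * h + \<epsilon>"
  have \<beta>: "0 \<le> \<beta>" using C \<epsilon> h by (simp add: \<beta>_def)
  have iter: "k \<le> N \<Longrightarrow> P (real k * h) ((1 + C * h) ^ k * (real k * h * \<beta>))" for k
  proof (induction k)
    case 0
    then show ?case using P0 by simp
  next
    case (Suc k)
    let ?d = "(1 + C * h) ^ k * (real k * h * \<beta>)"
    have q: "1 \<le> (1 + C * h) ^ Suc k" using C h by (intro one_le_power) simp
    have "real (Suc k) * h \<le> real N * h" using Suc h by (intro mult_right_mono) auto
    then have le: "real k * h + h \<le> T" using h t by (simp add: algebra_simps)
    have "P (real k * h + h) (?d + h * (C * (?d + h) + \<epsilon>))"
      using Suc h C \<beta> le by (intro step) auto
    moreover have "?d + h * (C * (?d + h) + \<epsilon>) = (1 + C * h) ^ Suc k * (real k * h * \<beta>) + h * \<beta>"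
      by (simp add: \<beta>_def algebra_simps)
    moreover have "h * \<beta> \<le> (1 + C * h) ^ Suc k * (h * \<beta>)"
      using mult_right_mono[OF q, of "h * \<beta>"] h \<beta> by simp
    ultimately have "P (real (Suc k) * h) ((1 + C * h) ^ Suc k * (real k * h * \<beta>) + (1 + C * h) ^ Suc k * (h * \<beta>))"
      using mono by (simp add: algebra_simps)
    then show ?case by (simp add: algebra_simps)
  qed
  have "(1 + C * h) ^ N \<le> exp (C * h) ^ N"
    using C h by (intro power_mono) (auto intro: exp_ge_add_one_self)
  also have "\<dots> = exp (C * t)"
    using h by (simp flip: exp_of_nat_mult add: mult_ac)
  finally have "(1 + C * h) ^ N * (t * \<beta>) \<le> exp (C * t) * (t * \<beta>)"
    using t \<beta> by (intro mult_right_mono) auto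
  also have "\<dots> \<le> d" using N(2) by (simp add: \<beta>_def h_def)
  finally show ?thesis using mono iter[of N] h by auto
qed

text \<open>An Euler scheme of step \<open>h\<^sub>0 / 2^p\<close> stays in \<open>K\<close>, so that its limit solves the equation in
  \<open>K\<close> even if the field is not Lipschitz outside of \<open>K\<close>.\<close>

lemma euler_flow:
  fixes K :: "('i \<Rightarrow> real) set" and G :: "('i \<Rightarrow> real) \<Rightarrow> 'i \<Rightarrow> real"
  assumes X0: "X0 \<in> K" and closed: "\<And>Y Z. (\<And>k. Y k \<in> K) \<Longrightarrow> (\<And>a. (\<lambda>k. Y k a) \<longlonglongrightarrow> Z a) \<Longrightarrow> Z \<in> K"
    and bound: "\<And>X a. X \<in> K \<Longrightarrow> \<bar>G X a\<bar> \<le> C"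
    and lip: "\<And>X Y d a. X \<in> K \<Longrightarrow> Y \<in> K \<Longrightarrow> (\<And>b. \<bar>X b - Y b\<bar> \<le> d) \<Longrightarrow> \<bar>G X a - G Y a\<bar> \<le> L * d"
    and L: "0 \<le> L" and h0: "0 < h\<^sub>0"
    and step: "\<And>X h. X \<in> K \<Longrightarrow> 0 \<le> h \<Longrightarrow> h \<le> h\<^sub>0 \<Longrightarrow> (\<lambda>a. X a + h * G X a) \<in> K"
  shows "\<exists>Z. Z 0 = X0 \<and> (\<forall>t\<ge>0. Z t \<in> K) \<and>
     (\<forall>t\<ge>0. \<forall>a. ((\<lambda>s. Z s a) has_real_derivative G (Z t) a) (at t within {0..}))"
proof -
  define \<tau> where "\<tau> p = h\<^sub>0 / 2 ^ p" for p :: nat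
  have \<tau>: "0 < \<tau> p" "\<tau> p \<le> h\<^sub>0" "\<tau> (Suc p) = \<tau> p / 2" for p
    using h0 by (auto simp: \<tau>_def field_simps)
  define E where "E p k = ((\<lambda>X a. X a + \<tau> p * G X a) ^^ k) X0" for p k
  have E0: "E p 0 = X0" and ES: "E p (Suc k) a = E p k a + \<tau> p * G (E p k) a" for p k a
    by (simp_all add: E_def)
  have EK: "E p k \<in> K" for p k
  proof (induction k)
    case (Suc k)
    have "(\<lambda>a. E p k a + \<tau> p * G (E p k) a) \<in> K"
      by (intro step Suc) (use \<tau>[of p] in auto)
    then show ?case by (simp add: E_def)
  qed (simp add: E0 X0)
  have C: "0 \<le> C" using bound[OF X0, of undefined] by linarith
  have move: "\<bar>E p (k + j) a - E p k a\<bar> \<le> real j * \<tau> p * C" for p k j a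
  proof (induction j)
    case (Suc j)
    have "\<bar>\<tau> p * G (E p (k + j)) a\<bar> \<le> \<tau> p * C"
      using \<tau>[of p] bound[OF EK] by (simp add: abs_mult mult_left_mono)
    then show ?case using Suc by (simp add: ES algebra_simps)
  qed simp
  have half_step: "\<bar>E (Suc p) (Suc k) a - E (Suc p) k a\<bar> \<le> \<tau> p * C" for p k a
    using move[of "Suc p" k 1 a] mult_nonneg_nonneg[OF less_imp_le[OF \<tau>(1)[of p]] C] by (simp add: \<tau>(3))
  have expand: "\<bar>E p (k + j) a - E p k a - real j * \<tau> p * G (E p k) a\<bar> \<le> L * C * (real j * \<tau> p)\<^sup>2" for p k j a
  proof (induction j)
    case (Suc j)
    have "\<bar>G (E p (k + j)) a - G (E p k) a\<bar> \<le> L * (real j * \<tau> p * C)"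
      by (intro lip EK move)
    then have "\<bar>\<tau> p * (G (E p (k + j)) a - G (E p k) a)\<bar> \<le> \<tau> p * (L * (real j * \<tau> p * C))"
      using \<tau>(1)[of p] by (simp add: abs_mult)
    moreover have "E p (k + Suc j) a - E p k a - real (Suc j) * \<tau> p * G (E p k) a
      = (E p (k + j) a - E p k a - real j * \<tau> p * G (E p k) a) + \<tau> p * (G (E p (k + j)) a - G (E p k) a)"
      by (simp add: ES algebra_simps)
    moreover have "L * C * (real j * \<tau> p)\<^sup>2 + \<tau> p * (L * (real j * \<tau> p * C)) \<le> L * C * (real (Suc j) * \<tau> p)\<^sup>2"
    proof -
      have "(real j * \<tau> p)\<^sup>2 + \<tau> p * (real j * \<tau> p) \<le> (real (Suc j) * \<tau> p)\<^sup>2"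
        using \<tau>(1)[of p] by (simp add: power2_eq_square algebra_simps)
      from mult_left_mono[OF this, of "L * C"] L C show ?thesis by (simp add: algebra_simps)
    qed
    ultimately show ?case using Suc by linarith
  qed simp
  have refine: "\<bar>E (Suc p) (2 * k) a - E p k a\<bar> \<le> \<tau> p * C * ((1 + L * \<tau> p) ^ k - 1)" for p k a
  proof (induction k arbitrary: a)
    case (Suc k)
    let ?B = "\<tau> p * C * ((1 + L * \<tau> p) ^ k - 1)" and ?y = "E (Suc p) (2 * k)" and ?y' = "E (Suc p) (Suc (2 * k))"
    let ?x = "E p k"
    have 1: "\<bar>G ?y a - G ?x a\<bar> \<le> L * ?B" by (intro lip EK Suc)
    have y': "\<bar>?y' b - ?y b\<bar> \<le> \<tau> p * C" for b
      by (rule half_step)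
    have "\<bar>?y' b - ?x b\<bar> \<le> ?B + \<tau> p * C" for b
      using Suc[of b] y'[of b] by linarith
    then have 2: "\<bar>G ?y' a - G ?x a\<bar> \<le> L * (?B + \<tau> p * C)" by (intro lip EK)
    have "\<bar>\<tau> p / 2 * (G ?y a - G ?x a) + \<tau> p / 2 * (G ?y' a - G ?x a)\<bar>
       \<le> \<tau> p / 2 * \<bar>G ?y a - G ?x a\<bar> + \<tau> p / 2 * \<bar>G ?y' a - G ?x a\<bar>"
      using \<tau>(1)[of p] by (intro order.trans[OF abs_triangle_ineq]) (simp add: abs_mult)
    also have "\<dots> \<le> \<tau> p / 2 * (L * (?B + \<tau> p * C)) + \<tau> p / 2 * (L * (?B + \<tau> p * C))"
    proof (intro add_mono mult_left_mono)
      show "\<bar>G ?y a - G ?x a\<bar> \<le> L * (?B + \<tau> p * C)"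
        using 1 mult_nonneg_nonneg[OF L mult_nonneg_nonneg[OF less_imp_le[OF \<tau>(1)[of p]] C]]
        by (simp add: distrib_left)
    qed (use \<tau>(1)[of p] 2 in auto)
    also have "\<dots> = \<tau> p * L * (?B + \<tau> p * C)" by (simp add: field_simps)
    finally have "\<bar>E (Suc p) (2 * Suc k) a - E p (Suc k) a\<bar> \<le> ?B + \<tau> p * L * (?B + \<tau> p * C)"
      using Suc[of a] by (simp add: ES \<tau>(3) algebra_simps)
    also have "\<dots> = \<tau> p * C * ((1 + L * \<tau> p) ^ Suc k - 1)" by (simp add: algebra_simps)
    finally show ?case .
  qed (simp add: E0)
  define idx where "idx p t = nat \<lfloor>t / \<tau> p\<rfloor>" for p t
  have idx: "real (idx p t) * \<tau> p \<le> t" "t < real (idx p t) * \<tau> p + \<tau> p" if "0 \<le> t" for p t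
  proof -
    have "real (idx p t) = of_int \<lfloor>t / \<tau> p\<rfloor>" using that \<tau>(1)[of p] by (simp add: idx_def)
    then have "real (idx p t) \<le> t / \<tau> p" "t / \<tau> p < real (idx p t) + 1" by linarith+
    then show "real (idx p t) * \<tau> p \<le> t" "t < real (idx p t) * \<tau> p + \<tau> p"
      using \<tau>(1)[of p] by (simp_all add: pos_le_divide_eq pos_divide_less_eq distrib_right)
  qed
  have idx_Suc: "idx (Suc p) t = 2 * idx p t \<or> idx (Suc p) t = Suc (2 * idx p t)" if "0 \<le> t" for p t
  proof -
    let ?i = "idx p t" and ?j = "idx (Suc p) t"
    have "\<tau> p * real ?j < \<tau> p * (2 * (real ?i + 1))" "\<tau> p * (2 * real ?i) < \<tau> p * (real ?j + 1)"
      using idx[OF that, of p] idx[OF that, of "Suc p"] by (auto simp: \<tau>(3) algebra_simps)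
    then have "real ?j < 2 * (real ?i + 1)" "2 * real ?i < real ?j + 1"
      using \<tau>(1)[of p] by (simp_all only: mult_less_cancel_left_pos)
    then have "?j < 2 * ?i + 2" "2 * ?i < ?j + 1" by (simp_all flip: of_nat_less_iff[where 'a = real])
    then show ?thesis by linarith
  qed
  define W where "W p t = E p (idx p t)" for p t
  have WK: "W p t \<in> K" for p t by (simp add: W_def EK)
  define Q where "Q t = h\<^sub>0 * C * (exp (L * t) + 1)" for t
  have cauchy: "\<bar>W (Suc p) t a - W p t a\<bar> \<le> Q t * (1 / 2) ^ p" if t: "0 \<le> t" for p t a
  proof -
    let ?i = "idx p t"
    have "(1 + L * \<tau> p) ^ ?i \<le> exp (L * \<tau> p) ^ ?i"
      using L \<tau>(1)[of p] by (intro power_mono) (auto intro: exp_ge_add_one_self)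
    also have "\<dots> = exp (L * (real ?i * \<tau> p))" by (simp flip: exp_of_nat_mult add: mult_ac)
    also have "\<dots> \<le> exp (L * t)" using L idx(1)[OF t, of p] by (simp add: mult_left_mono)
    finally have *: "\<tau> p * C * ((1 + L * \<tau> p) ^ ?i - 1) \<le> \<tau> p * C * exp (L * t)"
      using \<tau>(1)[of p] C by (intro mult_left_mono) auto
    have "\<bar>W (Suc p) t a - E (Suc p) (2 * ?i) a\<bar> \<le> \<tau> p * C"
      using idx_Suc[OF t, of p]
    proof
      assume "idx (Suc p) t = Suc (2 * ?i)"
      then show ?thesis using half_step[of p "2 * ?i" a] by (simp add: W_def)
    qed (use \<tau>(1)[of p] C in \<open>simp add: W_def\<close>)
    moreover have "\<bar>E (Suc p) (2 * ?i) a - W p t a\<bar> \<le> \<tau> p * C * exp (L * t)"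
      using refine[of p ?i a] * by (simp add: W_def)
    ultimately have "\<bar>W (Suc p) t a - W p t a\<bar> \<le> \<tau> p * C + \<tau> p * C * exp (L * t)" by linarith
    also have "\<dots> = Q t * (1 / 2) ^ p" by (simp add: Q_def \<tau>_def field_simps power_divide)
    finally show ?thesis .
  qed
  define Z where "Z t a = lim (\<lambda>p. W p t a)" for t a
  have Q: "0 \<le> Q t" for t using h0 C by (simp add: Q_def add_nonneg_nonneg)
  have geo: "summable (\<lambda>p. Q t * (1 / 2 :: real) ^ p)" for t by (intro summable_mult summable_geometric) simp
  have lim: "(\<lambda>p. W p t a) \<longlonglongrightarrow> Z t a" if t: "0 \<le> t" for t a
  proof -
    have "summable (\<lambda>p. W (Suc p) t a - W p t a)"
      by (rule summable_comparison_test'[OF geo[of t], of 0]) (use cauchy[OF t] in auto)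
    then have "convergent (\<lambda>p. (\<Sum>q<p. W (Suc q) t a - W q t a) + W 0 t a)"
      by (intro convergent_add convergent_const) (simp add: summable_iff_convergent)
    moreover have "(\<Sum>q<p. W (Suc q) t a - W q t a) + W 0 t a = W p t a" for p by (induction p) auto
    ultimately have "convergent (\<lambda>p. W p t a)" by (simp only:)
    then show ?thesis by (simp add: Z_def convergent_LIMSEQ_iff)
  qed
  have near: "\<bar>Z t a - W p t a\<bar> \<le> 2 * Q t * (1 / 2) ^ p" if t: "0 \<le> t" for t a p
  proof -
    have "\<bar>W (p + q) t a - W p t a\<bar> \<le> 2 * Q t * (1 / 2) ^ p - 2 * Q t * (1 / 2) ^ (p + q)" for q
    proof (induction q)
      case (Suc q)
      then show ?case using cauchy[OF t, of "p + q" a] by simp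
    qed simp
    then have "\<bar>W (p + q) t a - W p t a\<bar> \<le> 2 * Q t * (1 / 2) ^ p" for q
      using Q[of t] by (smt (verit) mult_nonneg_nonneg zero_le_power divide_nonneg_nonneg)
    moreover have "(\<lambda>q. \<bar>W (p + q) t a - W p t a\<bar>) \<longlonglongrightarrow> \<bar>Z t a - W p t a\<bar>"
      by (intro tendsto_intros LIMSEQ_ignore_initial_segment[OF lim[OF t], of p, unfolded add.commute[of _ p]])
    ultimately show ?thesis by (intro LIMSEQ_le_const2) auto
  qed
  have ZK: "Z t \<in> K" if "0 \<le> t" for t by (rule closed[of "\<lambda>p. W p t"]) (use WK lim that in auto)
  have half0: "(\<lambda>p. (1 / 2 :: real) ^ p) \<longlonglongrightarrow> 0" by (intro LIMSEQ_power_zero) simp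
  have \<tau>0: "\<tau> \<longlonglongrightarrow> 0"
    using tendsto_mult[OF tendsto_const[of h\<^sub>0] half0] by (simp add: \<tau>_def[abs_def] power_divide)
  have Glim: "(\<lambda>p. G (W p t) a) \<longlonglongrightarrow> G (Z t) a" if t: "0 \<le> t" for t a
  proof (rule LIM_zero_cancel, rule Lim_null_comparison)
    show "\<forall>\<^sub>F p in sequentially. norm (G (W p t) a - G (Z t) a) \<le> L * (2 * Q t * (1 / 2) ^ p)"
      using near[OF t] by (intro always_eventually allI) (auto intro!: lip WK ZK t simp: abs_minus_commute)
    show "(\<lambda>p. L * (2 * Q t * (1 / 2) ^ p)) \<longlonglongrightarrow> 0"
      using tendsto_mult[OF tendsto_const[of "L * (2 * Q t)"] half0] by (simp add: mult_ac)
  qed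
  have jbound: "\<exists>j. idx p (t + h) = idx p t + j \<and> \<bar>real j * \<tau> p - h\<bar> \<le> \<tau> p" if "0 \<le> t" "0 \<le> h" for p t h
  proof (intro exI conjI)
    have "t / \<tau> p \<le> (t + h) / \<tau> p" using that \<tau>(1)[of p] by (simp add: divide_right_mono)
    then have le: "idx p t \<le> idx p (t + h)" unfolding idx_def by (intro nat_mono floor_mono)
    then show "idx p (t + h) = idx p t + (idx p (t + h) - idx p t)" by simp
    show "\<bar>real (idx p (t + h) - idx p t) * \<tau> p - h\<bar> \<le> \<tau> p"
      using idx[of t p] idx[of "t + h" p] that le by (simp add: of_nat_diff algebra_simps abs_le_iff)
  qed
  have Zmove: "\<bar>Z (t + h) a - Z t a\<bar> \<le> C * h" if th: "0 \<le> t" "0 \<le> h" for t h a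
  proof -
    have "\<bar>W p (t + h) a - W p t a\<bar> \<le> (h + \<tau> p) * C" for p
    proof -
      obtain j where j: "idx p (t + h) = idx p t + j" "\<bar>real j * \<tau> p - h\<bar> \<le> \<tau> p" using jbound[OF th] by blast
      have "\<bar>W p (t + h) a - W p t a\<bar> \<le> real j * \<tau> p * C" using move by (simp add: W_def j)
      also have "\<dots> \<le> (h + \<tau> p) * C" using j C by (intro mult_right_mono) auto
      finally show ?thesis .
    qed
    moreover have "(\<lambda>p. \<bar>W p (t + h) a - W p t a\<bar>) \<longlonglongrightarrow> \<bar>Z (t + h) a - Z t a\<bar>"
      by (intro tendsto_intros lim) (use th in auto)
    moreover have "(\<lambda>p. (h + \<tau> p) * C) \<longlonglongrightarrow> (h + 0) * C" by (intro tendsto_intros \<tau>0)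
    ultimately have "\<bar>Z (t + h) a - Z t a\<bar> \<le> (h + 0) * C" by (intro LIMSEQ_le) auto
    then show ?thesis by (simp add: mult_ac)
  qed
  have Zexp: "\<bar>Z (t + h) a - Z t a - h * G (Z t) a\<bar> \<le> L * C * h\<^sup>2" if th: "0 \<le> t" "0 \<le> h" for t h a
  proof -
    have "\<bar>W p (t + h) a - W p t a - h * G (W p t) a\<bar> \<le> L * C * (h + \<tau> p)\<^sup>2 + \<tau> p * C" for p
    proof -
      obtain j where j: "idx p (t + h) = idx p t + j" "\<bar>real j * \<tau> p - h\<bar> \<le> \<tau> p" using jbound[OF th] by blast
      have "\<bar>W p (t + h) a - W p t a - real j * \<tau> p * G (W p t) a\<bar> \<le> L * C * (real j * \<tau> p)\<^sup>2"
        using expand[of p "idx p t" j] by (simp add: W_def j)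
      also have "\<dots> \<le> L * C * (h + \<tau> p)\<^sup>2"
        using j C L \<tau>(1)[of p] by (intro mult_left_mono power_mono) auto
      finally have 1: "\<bar>W p (t + h) a - W p t a - real j * \<tau> p * G (W p t) a\<bar> \<le> L * C * (h + \<tau> p)\<^sup>2" .
      have "\<bar>(real j * \<tau> p - h) * G (W p t) a\<bar> \<le> \<tau> p * C"
        unfolding abs_mult using j(2) bound[OF WK] \<tau>(1)[of p] by (intro mult_mono) auto
      then show ?thesis using 1 by (simp add: algebra_simps)
    qed
    moreover have "(\<lambda>p. \<bar>W p (t + h) a - W p t a - h * G (W p t) a\<bar>) \<longlonglongrightarrow> \<bar>Z (t + h) a - Z t a - h * G (Z t) a\<bar>"
      by (intro tendsto_intros lim Glim) (use th in auto)
    moreover have "(\<lambda>p. L * C * (h + \<tau> p)\<^sup>2 + \<tau> p * C) \<longlonglongrightarrow> L * C * (h + 0)\<^sup>2 + 0 * C" by (intro tendsto_intros \<tau>0)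
    ultimately have "\<bar>Z (t + h) a - Z t a - h * G (Z t) a\<bar> \<le> L * C * (h + 0)\<^sup>2 + 0 * C" by (intro LIMSEQ_le) auto
    then show ?thesis by simp
  qed
  have two_sided: "\<bar>Z s a - Z t a - (s - t) * G (Z t) a\<bar> \<le> 2 * L * C * (s - t)\<^sup>2" if "0 \<le> t" "0 \<le> s" for t s a
  proof (cases "t \<le> s")
    case True
    have "0 \<le> L * C * (s - t)\<^sup>2" using L C by simp
    then show ?thesis using Zexp[of t "s - t" a] that True by simp
  next
    case False
    have "\<bar>G (Z s) a - G (Z t) a\<bar> \<le> L * (C * (t - s))"
      using Zmove[of s "t - s"] that False by (intro lip ZK) (auto simp: abs_minus_commute)
    then have "\<bar>(s - t) * (G (Z s) a - G (Z t) a)\<bar> \<le> (t - s) * (L * (C * (t - s)))"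
      using False by (simp add: abs_mult)
    moreover have "\<bar>Z t a - Z s a - (t - s) * G (Z s) a\<bar> \<le> L * C * (t - s)\<^sup>2"
      using Zexp[of s "t - s" a] that False by simp
    moreover have "(t - s) * (L * (C * (t - s))) = L * C * (t - s)\<^sup>2" by (simp add: power2_eq_square)
    moreover have "Z s a - Z t a - (s - t) * G (Z t) a
      = - (Z t a - Z s a - (t - s) * G (Z s) a) + (s - t) * (G (Z s) a - G (Z t) a)" by (simp add: algebra_simps)
    ultimately show ?thesis by (simp add: power2_commute[of s t])
  qed
  have deriv: "((\<lambda>s. Z s a) has_real_derivative G (Z t) a) (at t within {0..})" if t: "0 \<le> t" for t a
    unfolding has_field_derivative_iff
  proof (rule LIM_zero_cancel, rule Lim_null_comparison)
    have "norm ((Z s a - Z t a) / (s - t) - G (Z t) a) \<le> 2 * L * C * \<bar>s - t\<bar>" if "0 \<le> s" "s \<noteq> t" for s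
    proof -
      have "(Z s a - Z t a) / (s - t) - G (Z t) a = (Z s a - Z t a - (s - t) * G (Z t) a) / (s - t)"
        using that by (simp add: field_simps)
      then have "\<bar>(Z s a - Z t a) / (s - t) - G (Z t) a\<bar> = \<bar>Z s a - Z t a - (s - t) * G (Z t) a\<bar> / \<bar>s - t\<bar>"
        by (simp add: abs_divide)
      also have "\<dots> \<le> 2 * L * C * (s - t)\<^sup>2 / \<bar>s - t\<bar>"
        using two_sided[OF t that(1)] by (intro divide_right_mono) auto
      also have "\<dots> = 2 * L * C * \<bar>s - t\<bar>"
        using that abs_mult_self_eq[of "s - t"] by (simp add: power2_eq_square nonzero_divide_eq_eq)
      finally show ?thesis by simp
    qed
    then show "\<forall>\<^sub>F s in at t within {0..}. norm ((Z s a - Z t a) / (s - t) - G (Z t) a) \<le> 2 * L * C * \<bar>s - t\<bar>"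
      by (auto simp: eventually_at_filter)
    have "((\<lambda>s. 2 * L * C * \<bar>s - t\<bar>) \<longlongrightarrow> 2 * L * C * \<bar>t - t\<bar>) (at t within {0..})"
      by (intro tendsto_intros)
    then show "((\<lambda>s. 2 * L * C * \<bar>s - t\<bar>) \<longlongrightarrow> 0) (at t within {0..})" by simp
  qed
  have "Z 0 = X0"
  proof
    fix a
    have "W p 0 a = X0 a" for p by (simp add: W_def idx_def E0)
    then show "Z 0 a = X0 a" using lim[of 0 a] by (simp add: LIMSEQ_const_iff)
  qed
  then show ?thesis using ZK deriv by blast
qed

section \<open>Smooth step functions\<close>

lemma C_k_add: "C_k k f \<Longrightarrow> C_k k g \<Longrightarrow> C_k k (\<lambda>x. f x + g x)"
proof (induction k arbitrary: f g)
  case (Suc k)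
  have "frechet_derivative (\<lambda>x. f x + g x) (at x) h = frechet_derivative f (at x) h + frechet_derivative g (at x) h" for x h
    proof -
    have "((\<lambda>x. f x + g x) has_derivative (\<lambda>h. frechet_derivative f (at x) h + frechet_derivative g (at x) h)) (at x)"
      using Suc.prems by (intro has_derivative_add) (simp_all flip: frechet_derivative_works)
    from frechet_derivative_at[OF this] show ?thesis by metis
  qed
  then show ?case using Suc by (simp add: differentiable_add)
qed (auto intro: continuous_intros)

lemma C_k_cmult: "C_k k f \<Longrightarrow> C_k k (\<lambda>x. c * f x)"
proof (induction k arbitrary: f)
  case (Suc k)
  have "frechet_derivative (\<lambda>x. c * f x) (at x) h = c * frechet_derivative f (at x) h" for x h
  proof -
    have "(f has_derivative frechet_derivative f (at x)) (at x)"
      using Suc.prems by (simp flip: frechet_derivative_works)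
    then have "((\<lambda>x. c * f x) has_derivative (\<lambda>h. c * frechet_derivative f (at x) h)) (at x)"
      by (rule has_derivative_mult_right)
    from frechet_derivative_at[OF this] show ?thesis by (metis)
  qed
  then show ?case using Suc by (simp add: differentiable_mult)
qed (auto intro: continuous_intros)

lemma C_k_Suc_D: "C_k (Suc k) f \<Longrightarrow> C_k k f"
proof (induction k arbitrary: f)
  case 0
  then show ?case
    by (auto intro!: differentiable_imp_continuous_on simp: differentiable_on_def)
next
  case (Suc k)
  then show ?case by (auto simp del: C_k.simps(2) simp: C_k.simps(2)[of "Suc k"]) (simp add: Suc)
qed

lemma C_k_mult: "C_k k f \<Longrightarrow> C_k k g \<Longrightarrow> C_k k (\<lambda>x. f x * g x)"
proof (induction k arbitrary: f g)
  case (Suc k)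
  have "frechet_derivative (\<lambda>x. f x * g x) (at x) h
      = f x * frechet_derivative g (at x) h + frechet_derivative f (at x) h * g x" for x h
  proof -
    have "((\<lambda>x. f x * g x) has_derivative
       (\<lambda>h. f x * frechet_derivative g (at x) h + frechet_derivative f (at x) h * g x)) (at x)"
      using Suc.prems by (intro has_derivative_mult) (simp_all flip: frechet_derivative_works)
    from frechet_derivative_at[OF this] show ?thesis by metis
  qed
  then show ?case
    using Suc C_k_Suc_D[OF Suc.prems(1)] C_k_Suc_D[OF Suc.prems(2)]
    by (simp add: differentiable_mult C_k_add)
qed (auto intro: continuous_intros)

lemma C_k_Suc_real:
  fixes f :: "real \<Rightarrow> real"
  assumes f: "\<And>x. (f has_real_derivative f' x) (at x)" and f': "C_k k f'"
  shows "C_k (Suc k) f"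
proof -
  have "frechet_derivative f (at x) h = h * f' x" for x h
  proof -
    have "(f has_derivative (\<lambda>h. h * f' x)) (at x)" using f[of x] by (simp add: has_field_derivative_def mult.commute[of _ "f' x"])
    from frechet_derivative_at[OF this] show ?thesis by metis
  qed
  moreover have "f differentiable at x" for x using f real_differentiable_def by blast
  ultimately show ?thesis using C_k_cmult[OF f'] by simp
qed

lemma C_k_compose_affine:
  fixes f :: "real \<Rightarrow> real" and l :: "'a::euclidean_space \<Rightarrow> real"
  assumes l: "bounded_linear l" and f: "C_k k f"
  shows "C_k k (\<lambda>x. f (l x + c))"
  using f
proof (induction k arbitrary: f)
  case 0
  then show ?case
    by (auto intro!: continuous_on_compose2[of UNIV f] continuous_on_add linear_continuous_on[OF l])
next
  case (Suc k)
  have d: "((\<lambda>x. f (l x + c)) has_derivative (\<lambda>h. l h * frechet_derivative f (at (l x + c)) 1)) (at x)" for x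
  proof -
    have 1: "(f has_derivative frechet_derivative f (at (l x + c))) (at (l x + c))"
      using Suc.prems by (simp flip: frechet_derivative_works)
    have "((\<lambda>x. l x + c) has_derivative l) (at x)"
      using bounded_linear_imp_has_derivative[OF l] by (auto intro!: derivative_eq_intros)
    from has_derivative_compose[OF this 1]
    have "((\<lambda>x. f (l x + c)) has_derivative (\<lambda>h. frechet_derivative f (at (l x + c)) (l h))) (at x)" .
    moreover have "frechet_derivative f (at (l x + c)) (l h) = l h * frechet_derivative f (at (l x + c)) 1" for h
      using linear_cmul[OF has_derivative_linear[OF 1], of "l h" 1] by simp
    ultimately show ?thesis by simp
  qed
  have "C_k k (\<lambda>x. frechet_derivative f (at (l x + c)) 1)"
    using Suc.prems by (intro Suc.IH) simp
  moreover have "frechet_derivative (\<lambda>x. f (l x + c)) (at x) h = l h * frechet_derivative f (at (l x + c)) 1" for x h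
    using frechet_derivative_at[OF d] by metis
  moreover have "(\<lambda>x. f (l x + c)) differentiable at x" for x
    using d differentiable_def by blast
  ultimately show ?case by (simp add: C_k_cmult)
qed

definition flat_fun :: "nat \<Rightarrow> real \<Rightarrow> real" where
  "flat_fun j x = (if 0 < x then (1 / x) ^ j * exp (- (1 / x)) else 0)"

lemma tendsto_flat_0: "(flat_fun j \<longlongrightarrow> 0) (at 0)"
proof -
  have "((\<lambda>y::real. y ^ j / exp y) \<longlongrightarrow> 0) at_top" by (rule tendsto_power_div_exp_0)
  from filterlim_compose[OF this filterlim_inverse_at_top_right]
  have "((\<lambda>x::real. inverse x ^ j / exp (inverse x)) \<longlongrightarrow> 0) (at_right 0)" .
  then have "(flat_fun j \<longlongrightarrow> 0) (at_right 0)"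
    by (rule Lim_transform_eventually)
       (auto simp: flat_fun_def eventually_at_filter exp_minus field_simps)
  moreover have "(flat_fun j \<longlongrightarrow> 0) (at_left 0)"
    by (rule Lim_transform_eventually[OF tendsto_const]) (auto simp: flat_fun_def eventually_at_filter)
  ultimately show ?thesis by (rule filterlim_split_at[rotated])
qed

lemma flat_deriv: "(flat_fun j has_real_derivative flat_fun (j + 2) x - real j * flat_fun (j + 1) x) (at x)"
proof -
  consider "x < 0" | "x = 0" | "0 < x" by linarith
  then show ?thesis
  proof cases
    case 1
    have "((\<lambda>_. 0) has_real_derivative 0) (at x)" by simp
    then have "(flat_fun j has_real_derivative 0) (at x)"
      by (rule DERIV_cong_ev[THEN iffD1, rotated 3])
         (use 1 eventually_nhds_in_open[of "{..<0}" x] in \<open>auto simp: flat_fun_def elim!: eventually_mono\<close>)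
    then show ?thesis using 1 by (simp add: flat_fun_def)
  next
    case 2
    have "((\<lambda>y. (flat_fun j y - flat_fun j 0) / (y - 0)) \<longlongrightarrow> 0) (at 0)"
      by (rule Lim_transform_eventually[OF tendsto_flat_0[of "Suc j"]])
         (auto simp: flat_fun_def eventually_at_filter field_simps)
    then show ?thesis using 2 by (simp add: has_field_derivative_iff flat_fun_def)
  next
    case 3
    have pred: "i = 0 \<or> x ^ i = x * x ^ (i - Suc 0)" for i by (cases i) auto
    have "((\<lambda>x. (1 / x) ^ j * exp (- (1 / x))) has_real_derivative flat_fun (j + 2) x - real j * flat_fun (j + 1) x) (at x)"
    proof (cases j)
      case (Suc i)
      then show ?thesis
        using 3 pred[of i] by (auto intro!: derivative_eq_intros simp: flat_fun_def field_simps power2_eq_square)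
    qed (use 3 in \<open>auto intro!: derivative_eq_intros simp: flat_fun_def field_simps power2_eq_square\<close>)
    then show ?thesis
      by (rule DERIV_cong_ev[THEN iffD1, rotated 3])
         (use 3 eventually_nhds_in_open[of "{0<..}" x] in \<open>auto simp: flat_fun_def elim!: eventually_mono\<close>)
  qed
qed

lemma C_k_flat: "C_k k (flat_fun j)"
proof (induction k arbitrary: j)
  case 0
  show ?case using DERIV_isCont[OF flat_deriv] by (simp add: continuous_at_imp_continuous_on)
next
  case (Suc k)
  show ?case
    using C_k_add[OF Suc C_k_cmult[OF Suc, where c = "- real j"]] by (intro C_k_Suc_real[OF flat_deriv]) simp
qed

lemma smooth_step_exists:
  "\<exists>B B' :: real \<Rightarrow> real. C_infinity B \<and> continuous_on UNIV B' \<and> (\<forall>x. (B has_real_derivative B' x) (at x)) \<and>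
     (\<forall>x. 0 \<le> B' x) \<and> (\<forall>x\<le>0. B x = 0) \<and> (\<forall>x\<ge>1. B x = 1) \<and> (\<forall>x. x \<notin> {0<..<1} \<longrightarrow> B' x = 0)"
proof -
  define b where "b x = flat_fun 0 x * flat_fun 0 ((- 1) * x + 1)" for x
  have C_b: "C_k k b" for k
    unfolding b_def by (intro C_k_mult C_k_flat C_k_compose_affine bounded_linear_mult_right)
  have cont: "continuous_on A b" for A using C_b[of 0] continuous_on_subset by auto
  have b0: "0 \<le> b x" for x by (simp add: b_def flat_fun_def)
  have bz: "b x = 0" if "x \<notin> {0<..<1}" for x using that by (auto simp: b_def flat_fun_def)
  define Z where "Z = integral {0..1} b"
  have int: "b integrable_on {c..d}" for c d using cont by (rule integrable_continuous_interval)
  have Z: "0 < Z"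
  proof -
    have "Z \<noteq> 0"
    proof
      assume "Z = 0"
      then have "b (1/2) = 0"
        using integral_eq_0_iff[of 0 1 b] cont b0 by (auto simp: Z_def)
      then show False by (simp add: b_def flat_fun_def)
    qed
    moreover have "0 \<le> Z" unfolding Z_def by (intro integral_nonneg int b0)
    ultimately show ?thesis by simp
  qed
  define B where "B x = (integral {-1..x} b) / Z" for x
  have z: "integral {c..x} b = 0" if "x \<le> 0 \<or> 1 \<le> c" for c x
    using integral_cong[of "{c..x}" b "\<lambda>_. 0"] bz that by force
  have dB: "(B has_real_derivative b x / Z) (at x)" for x
  proof (cases "x \<le> -1")
    case True
    have "((\<lambda>_. 0) has_real_derivative 0) (at x)" by simp
    then have "(B has_real_derivative 0) (at x)"
      by (rule DERIV_cong_ev[THEN iffD1, rotated 3])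
         (use True z eventually_nhds_in_open[of "{..<0}" x] in \<open>auto simp: B_def elim!: eventually_mono\<close>)
    then show ?thesis using True bz by simp
  next
    case False
    have "((\<lambda>u. integral {-1..u} b) has_real_derivative b x) (at x within {-1..x+1})"
      using False by (intro integral_has_real_derivative cont) auto
    then have "((\<lambda>u. integral {-1..u} b) has_real_derivative b x) (at x)"
      using False at_within_interior[of x "{-1..x+1}"] by simp
    then show ?thesis unfolding B_def[abs_def] by (rule DERIV_cdivide)
  qed
  have "C_infinity B"
    unfolding C_infinity_def
  proof
    fix k
    have "C_k k (\<lambda>x. b x / Z)" using C_k_cmult[OF C_b[of k], of "1 / Z"] by simp
    from C_k_Suc_real[OF dB this] show "C_k k B" by (rule C_k_Suc_D)
  qed
  moreover have "B x = 1" if "1 \<le> x" for x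
  proof -
    have "integral {-1..x} b = integral {-1..0} b + (integral {0..1} b + integral {1..x} b)"
      using that by (simp add: Henstock_Kurzweil_Integration.integral_combine int)
    then show ?thesis using Z by (simp add: B_def z flip: Z_def)
  qed
  moreover have "continuous_on UNIV (\<lambda>x. b x / Z)" using Z cont by (intro continuous_intros) auto
  ultimately show ?thesis
    using dB b0 Z bz z by (intro exI[of _ B] exI[of _ "\<lambda>x. b x / Z"]) (auto simp: B_def)
qed

section \<open>Curves of compactly supported measures\<close>

lemma P_c_real_distribution: "\<mu> \<in> P_c \<Longrightarrow> real_distribution \<mu>"
  by (auto simp: P_c_def real_distribution_def real_distribution_axioms_def intro: sets_eq_imp_space_eq)

lemma W_inf_nonneg: "0 \<le> W_inf \<mu> \<nu>"
  unfolding W_inf_def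
proof (rule INF_greatest)
  fix \<pi> assume "\<pi> \<in> couplings \<mu> \<nu>"
  then have p: "prob_space \<pi>" "sets \<pi> = sets borel" by (auto simp: couplings_def)
  have [measurable_cong]: "sets \<pi> = sets (borel \<Otimes>\<^sub>M borel)" unfolding p(2) borel_prod ..
  have "esssup \<pi> (\<lambda>_. 0) \<le> esssup \<pi> (\<lambda>(x, y). ereal \<bar>x - y\<bar>)"
    by (rule esssup_mono) (auto simp: case_prod_beta)
  then show "0 \<le> esssup \<pi> (\<lambda>(x, y). ereal \<bar>x - y\<bar>)"
    using p(1) by (subst (asm) esssup_const) (auto simp: prob_space.emeasure_space_1)
qed

lemma W_inf_less_coupling:
  assumes "W_inf \<mu> \<nu> < ereal d"
  shows "\<exists>\<pi>\<in>couplings \<mu> \<nu>. AE z in \<pi>. \<bar>fst z - snd z\<bar> \<le> d"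
proof -
  obtain \<pi> where \<pi>: "\<pi> \<in> couplings \<mu> \<nu>" "esssup \<pi> (\<lambda>(x, y). ereal \<bar>x - y\<bar>) < ereal d"
    using assms by (auto simp: W_inf_def INF_less_iff)
  have "AE z in \<pi>. (case z of (x, y) \<Rightarrow> ereal \<bar>x - y\<bar>) \<le> esssup \<pi> (\<lambda>(x, y). ereal \<bar>x - y\<bar>)"
    by (rule esssup_AE)
  then have "AE z in \<pi>. \<bar>fst z - snd z\<bar> \<le> d"
  proof eventually_elim
    case (elim z)
    from le_less_trans[OF elim \<pi>(2)] show ?case by (simp add: case_prod_beta)
  qed
  then show ?thesis using \<pi>(1) by blast
qed

lemma W_inf_distr_le:
  assumes P: "prob_space P" and [measurable]: "X \<in> borel_measurable P" "Y \<in> borel_measurable P"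
    and d: "\<And>a. a \<in> space P \<Longrightarrow> \<bar>X a - Y a\<bar> \<le> d"
  shows "W_inf (distr P borel X) (distr P borel Y) \<le> ereal d"
proof -
  interpret prob_space P by fact
  let ?\<pi> = "distr P borel (\<lambda>a. (X a, Y a))"
  have [measurable]: "(\<lambda>a. (X a, Y a)) \<in> P \<rightarrow>\<^sub>M borel" unfolding borel_prod[symmetric] by simp
  have [measurable]: "fst \<in> borel_measurable (borel :: (real \<times> real) measure)"
    "snd \<in> borel_measurable (borel :: (real \<times> real) measure)"
    by (auto intro!: borel_measurable_continuous_onI continuous_intros)
  have m: "(\<lambda>(x, y). ereal \<bar>x - y\<bar>) \<in> borel_measurable (borel :: (real \<times> real) measure)"
    unfolding borel_prod[symmetric] by measurable
  have "?\<pi> \<in> couplings (distr P borel X) (distr P borel Y)"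
    by (auto simp: couplings_def distr_distr comp_def intro!: prob_space_distr)
  then have "W_inf (distr P borel X) (distr P borel Y) \<le> esssup ?\<pi> (\<lambda>(x, y). ereal \<bar>x - y\<bar>)"
    unfolding W_inf_def by (rule INF_lower)
  also have "\<dots> \<le> ereal d"
  proof (rule esssup_I)
    show "AE z in ?\<pi>. (case z of (x, y) \<Rightarrow> ereal \<bar>x - y\<bar>) \<le> ereal d"
      using d m by (subst AE_distr_iff) (auto simp: case_prod_beta)
  qed (use m in simp)
  finally show ?thesis .
qed

lemma distr_curve_C0_P_c:
  assumes P: "prob_space P" and X[measurable]: "\<And>t. t \<in> {0..T} \<Longrightarrow> X t \<in> borel_measurable P"
    and bounded: "\<And>t. t \<in> {0..T} \<Longrightarrow> \<exists>R. \<forall>a\<in>space P. \<bar>X t a\<bar> \<le> R"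
    and lip: "\<And>s t a. s \<in> {0..T} \<Longrightarrow> t \<in> {0..T} \<Longrightarrow> a \<in> space P \<Longrightarrow> \<bar>X s a - X t a\<bar> \<le> C * \<bar>s - t\<bar>"
  shows "(\<lambda>t. distr P borel (X t)) \<in> C0_P_c T"
  unfolding C0_P_c_def mem_Collect_eq
proof (intro ballI conjI)
  fix t assume t: "t \<in> {0..T}"
  interpret prob_space P by fact
  obtain R where R: "\<forall>a\<in>space P. \<bar>X t a\<bar> \<le> R" using bounded[OF t] by blast
  have "AE x in distr P borel (X t). x \<in> {-R..R}"
    using R X[OF t] by (subst AE_distr_iff) (auto simp: abs_le_iff minus_le_iff intro!: AE_I2)
  then show "distr P borel (X t) \<in> P_c"
    using X[OF t] compact_Icc[of "-R" R] unfolding P_c_def by (auto intro!: prob_space_distr exI[of _ "{-R..R}"])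
  show "((\<lambda>s. W_inf (distr P borel (X s)) (distr P borel (X t))) \<longlongrightarrow> 0) (at t within {0..T})"
  proof (rule tendsto_sandwich[of "\<lambda>_. 0"])
    show "\<forall>\<^sub>F s in at t within {0..T}. W_inf (distr P borel (X s)) (distr P borel (X t)) \<le> ereal (C * \<bar>s - t\<bar>)"
      using t by (auto simp: eventually_at_filter intro!: always_eventually W_inf_distr_le P X lip)
    have "((\<lambda>s. ereal (C * \<bar>s - t\<bar>)) \<longlongrightarrow> ereal (C * \<bar>t - t\<bar>)) (at t within {0..T})"
      by (intro tendsto_intros)
    then show "((\<lambda>s. ereal (C * \<bar>s - t\<bar>)) \<longlongrightarrow> 0) (at t within {0..T})" by (simp add: zero_ereal_def)
  qed (simp_all add: W_inf_nonneg)
qed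

lemma coupling_cdf_le:
  assumes \<pi>: "\<pi> \<in> couplings \<mu> \<nu>" and d: "AE z in \<pi>. \<bar>fst z - snd z\<bar> \<le> d"
  shows "cdf \<mu> x \<le> cdf \<nu> (x + d)" "cdf \<nu> x \<le> cdf \<mu> (x + d)"
proof -
  have p: "prob_space \<pi>" "sets \<pi> = sets borel" and e: "\<mu> = distr \<pi> borel fst" "\<nu> = distr \<pi> borel snd"
    using \<pi> by (auto simp: couplings_def)
  have [measurable_cong]: "sets \<pi> = sets (borel \<Otimes>\<^sub>M borel)" unfolding p(2) borel_prod ..
  interpret prob_space \<pi> by fact
  have [simp]: "space \<pi> = UNIV" using sets_eq_imp_space_eq[OF p(2)] by simp
  have c: "cdf \<mu> y = measure \<pi> {z. fst z \<le> y}" "cdf \<nu> y = measure \<pi> {z. snd z \<le> y}" for y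
    unfolding e cdf_def by (simp_all add: measure_distr vimage_def)
  have [measurable]: "{z. fst z \<le> y} \<in> sets \<pi>" "{z. snd z \<le> y} \<in> sets \<pi>" for y
    using measurable_sets[of fst \<pi> borel "{..y}"] measurable_sets[of snd \<pi> borel "{..y}"]
    by (simp_all add: vimage_def)
  have "measure \<pi> {z. fst z \<le> x} \<le> measure \<pi> {z. snd z \<le> x + d}"
    by (rule finite_measure_mono_AE) (use d in \<open>auto elim!: eventually_mono\<close>)
  then show "cdf \<mu> x \<le> cdf \<nu> (x + d)" by (simp add: c)
  have "measure \<pi> {z. snd z \<le> x} \<le> measure \<pi> {z. fst z \<le> x + d}"
    by (rule finite_measure_mono_AE) (use d in \<open>auto elim!: eventually_mono\<close>)
  then show "cdf \<nu> x \<le> cdf \<mu> (x + d)" by (simp add: c)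
qed

lemma coupling_integral_diff:
  fixes f :: "real \<Rightarrow> real"
  assumes \<pi>: "\<pi> \<in> couplings \<mu> \<nu>" and d: "AE z in \<pi>. \<bar>fst z - snd z\<bar> \<le> d"
    and f[measurable]: "f \<in> borel_measurable borel" and B: "\<And>x. \<bar>f x\<bar> \<le> B"
    and L: "0 \<le> L" "\<And>x y. \<bar>f x - f y\<bar> \<le> L * \<bar>x - y\<bar>"
  shows "\<bar>(LINT x|\<mu>. f x) - (LINT x|\<nu>. f x)\<bar> \<le> L * d"
proof -
  have p: "prob_space \<pi>" "sets \<pi> = sets borel" and e: "\<mu> = distr \<pi> borel fst" "\<nu> = distr \<pi> borel snd"
    using \<pi> by (auto simp: couplings_def)
  have [measurable_cong]: "sets \<pi> = sets (borel \<Otimes>\<^sub>M borel)" unfolding p(2) borel_prod ..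
  interpret prob_space \<pi> by fact
  have int: "integrable \<pi> (\<lambda>z. f (fst z))" "integrable \<pi> (\<lambda>z. f (snd z))"
    by (rule integrable_const_bound[of _ B]; use B in auto)+
  have "(LINT x|\<mu>. f x) - (LINT x|\<nu>. f x) = (LINT z|\<pi>. f (fst z) - f (snd z))"
    unfolding e using int by (simp add: integral_distr)
  also have "\<bar>\<dots>\<bar> \<le> (LINT z|\<pi>. \<bar>f (fst z) - f (snd z)\<bar>)"
    by (rule integral_abs_bound)
  also have "\<dots> \<le> (LINT z|\<pi>. L * d)"
  proof (rule integral_mono_AE)
    show "AE z in \<pi>. \<bar>f (fst z) - f (snd z)\<bar> \<le> L * d"
      using d
    proof eventually_elim
      case (elim z)
      have "\<bar>f (fst z) - f (snd z)\<bar> \<le> L * \<bar>fst z - snd z\<bar>" by (rule L)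
      also have "\<dots> \<le> L * d" using elim L by (intro mult_left_mono)
      finally show ?case .
    qed
  qed (use int in auto)
  finally show ?thesis by (simp add: prob_space)
qed

lemma coupling_support:
  assumes \<pi>: "\<pi> \<in> couplings \<mu> \<nu>" and d: "AE z in \<pi>. \<bar>fst z - snd z\<bar> \<le> d"
    and R: "AE x in \<nu>. \<bar>x\<bar> \<le> R"
  shows "AE x in \<mu>. \<bar>x\<bar> \<le> R + d"
proof -
  have p: "prob_space \<pi>" "sets \<pi> = sets borel" and e: "\<mu> = distr \<pi> borel fst" "\<nu> = distr \<pi> borel snd"
    using \<pi> by (auto simp: couplings_def)
  have [measurable_cong]: "sets \<pi> = sets (borel \<Otimes>\<^sub>M borel)" unfolding p(2) borel_prod ..
  have "AE z in \<pi>. \<bar>snd z\<bar> \<le> R" using R unfolding e by (subst (asm) AE_distr_iff) auto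
  with d have "AE z in \<pi>. \<bar>fst z\<bar> \<le> R + d" by eventually_elim auto
  then show ?thesis unfolding e by (subst AE_distr_iff) auto
qed

lemma C0_P_c_coupling:
  assumes \<sigma>: "\<sigma> \<in> C0_P_c T" and t: "t \<in> {0..T}" and d: "0 < d"
  shows "\<exists>\<delta>>0. \<forall>s\<in>{0..T}. \<bar>s - t\<bar> < \<delta> \<longrightarrow> (\<exists>\<pi>\<in>couplings (\<sigma> s) (\<sigma> t). AE z in \<pi>. \<bar>fst z - snd z\<bar> \<le> d)"
proof -
  have "((\<lambda>s. W_inf (\<sigma> s) (\<sigma> t)) \<longlongrightarrow> 0) (at t within {0..T})" using \<sigma> t by (simp add: C0_P_c_def)
  then have "\<forall>\<^sub>F s in at t within {0..T}. W_inf (\<sigma> s) (\<sigma> t) < ereal d"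
    by (rule order_tendstoD) (use d in simp)
  then obtain \<delta> where \<delta>: "0 < \<delta>" "\<And>s. s \<in> {0..T} \<Longrightarrow> s \<noteq> t \<Longrightarrow> dist s t < \<delta> \<Longrightarrow> W_inf (\<sigma> s) (\<sigma> t) < ereal d"
    unfolding eventually_at by blast
  have "W_inf (\<sigma> t) (\<sigma> t) < ereal d"
  proof -
    interpret real_distribution "\<sigma> t" using \<sigma> t by (intro P_c_real_distribution) (simp add: C0_P_c_def)
    have "W_inf (distr (\<sigma> t) borel (\<lambda>x. x)) (distr (\<sigma> t) borel (\<lambda>x. x)) \<le> ereal 0"
      by (intro W_inf_distr_le) (auto intro: prob_space_axioms)
    moreover have "distr (\<sigma> t) borel (\<lambda>x. x) = \<sigma> t" by (rule distr_id2) simp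
    ultimately show ?thesis using d by (auto simp flip: zero_ereal_def intro: le_less_trans)
  qed
  then have "W_inf (\<sigma> s) (\<sigma> t) < ereal d" if "s \<in> {0..T}" "\<bar>s - t\<bar> < \<delta>" for s
    using \<delta>(2)[of s] that by (cases "s = t") (auto simp: dist_real_def)
  then show ?thesis using \<delta>(1) W_inf_less_coupling by blast
qed

lemma C0_P_c_uniform_support:
  assumes \<sigma>: "\<sigma> \<in> C0_P_c T"
  shows "\<exists>R. \<forall>t\<in>{0..T}. AE x in \<sigma> t. \<bar>x\<bar> \<le> R"
proof -
  have "\<exists>\<delta>>0. \<exists>R. \<forall>s\<in>{0..T}. \<bar>s - t\<bar> < \<delta> \<longrightarrow> (AE x in \<sigma> s. \<bar>x\<bar> \<le> R)" if t: "t \<in> {0..T}" for t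
  proof -
    have "\<sigma> t \<in> P_c" using \<sigma> t by (simp add: C0_P_c_def)
    then obtain K where K: "compact K" "AE x in \<sigma> t. x \<in> K" by (auto simp: P_c_def)
    then obtain R where R: "\<forall>x\<in>K. \<bar>x\<bar> \<le> R" using compact_imp_bounded bounded_real by blast
    have "AE x in \<sigma> t. \<bar>x\<bar> \<le> R" using K(2) by eventually_elim (use R in auto)
    obtain \<delta> where "0 < \<delta>" and \<delta>: "\<And>s. s \<in> {0..T} \<Longrightarrow> \<bar>s - t\<bar> < \<delta> \<Longrightarrow>
        \<exists>\<pi>\<in>couplings (\<sigma> s) (\<sigma> t). AE z in \<pi>. \<bar>fst z - snd z\<bar> \<le> 1"
      using C0_P_c_coupling[OF \<sigma> t zero_less_one] by blast
    moreover have "AE x in \<sigma> s. \<bar>x\<bar> \<le> R + 1" if "s \<in> {0..T}" "\<bar>s - t\<bar> < \<delta>" for s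
      using \<delta>[OF that] coupling_support[OF _ _ \<open>AE x in \<sigma> t. \<bar>x\<bar> \<le> R\<close>] by blast
    ultimately show ?thesis by blast
  qed
  then obtain \<delta> R where \<delta>: "\<And>t. t \<in> {0..T} \<Longrightarrow> 0 < \<delta> t"
    and R: "\<And>t s. t \<in> {0..T} \<Longrightarrow> s \<in> {0..T} \<Longrightarrow> \<bar>s - t\<bar> < \<delta> t \<Longrightarrow> AE x in \<sigma> s. \<bar>x\<bar> \<le> R t" by metis
  obtain D where D: "D \<subseteq> {0..T}" "finite D" "{0..T} \<subseteq> (\<Union>t\<in>D. ball t (\<delta> t))"
  proof (rule compactE_image[of "{0..T}" "{0..T}" "\<lambda>t. ball t (\<delta> t)"])
    show "{0..T} \<subseteq> (\<Union>t\<in>{0..T}. ball t (\<delta> t))" using \<delta> by force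
  qed auto
  have "AE x in \<sigma> s. \<bar>x\<bar> \<le> (\<Sum>t\<in>D. \<bar>R t\<bar>)" if s: "s \<in> {0..T}" for s
  proof -
    obtain t where t: "t \<in> D" "dist t s < \<delta> t" using D(3) s by auto
    have "R t \<le> (\<Sum>t\<in>D. \<bar>R t\<bar>)" using t D(2) member_le_sum[of t D "\<lambda>t. \<bar>R t\<bar>"] by force
    moreover have "AE x in \<sigma> s. \<bar>x\<bar> \<le> R t" using t s D(1) by (intro R) (auto simp: dist_real_def abs_minus_commute)
    ultimately show ?thesis by (auto elim!: eventually_mono)
  qed
  then show ?thesis by blast
qed

lemma C0_P_c_measurable:
  assumes \<sigma>: "\<sigma> \<in> C0_P_c T" and T: "0 \<le> T"
  shows "(\<lambda>t. \<sigma> (max 0 (min T t))) \<in> borel \<rightarrow>\<^sub>M subprob_algebra borel"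
proof -
  let ?c = "\<lambda>t. max 0 (min T t)"
  have c: "?c t \<in> {0..T}" for t using T by auto
  have rd: "real_distribution (\<sigma> (?c t))" for t
    using \<sigma> c by (intro P_c_real_distribution) (simp add: C0_P_c_def)
  have "(\<lambda>t. cdf (\<sigma> (?c t)) x) \<in> borel_measurable borel" for x
    unfolding borel_measurable_iff_less
  proof
    fix a
    have "open {t. cdf (\<sigma> (?c t)) x < a}"
      unfolding open_dist
    proof safe
      fix t assume a: "cdf (\<sigma> (?c t)) x < a"
      interpret real_distribution "\<sigma> (?c t)" by (rule rd)
      have "(cdf (\<sigma> (?c t)) \<longlongrightarrow> cdf (\<sigma> (?c t)) x) (at_right x)"
        using cdf_is_right_cont[of x] by (simp add: continuous_within)
      then have "\<forall>\<^sub>F y in at_right x. cdf (\<sigma> (?c t)) y < a" using a by (rule order_tendstoD)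
      then obtain b where b: "x < b" "\<And>y. x < y \<Longrightarrow> y < b \<Longrightarrow> cdf (\<sigma> (?c t)) y < a"
        by (auto simp: eventually_at_right_field)
      define d where "d = (b - x) / 2"
      have d: "0 < d" "cdf (\<sigma> (?c t)) (x + d) < a" using b by (auto simp: d_def field_simps)
      obtain \<delta> where \<delta>: "0 < \<delta>" "\<And>s. s \<in> {0..T} \<Longrightarrow> \<bar>s - ?c t\<bar> < \<delta> \<Longrightarrow>
          \<exists>\<pi>\<in>couplings (\<sigma> s) (\<sigma> (?c t)). AE z in \<pi>. \<bar>fst z - snd z\<bar> \<le> d"
        using C0_P_c_coupling[OF \<sigma> c[of t] d(1)] by blast
      have "cdf (\<sigma> (?c s)) x < a" if "dist s t < \<delta>" for s
      proof -
        have "\<bar>?c s - ?c t\<bar> \<le> \<bar>s - t\<bar>" by (auto simp: max_def min_def)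
        then have "\<bar>?c s - ?c t\<bar> < \<delta>" using that by (simp add: dist_real_def)
        then obtain \<pi> where "\<pi> \<in> couplings (\<sigma> (?c s)) (\<sigma> (?c t))" "AE z in \<pi>. \<bar>fst z - snd z\<bar> \<le> d"
          using \<delta>(2) c by blast
        from coupling_cdf_le(1)[OF this, of x] d(2) show ?thesis by linarith
      qed
      then show "\<exists>e>0. \<forall>s. dist s t < e \<longrightarrow> s \<in> {t. cdf (\<sigma> (?c t)) x < a}" using \<delta>(1) by auto
    qed
    then show "{t \<in> space borel. cdf (\<sigma> (?c t)) x < a} \<in> sets borel" by simp
  qed
  then have "(\<lambda>t. ennreal (cdf (\<sigma> (?c t)) x)) \<in> borel_measurable borel" for x by measurable
  moreover have "ennreal (cdf (\<sigma> (?c t)) x) = emeasure (\<sigma> (?c t)) {..x}" for x t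
  proof -
    interpret real_distribution "\<sigma> (?c t)" by (rule rd)
    show ?thesis by (simp add: cdf_def emeasure_eq_measure)
  qed
  ultimately have m: "(\<lambda>t. emeasure (\<sigma> (?c t)) {..x}) \<in> borel_measurable borel" for x by simp
  show ?thesis
  proof (rule measurable_prob_algebraD, rule measurable_prob_algebra_generated[where \<Omega> = UNIV and G = "range atMost"])
    show "sets borel = sigma_sets UNIV (range (atMost :: real \<Rightarrow> _))"
      by (subst borel_eq_atMost) simp
    show "Int_stable (range (atMost :: real \<Rightarrow> _))" by (auto simp: Int_stable_def)
    show "prob_space (\<sigma> (?c a))" "sets (\<sigma> (?c a)) = sets borel" for a
      using rd[of a] by (auto simp: real_distribution_def real_distribution_axioms_def)
    show "(\<lambda>a. emeasure (\<sigma> (?c a)) A) \<in> borel_measurable borel" if "A \<in> range atMost" for A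
      using that m by (elim rangeE) (simp only:)
  qed simp
qed

lemma bounded_integral_measurable_kernel:
  assumes L: "L \<in> M \<rightarrow>\<^sub>M subprob_algebra N" and f[measurable]: "(\<lambda>(x, y). f x y) \<in> borel_measurable (M \<Otimes>\<^sub>M N)"
    and B: "\<And>x y. \<bar>f x y\<bar> \<le> (B :: real)"
  shows "(\<lambda>x. LINT y|L x. f x y) \<in> borel_measurable M"
proof -
  have m: "(\<lambda>x. (enn2real (\<integral>\<^sup>+y. ennreal (f x y) \<partial>L x)) - enn2real (\<integral>\<^sup>+y. ennreal (- f x y) \<partial>L x)) \<in> borel_measurable M"
    by (intro borel_measurable_diff borel_measurable_enn2real nn_integral_measurable_subprob_algebra2[OF _ L]) auto
  have "(LINT y|L x. f x y) = enn2real (\<integral>\<^sup>+y. ennreal (f x y) \<partial>L x) - enn2real (\<integral>\<^sup>+y. ennreal (- f x y) \<partial>L x)"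
    if x: "x \<in> space M" for x
  proof (rule real_lebesgue_integral_def)
    have "L x \<in> space (subprob_algebra N)" using L x by (rule measurable_space)
    then interpret subprob_space "L x" by (simp add: space_subprob_algebra)
    have [measurable_cong]: "sets (L x) = sets N" using \<open>L x \<in> space (subprob_algebra N)\<close> by (simp add: space_subprob_algebra)
    have [measurable]: "f x \<in> borel_measurable N" using measurable_Pair2[OF f x] by simp
    show "integrable (L x) (f x)"
      using B by (intro integrable_const_bound[of _ B]) simp_all
  qed
  then show ?thesis using m by (simp cong: measurable_cong)
qed

section \<open>The nonlocal velocity\<close>

locale nonlocal_flux =
  fixes v w :: "real \<Rightarrow> real" and \<eta> Lv :: real
  assumes v_nonneg: "\<And>x. x \<in> {0..1} \<Longrightarrow> 0 \<le> v x" and v_lip: "Lv-lipschitz_on {0..1} v"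
    and v_anti: "antimono_on {0..1} v" and v_1: "v 1 = 0" and \<eta>: "0 < \<eta>"
    and w_nonneg: "\<And>x. x \<in> {0..\<eta>} \<Longrightarrow> 0 \<le> w x" and w_anti: "antimono_on {0..\<eta>} w"
    and w_cont: "continuous_on {0..\<eta>} w"
begin

abbreviation "V \<equiv> extend_v v"

definition S :: "real measure \<Rightarrow> real \<Rightarrow> real" where
  "S \<mu> x = (LINT y:{x..x+\<eta>}|\<mu>. w (y - x))"

lemma Lv_nonneg: "0 \<le> Lv" using v_lip by (rule lipschitz_on_nonneg)

lemma v_mono: "0 \<le> x \<Longrightarrow> x \<le> y \<Longrightarrow> y \<le> 1 \<Longrightarrow> v y \<le> v x"
  using v_anti by (auto simp: monotone_on_def)

lemma w_mono: "0 \<le> x \<Longrightarrow> x \<le> y \<Longrightarrow> y \<le> \<eta> \<Longrightarrow> w y \<le> w x"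
  using w_anti by (auto simp: monotone_on_def)

lemma w0: "0 \<le> w 0" using w_nonneg[of 0] \<eta> by simp

lemma V_nonneg: "0 \<le> x \<Longrightarrow> 0 \<le> V x" by (auto simp: extend_v_def v_nonneg)

lemma V_antimono: "0 \<le> x \<Longrightarrow> x \<le> y \<Longrightarrow> V y \<le> V x"
  using v_mono[of x y] v_nonneg[of x] by (auto simp: extend_v_def)

lemma V_le: "0 \<le> x \<Longrightarrow> V x \<le> v 0" using V_antimono[of 0 x] by (simp add: extend_v_def)

lemma V_lipschitz_le: "0 \<le> x \<Longrightarrow> x \<le> y \<Longrightarrow> V x \<le> V y + Lv * (y - x)"
proof -
  assume xy: "0 \<le> x" "x \<le> y"
  have l: "v a \<le> v b + Lv * (b - a)" if "0 \<le> a" "a \<le> b" "b \<le> 1" for a b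
    using lipschitz_onD[OF v_lip, of a b] that by (simp add: dist_real_def abs_le_iff)
  have "v x \<le> Lv * (y - x)" if "x \<le> 1" "1 < y"
    using l[of x 1] xy that v_1 mult_left_mono[OF _ Lv_nonneg, of "1 - x" "y - x"] by simp
  then show ?thesis using xy l[of x y] Lv_nonneg by (auto simp: extend_v_def)
qed

lemma V_one_sided: "0 \<le> x \<Longrightarrow> 0 \<le> y \<Longrightarrow> 0 \<le> k \<Longrightarrow> y \<le> x + k \<Longrightarrow> V x \<le> V y + Lv * k"
proof -
  assume h: "0 \<le> x" "0 \<le> y" "0 \<le> k" "y \<le> x + k"
  have "0 \<le> Lv * k" using Lv_nonneg h by simp
  moreover have "x \<le> y \<Longrightarrow> Lv * (y - x) \<le> Lv * k" using Lv_nonneg h by (intro mult_left_mono) auto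
  ultimately show ?thesis
    using V_antimono[of y x] V_lipschitz_le[of x y] h by (cases "x \<le> y") auto
qed

lemma V_lipschitz: "0 \<le> x \<Longrightarrow> 0 \<le> y \<Longrightarrow> \<bar>x - y\<bar> \<le> k \<Longrightarrow> \<bar>V x - V y\<bar> \<le> Lv * k"
  using V_one_sided[of x y k] V_one_sided[of y x k] by (auto simp: abs_le_iff)

lemma V_measurable[measurable]: "(\<lambda>x. V (max 0 x)) \<in> borel_measurable borel"
proof (rule borel_measurable_continuous_onI, rule lipschitz_on_continuous_on)
  show "Lv-lipschitz_on UNIV (\<lambda>x. V (max 0 x))"
    using Lv_nonneg by (intro lipschitz_onI) (auto simp: dist_real_def intro!: V_lipschitz)
qed

definition W :: "real \<Rightarrow> real" where "W z = indicator {0..\<eta>} z * w z"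

lemma W_measurable[measurable]: "W \<in> borel_measurable borel"
  using borel_measurable_continuous_on_indicator[OF _ w_cont] unfolding W_def by (simp add: mult.commute)

lemma W_bounds: "0 \<le> W z" "W z \<le> w 0"
  using w_nonneg[of z] w_mono[of 0 z] w0 by (auto simp: W_def indicator_def)

lemma S_eq: "S \<mu> x = (LINT y|\<mu>. W (y - x))"
  unfolding S_def set_lebesgue_integral_def by (rule Bochner_Integration.integral_cong) (auto simp: W_def indicator_def)

lemma S_nonneg: "0 \<le> S \<mu> x" unfolding S_eq by (rule Bochner_Integration.integral_nonneg) (rule W_bounds)

lemma nonlocal_velocity_eq: "nonlocal_velocity v w \<eta> \<mu> x = V (S \<mu> x)"
  by (simp add: nonlocal_velocity_def S_def)

lemma level_set:
  assumes s: "0 \<le> s" "s \<le> w 0"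
  shows "\<exists>r\<in>{0..\<eta>}. \<forall>x. {y. y - x \<in> {0..\<eta>} \<and> s \<le> w (y - x)} = {x..x+r}"
proof -
  let ?A = "{z. z \<in> {0..\<eta>} \<and> s \<le> w z}"
  have "closed ?A"
    using continuous_closed_preimage[OF w_cont closed_atLeastAtMost, of "{s..}"]
    by (simp add: vimage_def Int_def)
  moreover have "?A \<noteq> {}" "bdd_above ?A" using s \<eta> by (auto intro!: exI[of _ 0] bdd_aboveI[of _ \<eta>])
  ultimately have r: "Sup ?A \<in> ?A" by (intro closed_contains_Sup)
  moreover have "z \<le> Sup ?A" if "z \<in> ?A" for z
    using that \<open>bdd_above ?A\<close> by (rule cSup_upper)
  ultimately obtain r where r: "0 \<le> r" "r \<le> \<eta>" "s \<le> w r" "\<And>z. 0 \<le> z \<Longrightarrow> z \<le> \<eta> \<Longrightarrow> s \<le> w z \<Longrightarrow> z \<le> r"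
    by (metis (no_types, lifting) mem_Collect_eq atLeastAtMost_iff)
  have "{y. y - x \<in> {0..\<eta>} \<and> s \<le> w (y - x)} = {x..x+r}" for x
  proof (intro set_eqI iffI)
    fix y assume "y \<in> {x..x+r}"
    then show "y \<in> {y. y - x \<in> {0..\<eta>} \<and> s \<le> w (y - x)}" using r(1,2,3) w_mono[of "y - x" r] by simp
  next
    fix y assume "y \<in> {y. y - x \<in> {0..\<eta>} \<and> s \<le> w (y - x)}"
    then show "y \<in> {x..x+r}" using r(4)[of "y - x"] by simp
  qed
  then show ?thesis using r(1,2) by auto
qed

text \<open>Layer cake: the superlevel sets of the kernel are intervals starting at \<open>x\<close>.\<close>

lemma ennreal_S:
  assumes "real_distribution \<mu>"
  shows "ennreal (S \<mu> x) =
    (\<integral>\<^sup>+s\<in>{0..w 0}. ennreal (measure \<mu> {y. y - x \<in> {0..\<eta>} \<and> s \<le> w (y - x)}) \<partial>lborel)"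
proof -
  interpret real_distribution \<mu> by fact
  interpret P: pair_sigma_finite lborel \<mu> ..
  define A where "A = {(s, y). 0 \<le> s \<and> y - x \<in> {0..\<eta>} \<and> s \<le> W (y - x)}"
  have A[measurable]: "A \<in> sets (borel \<Otimes>\<^sub>M borel)" "A \<in> sets (lborel \<Otimes>\<^sub>M \<mu>)"
  proof -
    have "Measurable.pred (borel \<Otimes>\<^sub>M borel) (\<lambda>(s, y). 0 \<le> s \<and> y - x \<in> {0..\<eta>} \<and> s \<le> W (y - x))"
      unfolding atLeastAtMost_iff by measurable
    then show "A \<in> sets (borel \<Otimes>\<^sub>M borel)" by (simp add: pred_def space_pair_measure A_def)
    moreover have "sets (lborel \<Otimes>\<^sub>M \<mu>) = sets (borel \<Otimes>\<^sub>M borel)" by (rule sets_pair_measure_cong) auto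
    ultimately show "A \<in> sets (lborel \<Otimes>\<^sub>M \<mu>)" by simp
  qed
  have "integrable \<mu> (\<lambda>y. W (y - x))"
    using W_bounds by (intro integrable_const_bound[of _ "w 0"]) auto
  then have "ennreal (S \<mu> x) = (\<integral>\<^sup>+y. ennreal (W (y - x)) \<partial>\<mu>)"
    unfolding S_eq using W_bounds by (subst nn_integral_eq_integral) auto
  also have "\<dots> = (\<integral>\<^sup>+y. (\<integral>\<^sup>+s. indicator A (s, y) \<partial>lborel) \<partial>\<mu>)"
  proof (rule nn_integral_cong)
    fix y
    have "(\<integral>\<^sup>+s. indicator A (s, y) \<partial>lborel) = (\<integral>\<^sup>+s. indicator (if y - x \<in> {0..\<eta>} then {0..W (y - x)} else {}) s \<partial>lborel)"
      by (intro nn_integral_cong) (auto simp: A_def indicator_def)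
    also have "\<dots> = ennreal (W (y - x))"
      using W_bounds[of "y - x"] by (auto simp: W_def)
    finally show "ennreal (W (y - x)) = (\<integral>\<^sup>+s. indicator A (s, y) \<partial>lborel)" ..
  qed
  also have "\<dots> = (\<integral>\<^sup>+s. (\<integral>\<^sup>+y. indicator A (s, y) \<partial>\<mu>) \<partial>lborel)"
    by (rule P.Fubini') simp
  also have "\<dots> = (\<integral>\<^sup>+s\<in>{0..w 0}. ennreal (measure \<mu> {y. y - x \<in> {0..\<eta>} \<and> s \<le> w (y - x)}) \<partial>lborel)"
  proof (rule nn_integral_cong)
    fix s :: real
    show "(\<integral>\<^sup>+y. indicator A (s, y) \<partial>\<mu>) =
      ennreal (measure \<mu> {y. y - x \<in> {0..\<eta>} \<and> s \<le> w (y - x)}) * indicator {0..w 0} s"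
    proof (cases "s \<in> {0..w 0}")
      case True
      have "(\<integral>\<^sup>+y. indicator A (s, y) \<partial>\<mu>) = (\<integral>\<^sup>+y. indicator {y. y - x \<in> {0..\<eta>} \<and> s \<le> w (y - x)} y \<partial>\<mu>)"
        using True by (intro nn_integral_cong) (auto simp: A_def indicator_def W_def)
      moreover obtain r where "{y. y - x \<in> {0..\<eta>} \<and> s \<le> w (y - x)} = {x..x+r}"
        using level_set[of s] True by auto
      ultimately show ?thesis using True by (simp only: nn_integral_indicator) (simp add: emeasure_eq_measure)
    next
      case False
      have "(\<integral>\<^sup>+y. indicator A (s, y) \<partial>\<mu>) = (\<integral>\<^sup>+y. 0 \<partial>\<mu>)"
        using False W_bounds(2) by (intro nn_integral_cong) (force simp: A_def indicator_def intro: order_trans)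
      then show ?thesis using False by simp
    qed
  qed
  finally show ?thesis .
qed

lemma S_le:
  assumes \<mu>: "real_distribution \<mu>" and \<nu>: "real_distribution \<nu>" and k: "0 \<le> k"
    and le: "\<And>r. 0 \<le> r \<Longrightarrow> r \<le> \<eta> \<Longrightarrow> measure \<mu> {x..x+r} \<le> measure \<nu> {x'..x'+r} + k"
  shows "S \<mu> x \<le> S \<nu> x' + w 0 * k"
proof -
  let ?L = "\<lambda>\<mu> x s. measure \<mu> {y. y - x \<in> {0..\<eta>} \<and> s \<le> w (y - x)}"
  have m: "(\<lambda>s. ennreal (?L \<nu> x' s) * indicator {0..w 0} s) \<in> borel_measurable lborel"
  proof -
    interpret real_distribution \<nu> by fact
    have "antimono (?L \<nu> x')"
    proof (rule antimonoI, rule finite_measure_mono)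
      fix s
      have "closed {z. z \<in> {0..\<eta>} \<and> s \<le> w z}"
        using continuous_closed_preimage[OF w_cont closed_atLeastAtMost, of "{s..}"] by (simp add: vimage_def Int_def)
      then have "closed ((\<lambda>y. y - x') -` {z. z \<in> {0..\<eta>} \<and> s \<le> w z})"
        by (intro closed_vimage continuous_intros)
      then show "{y. y - x' \<in> {0..\<eta>} \<and> s \<le> w (y - x')} \<in> sets \<nu>" by (simp add: vimage_def)
    qed auto
    then have "mono (\<lambda>s. - ?L \<nu> x' s)" by (auto simp: mono_def antimono_def)
    from borel_measurable_mono[OF this] have "(\<lambda>s. - (- ?L \<nu> x' s)) \<in> borel_measurable borel" by (rule borel_measurable_uminus)
    then show ?thesis by simp
  qed
  have "ennreal (S \<mu> x) \<le> (\<integral>\<^sup>+s. ennreal (?L \<nu> x' s) * indicator {0..w 0} s + ennreal k * indicator {0..w 0} s \<partial>lborel)"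
    unfolding ennreal_S[OF \<mu>]
  proof (rule nn_integral_mono)
    fix s :: real
    show "ennreal (?L \<mu> x s) * indicator {0..w 0} s
       \<le> ennreal (?L \<nu> x' s) * indicator {0..w 0} s + ennreal k * indicator {0..w 0} s"
    proof (cases "s \<in> {0..w 0}")
      case True
      then obtain r where r: "r \<in> {0..\<eta>}" and e: "\<And>c. {y. y - c \<in> {0..\<eta>} \<and> s \<le> w (y - c)} = {c..c+r}"
        using level_set[of s] by auto
      have "?L \<mu> x s \<le> ?L \<nu> x' s + k" unfolding e using r by (intro le) auto
      then show ?thesis using True k by (simp flip: ennreal_plus add: ennreal_leI)
    qed simp
  qed
  also have "\<dots> = ennreal (S \<nu> x') + ennreal k * ennreal (w 0)"
    using m w0 by (subst nn_integral_add) (auto simp: ennreal_S[OF \<nu>] nn_integral_cmult)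
  also have "\<dots> = ennreal (S \<nu> x' + w 0 * k)"
    using k w0 S_nonneg by (simp add: ennreal_plus ennreal_mult' mult.commute)
  finally show ?thesis using S_nonneg k w0 by (subst (asm) ennreal_le_iff) (auto intro!: add_nonneg_nonneg)
qed

lemma S_cdf_le:
  assumes \<mu>: "real_distribution \<mu>" and \<nu>: "real_distribution \<nu>"
    and k: "\<And>y. \<bar>cdf \<mu> y - cdf \<nu> y\<bar> \<le> k"
  shows "S \<mu> x \<le> S \<nu> x + w 0 * (2 * k)"
proof (rule S_le[OF \<mu> \<nu>])
  interpret \<mu>: real_distribution \<mu> by fact
  interpret \<nu>: real_distribution \<nu> by fact
  show "0 \<le> 2 * k" using k[of 0] by simp
  have "measure \<nu> {..<x} \<le> measure \<mu> {..<x} + k"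
  proof (rule tendsto_le)
    show "(cdf \<nu> \<longlongrightarrow> measure \<nu> {..<x}) (at_left x)" by (rule \<nu>.cdf_at_left)
    show "((\<lambda>y. cdf \<mu> y + k) \<longlongrightarrow> measure \<mu> {..<x} + k) (at_left x)" by (intro tendsto_intros \<mu>.cdf_at_left)
    show "\<forall>\<^sub>F y in at_left x. cdf \<nu> y \<le> cdf \<mu> y + k" using k by (auto simp: abs_le_iff algebra_simps)
  qed simp
  moreover have "measure \<mu>' {x..x+r} = cdf \<mu>' (x + r) - measure \<mu>' {..<x}"
    if "real_distribution \<mu>'" "0 \<le> r" for \<mu>' r
  proof -
    interpret real_distribution \<mu>' by fact
    have "measure \<mu>' ({..x+r} - {..<x}) = measure \<mu>' {..x+r} - measure \<mu>' {..<x}"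
      by (rule finite_measure_Diff) (use that in auto)
    moreover have "{..x+r} - {..<x} = {x..x+r}" by auto
    ultimately show ?thesis by (simp add: cdf_def)
  qed
  ultimately show "measure \<mu> {x..x+r} \<le> measure \<nu> {x..x+r} + 2 * k" if "0 \<le> r" for r
    using that \<mu> \<nu> k[of "x + r"] by (simp add: abs_le_iff)
qed

lemma S_cdf_diff:
  assumes "real_distribution \<mu>" "real_distribution \<nu>" "\<And>y. \<bar>cdf \<mu> y - cdf \<nu> y\<bar> \<le> k"
  shows "\<bar>S \<mu> x - S \<nu> x\<bar> \<le> w 0 * (2 * k)"
  using S_cdf_le[OF assms, of x] S_cdf_le[OF assms(2,1), of k x] assms(3) by (auto simp: abs_minus_commute abs_le_iff)

end

definition law :: "(real \<Rightarrow> real) \<Rightarrow> real measure" where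
  "law X = distr (uniform_measure lborel {0..1}) borel X"

definition expanding :: "real \<Rightarrow> (real \<Rightarrow> real) \<Rightarrow> bool" where
  "expanding M X \<longleftrightarrow> (\<forall>a b. a \<le> b \<longrightarrow> b - a \<le> M * (X b - X a))"

lemma prob_space_unit: "prob_space (uniform_measure lborel {0..1::real})"
  by (rule prob_space_uniform_measure) auto

context
  fixes M :: real and X :: "real \<Rightarrow> real"
  assumes M: "0 < M" and X: "expanding M X"
begin

lemma expanding_mono: "a \<le> b \<Longrightarrow> X a \<le> X b"
proof -
  assume "a \<le> b"
  then have "0 \<le> M * (X b - X a)" using X unfolding expanding_def by (metis diff_ge_0_iff_ge order_trans)
  then show ?thesis using M by (simp add: zero_le_mult_iff)
qed

lemma expanding_measurable: "X \<in> borel_measurable borel"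
  by (rule borel_measurable_mono) (simp add: mono_def expanding_mono)

lemma real_distribution_law: "real_distribution (law X)"
  unfolding law_def real_distribution_def real_distribution_axioms_def
  using expanding_measurable by (auto intro!: prob_space.prob_space_distr prob_space_unit)

lemma cdf_law: "cdf (law X) y = measure lborel ({0..1} \<inter> {a. X a \<le> y})"
proof -
  have [measurable]: "{a. X a \<le> y} \<in> sets borel"
    using measurable_sets[OF expanding_measurable, of "{..y}"] by (simp add: vimage_def)
  have "cdf (law X) y = measure (uniform_measure lborel {0..1}) {a. X a \<le> y}"
    unfolding cdf_def law_def using expanding_measurable by (subst measure_distr) (auto simp: vimage_def)
  then show ?thesis by (subst (asm) measure_uniform_measure) auto
qed

lemma cdf_law_le: "0 \<le> a \<Longrightarrow> y < X a \<Longrightarrow> cdf (law X) y \<le> a"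
proof -
  assume a: "0 \<le> a" "y < X a"
  have "{0..1} \<inter> {a. X a \<le> y} \<subseteq> {0..a}"
  proof safe
    fix b assume "X b \<le> y" "b \<in> {0..1}"
    then show "b \<in> {0..a}" using a expanding_mono[of a b] by (cases "b \<le> a") auto
  qed
  then have "measure lborel ({0..1} \<inter> {a. X a \<le> y}) \<le> measure lborel {0..a}"
    using measurable_sets[OF expanding_measurable, of "{..y}"]
    by (intro measure_mono_fmeasurable) (auto simp: fmeasurable_def emeasure_lborel_Icc_eq vimage_def)
  then show ?thesis using a by (simp add: cdf_law)
qed

lemma cdf_law_ge: "a \<le> 1 \<Longrightarrow> X a \<le> y \<Longrightarrow> a \<le> cdf (law X) y"
proof (cases "0 \<le> a")
  case True
  assume a: "a \<le> 1" "X a \<le> y"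
  have "{0..a} \<subseteq> {0..1} \<inter> {a. X a \<le> y}"
    using a order_trans[OF expanding_mono[of _ a] a(2)] by auto
  moreover have "{0..1} \<inter> {a. X a \<le> y} \<in> fmeasurable lborel"
  proof (rule fmeasurableI2[of "{0..1}"])
    show "{0..1} \<inter> {a. X a \<le> y} \<in> sets lborel"
      using measurable_sets[OF expanding_measurable, of "{..y}"] by (simp add: vimage_def)
  qed (auto simp: fmeasurable_def)
  ultimately have "measure lborel {0..a} \<le> measure lborel ({0..1} \<inter> {a. X a \<le> y})"
    by (intro measure_mono_fmeasurable) auto
  then show ?thesis using True by (simp add: cdf_law)
next
  case False
  then show ?thesis unfolding cdf_def using measure_nonneg[of "law X" "{..y}"] by linarith
qed

lemma cdf_law_at:
  assumes "0 \<le> a" "a \<le> 1" shows "cdf (law X) (X a) = a"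
proof (rule antisym)
  show "cdf (law X) (X a) \<le> a"
  proof (rule field_le_epsilon)
    fix e :: real assume e: "0 < e"
    have "0 < M * (X (a + e) - X a)" using X[unfolded expanding_def, rule_format, of a "a + e"] e by simp
    then have "X a < X (a + e)" using M by (simp add: zero_less_mult_iff)
    then show "cdf (law X) (X a) \<le> a + e" using assms e by (intro cdf_law_le) auto
  qed
qed (use assms in \<open>simp add: cdf_law_ge\<close>)

lemma cdf_law_diff: "x \<le> y \<Longrightarrow> cdf (law X) y - cdf (law X) x \<le> M * (y - x)"
proof (rule ccontr)
  assume xy: "x \<le> y" and "\<not> cdf (law X) y - cdf (law X) x \<le> M * (y - x)"
  define e where "e = (cdf (law X) y - cdf (law X) x - M * (y - x)) / 2"
  have e: "0 < e" "2 * e = cdf (law X) y - cdf (law X) x - M * (y - x)" using \<open>\<not> _\<close> by (simp_all add: e_def)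
  define a where "a = cdf (law X) x + e / 2"
  define b where "b = cdf (law X) y - e / 2"
  interpret real_distribution "law X" by (rule real_distribution_law)
  have "0 \<le> M * (y - x)" using M xy by simp
  then have ab: "a \<le> b" "M * (y - x) < b - a" unfolding a_def b_def using e by linarith+
  have "0 \<le> a" "b \<le> 1" using e cdf_nonneg[of x] cdf_bounded_prob[of y] by (auto simp: a_def b_def)
  have "x < X a"
    using cdf_law_ge[of a x] e ab(1) \<open>b \<le> 1\<close> by (cases "X a \<le> x") (auto simp: a_def)
  moreover have "X b \<le> y"
    using cdf_law_le[of b y] e ab(1) \<open>0 \<le> a\<close> by (cases "y < X b") (auto simp: b_def)
  ultimately have "M * (X b - X a) \<le> M * (y - x)" using M by (intro mult_left_mono) auto
  moreover have "b - a \<le> M * (X b - X a)" using X ab(1) by (simp add: expanding_def)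
  ultimately show False using ab(2) by linarith
qed

lemma cdf_law_lipschitz: "\<bar>cdf (law X) y - cdf (law X) x\<bar> \<le> M * \<bar>y - x\<bar>"
proof -
  interpret real_distribution "law X" by (rule real_distribution_law)
  show ?thesis
    using cdf_law_diff[of x y] cdf_law_diff[of y x] cdf_nondecreasing[of x y] cdf_nondecreasing[of y x]
    by (cases "x \<le> y") auto
qed

lemma measure_law_Icc: "0 \<le> r \<Longrightarrow> measure (law X) {x..x+r} = cdf (law X) (x + r) - cdf (law X) x"
proof -
  assume r: "0 \<le> r"
  interpret real_distribution "law X" by (rule real_distribution_law)
  have "isCont (cdf (law X)) x"
  proof -
    have "M-lipschitz_on UNIV (cdf (law X))"
      using cdf_law_lipschitz M by (intro lipschitz_onI) (auto simp: dist_real_def)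
    from lipschitz_on_continuous_on[OF this] show ?thesis by (simp add: continuous_on_eq_continuous_at)
  qed
  then have "(cdf (law X) \<longlongrightarrow> cdf (law X) x) (at_left x)"
    by (simp add: isCont_def filterlim_at_split)
  then have "measure (law X) {..<x} = cdf (law X) x"
    using cdf_at_left tendsto_unique trivial_limit_at_left_real by blast
  moreover have "prob ({..x+r} - {..<x}) = prob {..x+r} - prob {..<x}"
    by (rule finite_measure_Diff) (use r in auto)
  moreover have "{..x+r} - {..<x} = {x..x+r}" by auto
  ultimately show ?thesis by (simp add: cdf_def)
qed

end

lemma expanding_le: "expanding M X \<Longrightarrow> a \<le> b \<Longrightarrow> b - a \<le> M * (X b - X a)"
  by (simp add: expanding_def)

lemma cdf_law_near:
  assumes M: "0 < M" and X: "expanding M X" and Y: "expanding M Y" and d: "\<And>a. \<bar>X a - Y a\<bar> \<le> d"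
  shows "\<bar>cdf (law X) y - cdf (law Y) y\<bar> \<le> M * d"
proof -
  have *: "cdf (law X) y \<le> cdf (law Y) y + M * d"
    if X: "expanding M X" and Y: "expanding M Y" and d: "\<And>a. \<bar>X a - Y a\<bar> \<le> d" for X Y
  proof (rule dense_ge_bounded[of _ "cdf (law Y) y + M * d + 1"])
    interpret Y: real_distribution "law Y" by (rule real_distribution_law[OF M Y])
    fix a assume a: "cdf (law Y) y + M * d < a"
    have "cdf (law Y) (y + d) \<le> cdf (law Y) y + M * d"
      using cdf_law_diff[OF M Y, of y "y + d"] order_trans[OF abs_ge_zero d] by auto
    with a have "cdf (law Y) (y + d) < a" by linarith
    then have "0 \<le> a" "1 \<le> a \<or> y + d < Y a"
      using Y.cdf_nonneg[of "y + d"] cdf_law_ge[OF M Y, of a "y + d"] by linarith+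
    interpret X: real_distribution "law X" by (rule real_distribution_law[OF M X])
    show "cdf (law X) y \<le> a"
      using \<open>1 \<le> a \<or> y + d < Y a\<close>
    proof
      assume "y + d < Y a"
      then have "y < X a" using d[of a] by auto
      with \<open>0 \<le> a\<close> show ?thesis by (rule cdf_law_le[OF M X])
    qed (use X.cdf_bounded_prob[of y] in auto)
  qed simp
  show ?thesis using *[OF X Y d] *[OF Y X] d by (simp add: abs_le_iff abs_minus_commute)
qed

section \<open>The flow of the monotone rearrangement\<close>

lemma has_real_derivative_mvt:
  fixes f :: "real \<Rightarrow> real"
  assumes "a \<le> b" "{a..b} \<subseteq> A" "\<And>s. s \<in> {a..b} \<Longrightarrow> (f has_real_derivative f' s) (at s within A)"
  shows "\<exists>s\<in>{a..b}. f b - f a = (b - a) * f' s"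
proof -
  have "(f has_derivative (\<lambda>h. h * f' s)) (at s within {a..b})" if "a \<le> s" "s \<le> b" for s
  proof -
    have "(f has_real_derivative f' s) (at s within {a..b})"
      using assms(2,3) that by (intro has_field_derivative_subset[OF assms(3)]) auto
    then show ?thesis by (simp add: has_field_derivative_def mult.commute[of _ "f' s"])
  qed
  from mvt_very_simple[OF assms(1) this] show ?thesis by auto
qed

context nonlocal_flux
begin

lemma S_law_shift:
  assumes M: "0 < M" and X: "expanding M X" and ab: "0 \<le> a" "a \<le> b" "b \<le> 1"
  shows "S (law X) (X b) \<le> S (law X) (X a) + w 0 * (M * (X b - X a) - (b - a))"
proof (rule S_le)
  have mono: "X a \<le> X b" using expanding_mono[OF M X] ab by simp
  fix r :: real assume r: "0 \<le> r"
  have "cdf (law X) (X b + r) - cdf (law X) (X a + r) \<le> M * (X b - X a)"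
    using cdf_law_diff[OF M X, of "X a + r" "X b + r"] mono by simp
  then show "measure (law X) {X b..X b + r} \<le> measure (law X) {X a..X a + r} + (M * (X b - X a) - (b - a))"
    using ab by (simp add: measure_law_Icc[OF M X r] cdf_law_at[OF M X])
qed (use X ab real_distribution_law[OF M X] in \<open>auto simp: expanding_def\<close>)

lemma S_law_lipschitz_le:
  assumes M: "0 < M" and X: "expanding M X"
  shows "S (law X) x \<le> S (law X) y + w 0 * (2 * M * \<bar>x - y\<bar>)"
proof (rule S_le)
  fix r :: real assume r: "0 \<le> r"
  show "measure (law X) {x..x + r} \<le> measure (law X) {y..y + r} + 2 * M * \<bar>x - y\<bar>"
    using cdf_law_lipschitz[OF M X, of "x + r" "y + r"] cdf_law_lipschitz[OF M X, of x y]
    by (simp add: measure_law_Icc[OF M X r] abs_le_iff)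
qed (use M real_distribution_law[OF M X] in auto)

lemma S_law_lipschitz:
  assumes "0 < M" "expanding M X"
  shows "\<bar>S (law X) x - S (law X) y\<bar> \<le> w 0 * (2 * M * \<bar>x - y\<bar>)"
  using S_law_lipschitz_le[OF assms, of x y] S_law_lipschitz_le[OF assms, of y x]
  by (simp add: abs_le_iff abs_minus_commute)

text \<open>Labels outside of \<open>[0,1]\<close> carry no mass; they move along with the nearest endpoint.\<close>

lemma continuum_flow_exists:
  assumes M: "0 < M" and X0: "expanding M X0"
  shows "\<exists>X. X 0 = X0 \<and> (\<forall>t\<ge>0. expanding M (X t)) \<and>
    (\<forall>t\<ge>0. \<forall>a. ((\<lambda>s. X s a) has_real_derivative V (S (law (X t)) (X t (max 0 (min 1 a))))) (at t within {0..}))"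
proof -
  let ?c = "\<lambda>a. max 0 (min 1 (a :: real))"
  let ?G = "\<lambda>X a. V (S (law X) (X (?c a)))"
  have "\<exists>Z. Z 0 = X0 \<and> (\<forall>t\<ge>0. Z t \<in> {X. expanding M X}) \<and>
     (\<forall>t\<ge>0. \<forall>a. ((\<lambda>s. Z s a) has_real_derivative ?G (Z t) a) (at t within {0..}))"
  proof (rule euler_flow[where C = "v 0" and L = "Lv * (w 0 * (4 * M))" and h\<^sub>0 = "1 / (1 + Lv * (w 0 * M))"])
    have pos: "0 \<le> Lv * (w 0 * M)" using Lv_nonneg w0 M by simp
    then show "0 < 1 / (1 + Lv * (w 0 * M))" by simp
    show "0 \<le> Lv * (w 0 * (4 * M))" using pos by (simp add: mult_ac)
    show "X0 \<in> {X. expanding M X}" using X0 by simp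
    show "\<bar>?G X a\<bar> \<le> v 0" for X a using V_nonneg V_le S_nonneg by simp
    show "Z \<in> {X. expanding M X}"
      if Y: "\<And>k. Y k \<in> {X. expanding M X}" "\<And>a. (\<lambda>k. Y k a) \<longlonglongrightarrow> Z a" for Y :: "nat \<Rightarrow> real \<Rightarrow> real" and Z
      unfolding mem_Collect_eq expanding_def
    proof (intro allI impI)
      fix a b :: real assume ab: "a \<le> b"
      have "(\<lambda>k. M * (Y k b - Y k a)) \<longlonglongrightarrow> M * (Z b - Z a)" by (intro tendsto_intros Y)
      then show "b - a \<le> M * (Z b - Z a)"
        using Y(1) ab by (intro LIMSEQ_le_const) (auto simp: expanding_def)
    qed
    show "\<bar>?G X a - ?G Y a\<bar> \<le> Lv * (w 0 * (4 * M)) * d"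
      if "X \<in> {X. expanding M X}" "Y \<in> {X. expanding M X}" and d: "\<And>b. \<bar>X b - Y b\<bar> \<le> d" for X Y d a
    proof -
      have X: "expanding M X" and Y: "expanding M Y" using that by auto
      have "\<bar>S (law X) (X (?c a)) - S (law X) (Y (?c a))\<bar> \<le> w 0 * (2 * M * \<bar>X (?c a) - Y (?c a)\<bar>)"
        by (rule S_law_lipschitz[OF M X])
      also have "\<dots> \<le> w 0 * (2 * M * d)" using w0 M d by (intro mult_left_mono) auto
      finally have 1: "\<bar>S (law X) (X (?c a)) - S (law X) (Y (?c a))\<bar> \<le> w 0 * (2 * M * d)" .
      have "\<bar>S (law X) (Y (?c a)) - S (law Y) (Y (?c a))\<bar> \<le> w 0 * (2 * (M * d))"
        by (intro S_cdf_diff real_distribution_law[OF M] X Y cdf_law_near[OF M X Y d])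
      moreover have "w 0 * (4 * M * d) = w 0 * (2 * M * d) + w 0 * (2 * (M * d))" by (simp add: algebra_simps)
      ultimately have "\<bar>S (law X) (X (?c a)) - S (law Y) (Y (?c a))\<bar> \<le> w 0 * (4 * M * d)"
        using 1 by linarith
      then have "\<bar>?G X a - ?G Y a\<bar> \<le> Lv * (w 0 * (4 * M * d))" by (intro V_lipschitz S_nonneg)
      then show ?thesis by (simp add: mult_ac)
    qed
    show "(\<lambda>a. X a + h * ?G X a) \<in> {X. expanding M X}"
      if "X \<in> {X. expanding M X}" and h: "0 \<le> h" "h \<le> 1 / (1 + Lv * (w 0 * M))" for X h
      unfolding mem_Collect_eq expanding_def
    proof (intro allI impI)
      fix a b :: real assume ab: "a \<le> b"
      have X: "expanding M X" using that by simp
      let ?D = "\<lambda>a b. M * (X b - X a) - (b - a)"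
      have c: "0 \<le> ?c a" "?c a \<le> ?c b" "?c b \<le> 1" using ab by auto
      have "0 \<le> ?D (?c a) (?c b)" using X c by (simp add: expanding_def)
      have "?D (?c a) (?c b) \<le> ?D a b"
      proof -
        consider "b \<le> 0" | "1 \<le> a" | "a \<le> 1" "0 \<le> b" by linarith
        then show ?thesis
        proof cases
          case 3
          then have "?D a b = ?D (?c a) (?c b) + (if a \<le> 0 then ?D a 0 else 0) + (if 1 \<le> b then ?D 1 b else 0)"
            by (auto simp: algebra_simps)
          moreover have "a \<le> 0 \<Longrightarrow> 0 \<le> ?D a 0" "1 \<le> b \<Longrightarrow> 0 \<le> ?D 1 b"
            using X expanding_le[of M X a 0] expanding_le[of M X 1 b] by simp_all
          ultimately show ?thesis by (smt (verit))
        qed (use ab expanding_le[OF X, of a b] in auto)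
      qed
      have "V (S (law X) (X (?c a))) \<le> V (S (law X) (X (?c b))) + Lv * (w 0 * ?D (?c a) (?c b))"
        using w0 \<open>0 \<le> ?D (?c a) (?c b)\<close>
        by (intro V_one_sided S_nonneg S_law_shift[OF M X c] mult_nonneg_nonneg)
      also have "\<dots> \<le> V (S (law X) (X (?c b))) + Lv * (w 0 * ?D a b)"
        using \<open>?D (?c a) (?c b) \<le> ?D a b\<close> w0 Lv_nonneg by (intro add_left_mono mult_left_mono)
      finally have 1: "?G X a - ?G X b \<le> Lv * (w 0 * ?D a b)" by simp
      have "(M * h) * (?G X a - ?G X b) \<le> (M * h) * (Lv * (w 0 * ?D a b))"
        using M h 1 by (intro mult_left_mono) auto
      also have "\<dots> = (h * (Lv * (w 0 * M))) * ?D a b" by (simp add: mult_ac)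
      also have "\<dots> \<le> 1 * ?D a b"
      proof (rule mult_right_mono)
        have "h * (1 + Lv * (w 0 * M)) \<le> 1" using h pos by (simp add: pos_le_divide_eq)
        then show "h * (Lv * (w 0 * M)) \<le> 1" using h by (simp add: distrib_left)
      qed (use expanding_le[OF X ab] in simp)
      finally show "b - a \<le> M * (X b + h * ?G X b - (X a + h * ?G X a))"
        by (simp add: algebra_simps)
    qed
  qed
  then show ?thesis by simp
qed

end

locale flux_flow = nonlocal_flux +
  fixes M :: real and X :: "real \<Rightarrow> real \<Rightarrow> real"
  assumes M: "0 < M" and expand: "\<And>t. 0 \<le> t \<Longrightarrow> expanding M (X t)"
    and flow: "\<And>t a. 0 \<le> t \<Longrightarrow>
      ((\<lambda>s. X s a) has_real_derivative V (S (law (X t)) (X t (max 0 (min 1 a))))) (at t within {0..})"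
begin

definition U :: "real \<Rightarrow> real \<Rightarrow> real" where "U t x = V (S (law (X t)) x)"

definition K :: real where "K = Lv * (w 0 * (2 * M))"

lemma K_nonneg: "0 \<le> K" unfolding K_def using Lv_nonneg w0 M by simp

lemma v0_nonneg: "0 \<le> v 0" using v_nonneg by simp

lemma U_bounds: "0 \<le> U t x" "U t x \<le> v 0"
  unfolding U_def by (simp_all add: V_nonneg V_le S_nonneg)

lemma flow_label: "0 \<le> t \<Longrightarrow> a \<in> {0..1} \<Longrightarrow> ((\<lambda>s. X s a) has_real_derivative U t (X t a)) (at t within {0..})"
  using flow[of t a] by (simp add: U_def)

lemma flow_move: assumes "0 \<le> s" "s \<le> t" shows "X s a \<le> X t a" "X t a \<le> X s a + v 0 * (t - s)"
proof -
  obtain r where "X t a - X s a = (t - s) * V (S (law (X r)) (X r (max 0 (min 1 a))))"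
    using has_real_derivative_mvt[of s t "{0..}" "\<lambda>s. X s a" "\<lambda>r. V (S (law (X r)) (X r (max 0 (min 1 a))))"] flow assms
    by auto
  moreover have "0 \<le> (t - s) * V (S (law (X r)) (X r (max 0 (min 1 a))))"
    "(t - s) * V (S (law (X r)) (X r (max 0 (min 1 a)))) \<le> (t - s) * v 0"
    using assms V_nonneg V_le S_nonneg by (auto intro: mult_left_mono)
  ultimately show "X s a \<le> X t a" "X t a \<le> X s a + v 0 * (t - s)" by (simp_all add: mult.commute)
qed

lemma flow_lipschitz: "0 \<le> s \<Longrightarrow> 0 \<le> t \<Longrightarrow> \<bar>X s a - X t a\<bar> \<le> v 0 * \<bar>s - t\<bar>"
  using flow_move[of s t a] flow_move[of t s a] by (cases "s \<le> t") auto

lemma U_lipschitz: "0 \<le> t \<Longrightarrow> \<bar>U t x - U t y\<bar> \<le> K * \<bar>x - y\<bar>"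
  using V_lipschitz[OF S_nonneg S_nonneg S_law_lipschitz[OF M expand]] by (simp add: U_def K_def mult_ac)

lemma U_lipschitz_time: "0 \<le> s \<Longrightarrow> 0 \<le> t \<Longrightarrow> \<bar>U s x - U t x\<bar> \<le> K * (v 0 * \<bar>s - t\<bar>)"
proof -
  assume st: "0 \<le> s" "0 \<le> t"
  have "\<bar>S (law (X s)) x - S (law (X t)) x\<bar> \<le> w 0 * (2 * (M * (v 0 * \<bar>s - t\<bar>)))"
    using st by (intro S_cdf_diff real_distribution_law[OF M] expand cdf_law_near[OF M] flow_lipschitz)
  from V_lipschitz[OF S_nonneg S_nonneg this] show ?thesis by (simp add: U_def K_def mult_ac)
qed

lemma U_along: "0 \<le> t \<Longrightarrow> t \<le> s \<Longrightarrow> \<bar>U s (X s a) - U t (X t a)\<bar> \<le> 2 * K * v 0 * (s - t)"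
proof -
  assume st: "0 \<le> t" "t \<le> s"
  have "\<bar>U s (X s a) - U s (X t a)\<bar> \<le> K * \<bar>X s a - X t a\<bar>" using st by (intro U_lipschitz) simp
  also have "\<dots> \<le> K * (v 0 * \<bar>s - t\<bar>)" using st by (intro mult_left_mono flow_lipschitz K_nonneg) auto
  finally show ?thesis using U_lipschitz_time[of s t "X t a"] st by simp
qed

lemma flow_expand:
  assumes "0 \<le> t" "0 \<le> h" "a \<in> {0..1}"
  shows "\<bar>X (t + h) a - X t a - h * U t (X t a)\<bar> \<le> h * (2 * K * v 0 * h)"
proof -
  obtain s where s: "s \<in> {t..t+h}" "X (t + h) a - X t a = h * U s (X s a)"
    using has_real_derivative_mvt[of t "t + h" "{0..}" "\<lambda>s. X s a" "\<lambda>s. U s (X s a)"] flow_label assms by auto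
  have "\<bar>U s (X s a) - U t (X t a)\<bar> \<le> 2 * K * v 0 * (s - t)" using s assms by (intro U_along) auto
  also have "\<dots> \<le> 2 * K * v 0 * h" using s K_nonneg v0_nonneg by (intro mult_left_mono) auto
  finally have "h * \<bar>U s (X s a) - U t (X t a)\<bar> \<le> h * (2 * K * v 0 * h)" using assms by (intro mult_left_mono) auto
  moreover have "X (t + h) a - X t a - h * U t (X t a) = h * (U s (X s a) - U t (X t a))"
    using s(2) by (simp add: algebra_simps)
  ultimately show ?thesis using assms by (simp add: abs_mult)
qed

end

section \<open>Moving barriers for weak solutions\<close>

definition unit_step :: "(real \<Rightarrow> real) \<Rightarrow> (real \<Rightarrow> real) \<Rightarrow> bool" where
  "unit_step B B' \<longleftrightarrow> C_infinity B \<and> continuous_on UNIV B' \<and> (\<forall>x. (B has_real_derivative B' x) (at x)) \<and>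
     (\<forall>x. 0 \<le> B' x) \<and> (\<forall>x\<le>0. B x = 0) \<and> (\<forall>x\<ge>1. B x = 1) \<and> (\<forall>x. x \<notin> {0<..<1} \<longrightarrow> B' x = 0)"

lemma unit_stepD:
  assumes "unit_step B B'"
  shows "C_infinity B" "continuous_on A B'" "(B has_real_derivative B' x) (at x within A)" "0 \<le> B' x"
    "x \<le> 0 \<Longrightarrow> B x = 0" "1 \<le> x \<Longrightarrow> B x = 1" "x \<le> 0 \<or> 1 \<le> x \<Longrightarrow> B' x = 0"
  using assms continuous_on_subset[of UNIV B' A]
  by (auto simp: unit_step_def intro: has_field_derivative_at_within)

lemma unit_step_mono: assumes "unit_step B B'" "x \<le> y" shows "B x \<le> B y"
  using unit_stepD(3,4)[OF assms(1)] assms(2) by (intro DERIV_nonneg_imp_nondecreasing[of x y B]) auto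

lemma unit_step_bounds: assumes "unit_step B B'" shows "0 \<le> B x" "B x \<le> 1"
  using unit_step_mono[OF assms, of "min x 0" x] unit_step_mono[OF assms, of x "max x 1"]
    unit_stepD(5)[OF assms, of "min x 0"] unit_stepD(6)[OF assms, of "max x 1"] by auto

lemma unit_step_measurable: assumes "unit_step B B'" shows "B \<in> borel_measurable borel" "B' \<in> borel_measurable borel"
proof -
  have "isCont B x" for x using unit_stepD(3)[OF assms, of x UNIV] by (rule DERIV_isCont)
  then show "B \<in> borel_measurable borel"
    by (intro borel_measurable_continuous_onI continuous_at_imp_continuous_on) auto
  show "B' \<in> borel_measurable borel" by (intro borel_measurable_continuous_onI unit_stepD(2)[OF assms])
qed

lemma unit_step_lipschitz:
  assumes B: "unit_step B B'" shows "\<exists>L>0. (\<forall>x. B' x \<le> L) \<and> (\<forall>x y. \<bar>B x - B y\<bar> \<le> L * \<bar>x - y\<bar>)"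
proof -
  have "compact (B' ` {0..1})" by (intro compact_continuous_image unit_stepD(2)[OF B]) simp
  then obtain L where L: "\<forall>y\<in>B' ` {0..1}. \<bar>y\<bar> \<le> L" using compact_imp_bounded bounded_real by blast
  define L' where "L' = max L 1"
  have le: "\<bar>B' x\<bar> \<le> L'" for x
  proof (cases "x \<in> {0..1}")
    case True
    then have "\<bar>B' x\<bar> \<le> L" using L by blast
    then show ?thesis by (simp add: L'_def)
  next
    case False
    then have "x \<le> 0 \<or> 1 \<le> x" by auto
    then have "B' x = 0" by (rule unit_stepD(7)[OF B])
    then show ?thesis by (simp add: L'_def)
  qed
  moreover have "\<bar>B x - B y\<bar> \<le> L' * \<bar>x - y\<bar>" for x y
  proof -
    have "norm (B x - B y) \<le> L' * norm (x - y)"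
      by (rule field_differentiable_bound[of UNIV B B']) (use unit_stepD(3)[OF B] le in auto)
    then show ?thesis by simp
  qed
  ultimately show ?thesis by (intro exI[of _ L']) (auto simp: L'_def abs_le_iff)
qed

lemma integral_unit_step:
  assumes B: "unit_step B B'" and \<epsilon>: "0 < \<epsilon>" and ab: "a \<le> s" "s + \<epsilon> \<le> b"
  shows "set_integrable lborel {a..b} (\<lambda>t. B' ((t - s) / \<epsilon>) / \<epsilon>)" "(LBINT t:{a..b}. B' ((t - s) / \<epsilon>) / \<epsilon>) = 1"
proof -
  have c: "continuous_on UNIV (\<lambda>t. B' ((t - s) / \<epsilon>) / \<epsilon>)"
    using \<epsilon> by (intro continuous_intros continuous_on_compose2[OF unit_stepD(2)[OF B, of UNIV]]) auto
  show "set_integrable lborel {a..b} (\<lambda>t. B' ((t - s) / \<epsilon>) / \<epsilon>)"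
    by (rule borel_integrable_atLeastAtMost') (rule continuous_on_subset[OF c], simp)
  have "(LBINT t. (B' ((t - s) / \<epsilon>) / \<epsilon>) * indicator {a..b} t) = B ((b - s) / \<epsilon>) - B ((a - s) / \<epsilon>)"
  proof (rule integral_FTC_Icc_real)
    show "((\<lambda>t. B ((t - s) / \<epsilon>)) has_real_derivative B' ((t - s) / \<epsilon>) / \<epsilon>) (at t)" for t
    proof -
      have "((\<lambda>t. (t - s) / \<epsilon>) has_real_derivative 1 / \<epsilon>) (at t)"
        using \<epsilon> by (auto intro!: derivative_eq_intros)
      from DERIV_chain2[OF unit_stepD(3)[OF B] this] show ?thesis by simp
    qed
    show "isCont (\<lambda>t. B' ((t - s) / \<epsilon>) / \<epsilon>) t" for t
      using c by (simp add: continuous_on_eq_continuous_at)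
  qed (use ab \<epsilon> in simp)
  moreover have "B ((b - s) / \<epsilon>) = 1" using ab \<epsilon> by (intro unit_stepD(6)[OF B]) (simp add: field_simps)
  moreover have "B ((a - s) / \<epsilon>) = 0" using ab \<epsilon> by (intro unit_stepD(5)[OF B]) (simp add: field_simps)
  ultimately show "(LBINT t:{a..b}. B' ((t - s) / \<epsilon>) / \<epsilon>) = 1"
    by (simp add: set_lebesgue_integral_def mult.commute)
qed

text \<open>The cutoff at \<open>A\<close> makes the support compact; it lies to the left of all the measures.\<close>

lemma moving_step_test_function:
  fixes B :: "real \<Rightarrow> real"
  assumes B: "unit_step B B'" and \<epsilon>: "0 < \<epsilon>" and \<kappa>: "0 < \<kappa>" and s: "0 < s\<^sub>0" "s\<^sub>0 \<le> s\<^sub>1" "s\<^sub>1 + \<epsilon> < T"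
    and A: "A \<le> z - \<bar>c\<bar> * T"
  shows "(\<lambda>(t, x). (B ((t - s\<^sub>0) / \<epsilon>) - B ((t - s\<^sub>1) / \<epsilon>)) * (B (x - A) - B ((x - (z + c * t)) / \<kappa>))) \<in> test_functions T"
    (is "?\<phi> \<in> _")
proof -
  have Ck: "C_k k B" for k using unit_stepD(1)[OF B] by (simp add: C_infinity_def)
  have aff: "C_k k (\<lambda>p :: real \<times> real. B ((\<alpha> * fst p + \<beta> * snd p) + \<gamma>))" for k \<alpha> \<beta> \<gamma>
    by (rule C_k_compose_affine[OF _ Ck])
       (intro bounded_linear_add bounded_linear_const_mult bounded_linear_fst bounded_linear_snd)
  have sub: "C_k k (\<lambda>p. f p - g p)" if "C_k k f" "C_k k g" for k and f g :: "real \<times> real \<Rightarrow> real"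
    using C_k_add[OF that(1) C_k_cmult[OF that(2), of "-1"]] by simp
  have eq: "?\<phi> = (\<lambda>p. (B ((1 / \<epsilon>) * fst p + 0 * snd p + (- s\<^sub>0 / \<epsilon>)) - B ((1 / \<epsilon>) * fst p + 0 * snd p + (- s\<^sub>1 / \<epsilon>)))
      * (B (0 * fst p + 1 * snd p + (- A)) - B ((- c / \<kappa>) * fst p + (1 / \<kappa>) * snd p + (- z / \<kappa>))))"
    using \<epsilon> \<kappa> by (simp add: fun_eq_iff diff_divide_distrib add_divide_distrib algebra_simps)
  have smooth: "C_infinity ?\<phi>"
    unfolding C_infinity_def eq by (intro allI C_k_mult sub aff)
  define R where "R = max (A + 1) (z + \<bar>c\<bar> * T + \<kappa>)"
  have zero: "?\<phi> (t, x) = 0" if out: "(t, x) \<notin> {s\<^sub>0..s\<^sub>1+\<epsilon>} \<times> {A..R}" for t x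
  proof (cases "t \<in> {s\<^sub>0..s\<^sub>1+\<epsilon>}")
    case False
    then consider "t < s\<^sub>0" | "s\<^sub>1 + \<epsilon> < t" by auto
    then have "B ((t - s\<^sub>0) / \<epsilon>) = B ((t - s\<^sub>1) / \<epsilon>)"
    proof cases
      case 1
      then show ?thesis using s \<epsilon> by (simp add: unit_stepD(5)[OF B] divide_nonpos_pos)
    next
      case 2
      then show ?thesis using s \<epsilon> by (simp add: unit_stepD(6)[OF B])
    qed
    then show ?thesis by simp
  next
    case True
    then have "\<bar>c * t\<bar> \<le> \<bar>c\<bar> * T" using s \<epsilon> by (auto simp: abs_mult intro!: mult_left_mono)
    then have ct: "c * t \<le> \<bar>c\<bar> * T" "- (\<bar>c\<bar> * T) \<le> c * t" by (simp_all add: abs_le_iff)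
    consider "x < A" | "R < x" using out True by fastforce
    then have "B (x - A) = B ((x - (z + c * t)) / \<kappa>)"
    proof cases
      case 1
      then have "(x - (z + c * t)) / \<kappa> \<le> 0" using A ct \<kappa> by (intro divide_nonpos_pos) auto
      then show ?thesis using 1 by (simp add: unit_stepD(5)[OF B])
    next
      case 2
      then have "1 \<le> (x - (z + c * t)) / \<kappa>" using ct \<kappa> by (simp add: R_def pos_le_divide_eq)
      then show ?thesis using 2 by (simp add: unit_stepD(6)[OF B] R_def)
    qed
    then show ?thesis by simp
  qed
  let ?C = "{s\<^sub>0..s\<^sub>1+\<epsilon>} \<times> {A..R}"
  have C: "compact ?C" by (intro compact_Times compact_Icc)
  have "{p. ?\<phi> p \<noteq> 0} \<subseteq> ?C" using zero by (auto simp: subset_iff)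
  then have sC: "supp ?\<phi> \<subseteq> ?C" unfolding supp_def using C by (intro closure_minimal compact_imp_closed)
  moreover have "compact (supp ?\<phi>)"
    using compact_Int_closed[OF C, of "supp ?\<phi>"] sC by (simp add: Int_absorb1 supp_def)
  moreover have "?C \<subseteq> {0<..<T} \<times> UNIV" using s by auto
  ultimately show ?thesis using smooth unfolding test_functions_def by blast
qed

lemma moving_step_integral_continuous:
  fixes B :: "real \<Rightarrow> real"
  assumes \<sigma>: "\<sigma> \<in> C0_P_c T" and \<kappa>: "0 < \<kappa>" and B: "unit_step B B'" and t: "t \<in> {0..T}" and e: "0 < e"
  shows "\<exists>\<delta>>0. \<forall>s\<in>{0..T}. \<bar>s - t\<bar> < \<delta> \<longrightarrow>
    \<bar>(LINT x|\<sigma> s. 1 - B ((x - (z + c * s)) / \<kappa>)) - (LINT x|\<sigma> t. 1 - B ((x - (z + c * t)) / \<kappa>))\<bar> \<le> e"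
proof -
  have rd: "real_distribution (\<sigma> t)" using \<sigma> t by (intro P_c_real_distribution) (simp add: C0_P_c_def)
  obtain L where L: "0 < L" "\<And>x. B' x \<le> L" "\<And>x y. \<bar>B x - B y\<bar> \<le> L * \<bar>x - y\<bar>"
    using unit_step_lipschitz[OF B] by blast
  note [measurable] = unit_step_measurable[OF B]
  let ?\<psi> = "\<lambda>t x. 1 - B ((x - (z + c * t)) / \<kappa>)"
  let ?m = "\<lambda>t. LINT x|\<sigma> t. ?\<psi> t x"
  obtain \<delta> where \<delta>: "0 < \<delta>" "\<And>s. s \<in> {0..T} \<Longrightarrow> \<bar>s - t\<bar> < \<delta> \<Longrightarrow>
      \<exists>\<pi>\<in>couplings (\<sigma> s) (\<sigma> t). AE z in \<pi>. \<bar>fst z - snd z\<bar> \<le> e * \<kappa> / (2 * L)"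
    using C0_P_c_coupling[OF \<sigma> t, of "e * \<kappa> / (2 * L)"] divide_pos_pos[OF mult_pos_pos[OF e \<kappa>], of "2 * L"] L(1) by fastforce
  define c' where "c' = \<bar>c\<bar> + 1"
  have c': "0 < c'" "\<bar>c\<bar> \<le> c'" by (simp_all add: c'_def)
  define \<delta>' where "\<delta>' = min \<delta> (e * \<kappa> / (2 * L * c'))"
  have "\<bar>?m s - ?m t\<bar> \<le> e" if s: "s \<in> {0..T}" "\<bar>s - t\<bar> < \<delta>'" for s
  proof -
    have lip: "\<bar>?\<psi> s x - ?\<psi> s' y\<bar> \<le> L / \<kappa> * (\<bar>x - y\<bar> + \<bar>c\<bar> * \<bar>s - s'\<bar>)" for s s' x y
    proof -
      have "\<bar>?\<psi> s x - ?\<psi> s' y\<bar> \<le> L * \<bar>(x - (z + c * s)) / \<kappa> - (y - (z + c * s')) / \<kappa>\<bar>"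
        using L(3)[of "(x - (z + c * s)) / \<kappa>" "(y - (z + c * s')) / \<kappa>"] by (simp add: abs_minus_commute)
      also have "(x - (z + c * s)) / \<kappa> - (y - (z + c * s')) / \<kappa> = ((x - y) - c * (s - s')) / \<kappa>"
        unfolding diff_divide_distrib[symmetric] by (simp add: algebra_simps)
      also have "L * \<bar>((x - y) - c * (s - s')) / \<kappa>\<bar> = L / \<kappa> * \<bar>(x - y) - c * (s - s')\<bar>" using \<kappa> by simp
      also have "\<dots> \<le> L / \<kappa> * (\<bar>x - y\<bar> + \<bar>c\<bar> * \<bar>s - s'\<bar>)"
      proof (rule mult_left_mono)
        show "\<bar>(x - y) - c * (s - s')\<bar> \<le> \<bar>x - y\<bar> + \<bar>c\<bar> * \<bar>s - s'\<bar>"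
          using abs_triangle_ineq4[of "x - y" "c * (s - s')"] by (simp only: abs_mult)
      qed (use L(1) \<kappa> in simp)
      finally show ?thesis .
    qed
    have \<psi>1: "\<bar>?\<psi> s x\<bar> \<le> 1" for s x using unit_step_bounds[OF B, of "(x - (z + c * s)) / \<kappa>"] by auto
    interpret real_distribution "\<sigma> t" by (rule rd)
    have int: "integrable (\<sigma> t) (?\<psi> s)" for s using \<psi>1 by (intro integrable_const_bound[of _ 1]) auto
    obtain \<pi> where \<pi>: "\<pi> \<in> couplings (\<sigma> s) (\<sigma> t)" "AE z in \<pi>. \<bar>fst z - snd z\<bar> \<le> e * \<kappa> / (2 * L)"
      using \<delta>(2)[OF s(1)] s(2) unfolding \<delta>'_def min_less_iff_conj by blast
    have "\<bar>(LINT x|\<sigma> s. ?\<psi> s x) - (LINT x|\<sigma> t. ?\<psi> s x)\<bar> \<le> L / \<kappa> * (e * \<kappa> / (2 * L))"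
    proof (rule coupling_integral_diff[OF \<pi>])
      show "\<bar>?\<psi> s x - ?\<psi> s y\<bar> \<le> L / \<kappa> * \<bar>x - y\<bar>" for x y using lip[of x s y s] by simp
      show "\<bar>?\<psi> s x\<bar> \<le> 1" for x by (rule \<psi>1)
    qed (use L(1) \<kappa> in simp_all)
    also have "\<dots> = e / 2" using L(1) \<kappa> by simp
    finally have 1: "\<bar>?m s - (LINT x|\<sigma> t. ?\<psi> s x)\<bar> \<le> e / 2" .
    have 2: "(LINT x|\<sigma> t. ?\<psi> s x) - ?m t = (LINT x|\<sigma> t. ?\<psi> s x - ?\<psi> t x)"
      by (rule Bochner_Integration.integral_diff[OF int int, symmetric])
    have "\<bar>LINT x|\<sigma> t. ?\<psi> s x - ?\<psi> t x\<bar> \<le> (LINT x|\<sigma> t. e / 2)"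
    proof (rule integral_abs_bound_integral)
      fix x
      have "\<bar>c\<bar> * \<bar>s - t\<bar> \<le> c' * (e * \<kappa> / (2 * L * c'))"
        using s(2) c' by (intro mult_mono) (simp_all add: \<delta>'_def)
      also have "\<dots> = e / 2 / (L / \<kappa>)" using L(1) c' by simp
      finally have "L / \<kappa> * (\<bar>x - x\<bar> + \<bar>c\<bar> * \<bar>s - t\<bar>) \<le> e / 2"
        using L(1) \<kappa> by (simp add: field_simps)
      with lip[of x s x t] show "\<bar>?\<psi> s x - ?\<psi> t x\<bar> \<le> e / 2" by (rule order_trans)
    next
      show "integrable (\<sigma> t) (\<lambda>x. ?\<psi> s x - ?\<psi> t x)"
        by (rule Bochner_Integration.integrable_diff[OF int int])
      show "integrable (\<sigma> t) (\<lambda>x. e / 2)" by simp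
    qed
    moreover have "(LINT x|\<sigma> t. e / 2) = e / 2" using prob_space by simp
    ultimately show ?thesis using 1 2 by linarith
  qed
  moreover have "0 < \<delta>'" using \<delta>(1) e \<kappa> L(1) c' by (simp add: \<delta>'_def)
  ultimately show ?thesis by (intro exI[of _ \<delta>'] conjI ballI impI)
qed

context nonlocal_flux
begin

lemma S_curve_measurable:
  assumes \<sigma>: "\<sigma> \<in> C0_P_c T" and T: "0 \<le> T"
  shows "(\<lambda>(t, x). S (\<sigma> (max 0 (min T t))) x) \<in> borel_measurable (borel \<Otimes>\<^sub>M borel)"
proof -
  have "(\<lambda>p. \<sigma> (max 0 (min T (fst p)))) \<in> borel \<Otimes>\<^sub>M (borel :: real measure) \<rightarrow>\<^sub>M subprob_algebra borel"
    using measurable_compose[OF measurable_fst C0_P_c_measurable[OF \<sigma> T]] .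
  from bounded_integral_measurable_kernel[OF this, of "\<lambda>p y. W (y - snd p)" "w 0"]
  have "(\<lambda>p. LINT y|\<sigma> (max 0 (min T (fst p))). W (y - snd p)) \<in> borel_measurable (borel \<Otimes>\<^sub>M borel)"
    using W_bounds by simp
  then show ?thesis by (simp add: S_eq case_prod_beta')
qed

lemma weak_solution_monotone:
  assumes weak: "weak_solution v w \<eta> \<rho>\<^sub>0 T \<sigma>" and t: "0 \<le> t\<^sub>0" "t\<^sub>0 \<le> t\<^sub>1" "t\<^sub>1 \<le> T" and \<kappa>: "0 < \<kappa>"
    and B: "unit_step B B'" and sg: "sg = 1 \<or> sg = -1"
    and zone: "\<And>t x. t\<^sub>0 \<le> t \<Longrightarrow> t \<le> t\<^sub>1 \<Longrightarrow> z + c * t \<le> x \<Longrightarrow> x \<le> z + c * t + \<kappa> \<Longrightarrow> 0 \<le> sg * (c - V (S (\<sigma> t) x))"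
  defines "m \<equiv> \<lambda>t. LINT x|\<sigma> t. 1 - B ((x - (z + c * t)) / \<kappa>)"
  shows "sg * m t\<^sub>0 \<le> sg * m t\<^sub>1"
proof (rule ccontr)
  assume neg: "\<not> sg * m t\<^sub>0 \<le> sg * m t\<^sub>1"
  then have t01: "t\<^sub>0 < t\<^sub>1" using t by (cases "t\<^sub>0 = t\<^sub>1") auto
  have T: "0 \<le> T" using t by simp
  have \<sigma>: "\<sigma> \<in> C0_P_c T" using weak by (simp add: weak_solution_def)
  have rd: "real_distribution (\<sigma> t)" if "t \<in> {0..T}" for t
    using \<sigma> that by (intro P_c_real_distribution) (simp add: C0_P_c_def)
  obtain L where L: "0 < L" "\<And>x. B' x \<le> L" "\<And>x y. \<bar>B x - B y\<bar> \<le> L * \<bar>x - y\<bar>"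
    using unit_step_lipschitz[OF B] by blast
  note [measurable] = unit_step_measurable[OF B]
  have cont: "\<exists>\<delta>>0. \<forall>s\<in>{0..T}. \<bar>s - t\<bar> < \<delta> \<longrightarrow> \<bar>m s - m t\<bar> \<le> e" if t: "t \<in> {0..T}" and e: "0 < e" for t e
    unfolding m_def by (rule moving_step_integral_continuous[OF \<sigma> \<kappa> B t e])
  define \<mu> where "\<mu> = (sg * m t\<^sub>0 + sg * m t\<^sub>1) / 2"
  define \<gamma> where "\<gamma> = (sg * m t\<^sub>0 - sg * m t\<^sub>1) / 4"
  have \<gamma>: "0 < \<gamma>" using neg by (simp add: \<gamma>_def)
  obtain \<delta>\<^sub>0 where \<delta>\<^sub>0: "0 < \<delta>\<^sub>0" "\<And>s. s \<in> {0..T} \<Longrightarrow> \<bar>s - t\<^sub>0\<bar> < \<delta>\<^sub>0 \<Longrightarrow> \<bar>m s - m t\<^sub>0\<bar> \<le> \<gamma>"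
    using cont[of t\<^sub>0 \<gamma>] \<gamma> t by auto
  obtain \<delta>\<^sub>1 where \<delta>\<^sub>1: "0 < \<delta>\<^sub>1" "\<And>s. s \<in> {0..T} \<Longrightarrow> \<bar>s - t\<^sub>1\<bar> < \<delta>\<^sub>1 \<Longrightarrow> \<bar>m s - m t\<^sub>1\<bar> \<le> \<gamma>"
    using cont[of t\<^sub>1 \<gamma>] \<gamma> t by auto
  define \<epsilon> where "\<epsilon> = min (min \<delta>\<^sub>0 \<delta>\<^sub>1) (t\<^sub>1 - t\<^sub>0) / 4"
  have \<epsilon>: "0 < \<epsilon>" "4 * \<epsilon> \<le> \<delta>\<^sub>0" "4 * \<epsilon> \<le> \<delta>\<^sub>1" "4 * \<epsilon> \<le> t\<^sub>1 - t\<^sub>0" using \<delta>\<^sub>0(1) \<delta>\<^sub>1(1) t01 by (auto simp: \<epsilon>_def)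
  define s\<^sub>0 where "s\<^sub>0 = t\<^sub>0 + \<epsilon>"
  define s\<^sub>1 where "s\<^sub>1 = t\<^sub>1 - 2 * \<epsilon>"
  have s: "0 < s\<^sub>0" "s\<^sub>0 \<le> s\<^sub>1" "s\<^sub>1 + \<epsilon> < T" using \<epsilon> t by (auto simp: s\<^sub>0_def s\<^sub>1_def)
  have \<mu>\<gamma>: "sg * m t\<^sub>0 = \<mu> + 2 * \<gamma>" "sg * m t\<^sub>1 = \<mu> - 2 * \<gamma>" by (simp_all add: \<mu>_def \<gamma>_def field_simps)
  have sg_abs: "\<bar>sg * x - sg * y\<bar> = \<bar>x - y\<bar>" for x y using sg by auto
  have m0: "\<mu> + \<gamma> \<le> sg * m s" if "s \<in> {s\<^sub>0..s\<^sub>0+\<epsilon>}" for s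
  proof -
    have "\<bar>m s - m t\<^sub>0\<bar> \<le> \<gamma>" using that \<epsilon> t by (intro \<delta>\<^sub>0(2)) (auto simp: s\<^sub>0_def)
    then show ?thesis using \<mu>\<gamma>(1) sg_abs[of "m s" "m t\<^sub>0"] by linarith
  qed
  have m1: "sg * m s \<le> \<mu> - \<gamma>" if "s \<in> {s\<^sub>1..s\<^sub>1+\<epsilon>}" for s
  proof -
    have "\<bar>m s - m t\<^sub>1\<bar> \<le> \<gamma>" using that \<epsilon> t by (intro \<delta>\<^sub>1(2)) (auto simp: s\<^sub>1_def)
    then show ?thesis using \<mu>\<gamma>(2) sg_abs[of "m s" "m t\<^sub>1"] by linarith
  qed
  obtain R where R: "\<And>t. t \<in> {0..T} \<Longrightarrow> AE x in \<sigma> t. \<bar>x\<bar> \<le> R" using C0_P_c_uniform_support[OF \<sigma>] by blast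
  define A where "A = min (- R - 1) (z - \<bar>c\<bar> * T)"
  define \<theta> where "\<theta> t = B ((t - s\<^sub>0) / \<epsilon>) - B ((t - s\<^sub>1) / \<epsilon>)" for t
  define p where "p t = B' ((t - s\<^sub>0) / \<epsilon>) / \<epsilon>" for t
  define q where "q t = B' ((t - s\<^sub>1) / \<epsilon>) / \<epsilon>" for t
  define \<phi> where "\<phi> = (\<lambda>(t, x). \<theta> t * (B (x - A) - B ((x - (z + c * t)) / \<kappa>)))"
  have \<phi>: "\<phi> \<in> test_functions T"
    unfolding \<phi>_def \<theta>_def by (rule moving_step_test_function[OF B \<epsilon>(1) \<kappa> s]) (simp add: A_def)
  define b where "b t x = B' ((x - (z + c * t)) / \<kappa>) / \<kappa>" for t x
  define J where "J t = (LINT x|\<sigma> t. b t x * (c - V (S (\<sigma> t) x)))" for t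
  have d\<theta>: "(\<theta> has_real_derivative p t - q t) (at t)" for t
    unfolding \<theta>_def p_def q_def
    by (rule DERIV_diff; rule DERIV_cdivide[THEN DERIV_chain2[OF unit_stepD(3)[OF B]], THEN DERIV_cong])
       (auto intro!: derivative_eq_intros)
  have d1: "deriv (\<lambda>s. \<phi> (s, x)) t = (p t - q t) * (B (x - A) - B ((x - (z + c * t)) / \<kappa>)) + \<theta> t * (b t x * c)" for t x
  proof (rule DERIV_imp_deriv)
    have "((\<lambda>s. (x - (z + c * s)) / \<kappa>) has_real_derivative - c / \<kappa>) (at t)"
      using \<kappa> by (auto intro!: derivative_eq_intros)
    from DERIV_chain2[OF unit_stepD(3)[OF B] this]
    have "((\<lambda>s. B ((x - (z + c * s)) / \<kappa>)) has_real_derivative - (b t x * c)) (at t)" by (simp add: b_def)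
    from DERIV_mult[OF d\<theta> DERIV_diff[OF DERIV_const[of "B (x - A)"] this]]
    show "((\<lambda>s. \<phi> (s, x)) has_real_derivative
       (p t - q t) * (B (x - A) - B ((x - (z + c * t)) / \<kappa>)) + \<theta> t * (b t x * c)) (at t)"
      by (simp add: \<phi>_def algebra_simps)
  qed
  have d2: "deriv (\<lambda>y. \<phi> (t, y)) x = \<theta> t * (B' (x - A) - b t x)" for t x
  proof (rule DERIV_imp_deriv)
    have "((\<lambda>y. (y - (z + c * t)) / \<kappa>) has_real_derivative 1 / \<kappa>) (at x)"
      using \<kappa> by (auto intro!: derivative_eq_intros)
    from DERIV_chain2[OF unit_stepD(3)[OF B] this]
    have 1: "((\<lambda>y. B ((y - (z + c * t)) / \<kappa>)) has_real_derivative b t x) (at x)" by (simp add: b_def)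
    have "((\<lambda>y. y - A) has_real_derivative 1) (at x)" by (auto intro!: derivative_eq_intros)
    from DERIV_chain2[OF unit_stepD(3)[OF B] this]
    have 2: "((\<lambda>y. B (y - A)) has_real_derivative B' (x - A)) (at x)" by simp
    from DERIV_cmult[OF DERIV_diff[OF 2 1], of "\<theta> t"]
    show "((\<lambda>y. \<phi> (t, y)) has_real_derivative \<theta> t * (B' (x - A) - b t x)) (at x)" by (simp add: \<phi>_def)
  qed
  have b0: "0 \<le> b t x" "b t x \<le> L / \<kappa>" for t x
    unfolding b_def using unit_stepD(4)[OF B] L(2) \<kappa> by (auto intro: divide_right_mono)
  have vel: "\<bar>c - V (S \<nu> x)\<bar> \<le> \<bar>c\<bar> + v 0" for \<nu> x using V_nonneg[OF S_nonneg, of \<nu> x] V_le[OF S_nonneg, of \<nu> x] by linarith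
  have bvel: "\<bar>b t x * (c - V (S \<nu> x))\<bar> \<le> L / \<kappa> * (\<bar>c\<bar> + v 0)" for t x \<nu>
    unfolding abs_mult using b0[of t x] vel by (intro mult_mono) auto
  have VS: "V (S \<nu> x) = V (max 0 (S \<nu> x))" for \<nu> x using S_nonneg[of \<nu> x] by (simp add: max_def)
  have Sm: "(\<lambda>x. S (\<sigma> t) x) \<in> borel_measurable borel" if "t \<in> {0..T}" for t
  proof -
    have "max 0 (min T t) = t" using that by simp
    then show ?thesis using measurable_Pair2[OF S_curve_measurable[OF \<sigma> T], of t] by simp
  qed
  have inner: "(LINT x|\<sigma> t. deriv (\<lambda>s. \<phi> (s, x)) t + deriv (\<lambda>y. \<phi> (t, y)) x * nonlocal_velocity v w \<eta> (\<sigma> t) x)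
      = (p t - q t) * m t + \<theta> t * J t" if t: "t \<in> {0..T}" for t
  proof -
    interpret real_distribution "\<sigma> t" by (rule rd[OF t])
    note [measurable] = Sm[OF t]
    have "(LINT x|\<sigma> t. deriv (\<lambda>s. \<phi> (s, x)) t + deriv (\<lambda>y. \<phi> (t, y)) x * nonlocal_velocity v w \<eta> (\<sigma> t) x)
      = (LINT x|\<sigma> t. (p t - q t) * (1 - B ((x - (z + c * t)) / \<kappa>)) + \<theta> t * (b t x * (c - V (S (\<sigma> t) x))))"
    proof (rule integral_cong_AE)
      show "AE x in \<sigma> t. deriv (\<lambda>s. \<phi> (s, x)) t + deriv (\<lambda>y. \<phi> (t, y)) x * nonlocal_velocity v w \<eta> (\<sigma> t) x =
         (p t - q t) * (1 - B ((x - (z + c * t)) / \<kappa>)) + \<theta> t * (b t x * (c - V (S (\<sigma> t) x)))"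
        using R[OF t]
      proof eventually_elim
        case (elim x)
        then have "1 \<le> x - A" by (simp add: A_def min_def abs_le_iff)
        then have "B (x - A) = 1" "B' (x - A) = 0" using unit_stepD(6,7)[OF B] by auto
        then show ?case unfolding d1 d2 nonlocal_velocity_eq by (simp add: algebra_simps)
      qed
      show "(\<lambda>x. deriv (\<lambda>s. \<phi> (s, x)) t + deriv (\<lambda>y. \<phi> (t, y)) x * nonlocal_velocity v w \<eta> (\<sigma> t) x) \<in> borel_measurable (\<sigma> t)"
        unfolding d1 d2 nonlocal_velocity_eq b_def VS by measurable
      show "(\<lambda>x. (p t - q t) * (1 - B ((x - (z + c * t)) / \<kappa>)) + \<theta> t * (b t x * (c - V (S (\<sigma> t) x)))) \<in> borel_measurable (\<sigma> t)"
        unfolding b_def VS by measurable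
    qed
    also have "\<dots> = (p t - q t) * m t + \<theta> t * J t"
    proof -
      have "integrable (\<sigma> t) (\<lambda>x. 1 - B ((x - (z + c * t)) / \<kappa>))"
        using unit_step_bounds[OF B] by (intro integrable_const_bound[of _ 1]) (auto simp: abs_le_iff intro!: AE_I2 order_trans[OF _ add_increasing])
      moreover have "(\<lambda>x. b t x * (c - V (S (\<sigma> t) x))) \<in> borel_measurable (\<sigma> t)" unfolding b_def VS by measurable
      then have "integrable (\<sigma> t) (\<lambda>x. b t x * (c - V (S (\<sigma> t) x)))"
        using bvel by (intro integrable_const_bound[of _ "L / \<kappa> * (\<bar>c\<bar> + v 0)"]) auto
      ultimately show ?thesis by (simp add: m_def J_def)
    qed
    finally show ?thesis .
  qed
  have eq0: "(LBINT t:{0..T}. (p t - q t) * m t + \<theta> t * J t) = 0"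
  proof -
    have "(LBINT t:{0..T}. (p t - q t) * m t + \<theta> t * J t) = (LBINT t:{0..T}. (LINT x|\<sigma> t.
        deriv (\<lambda>s. \<phi> (s, x)) t + deriv (\<lambda>y. \<phi> (t, y)) x * nonlocal_velocity v w \<eta> (\<sigma> t) x))"
      by (rule set_lebesgue_integral_cong) (use inner in auto)
    then show ?thesis using weak \<phi> by (simp add: weak_solution_def)
  qed
  let ?c = "\<lambda>t. max 0 (min T t)"
  have km: "(\<lambda>t. \<sigma> (?c t)) \<in> borel \<rightarrow>\<^sub>M subprob_algebra borel" by (rule C0_P_c_measurable[OF \<sigma> T])
  have mm: "(\<lambda>t. LINT x|\<sigma> (?c t). 1 - B ((x - (z + c * t)) / \<kappa>)) \<in> borel_measurable borel"
  proof (rule bounded_integral_measurable_kernel[OF km])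
    show "\<bar>1 - B ((x - (z + c * t)) / \<kappa>)\<bar> \<le> 1" for t x
      using unit_step_bounds[OF B, of "(x - (z + c * t)) / \<kappa>"] by (simp add: abs_le_iff)
  qed measurable
  have Jm: "(\<lambda>t. LINT x|\<sigma> (?c t). b t x * (c - V (S (\<sigma> (?c t)) x))) \<in> borel_measurable borel"
  proof (rule bounded_integral_measurable_kernel[OF km _ bvel])
    have "(\<lambda>p. S (\<sigma> (?c (fst p))) (snd p)) \<in> borel_measurable (borel \<Otimes>\<^sub>M borel)"
      using S_curve_measurable[OF \<sigma> T] by (simp add: case_prod_beta')
    note [measurable] = this
    show "(\<lambda>(t, x). b t x * (c - V (S (\<sigma> (?c t)) x))) \<in> borel_measurable (borel \<Otimes>\<^sub>M borel)"
      unfolding b_def VS case_prod_beta' by measurable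
  qed
  have clamp: "?c t = t" if "t \<in> {0..T}" for t using that by auto
  have pq[measurable]: "p \<in> borel_measurable borel" "q \<in> borel_measurable borel" "\<theta> \<in> borel_measurable borel"
    unfolding p_def q_def \<theta>_def by measurable
  have mb: "\<bar>m t\<bar> \<le> 1" if t: "t \<in> {0..T}" for t
  proof -
    interpret real_distribution "\<sigma> t" by (rule rd[OF t])
    have "\<bar>m t\<bar> \<le> (LINT x|\<sigma> t. 1)" unfolding m_def
    proof (rule integral_abs_bound_integral)
      show "integrable (\<sigma> t) (\<lambda>x. 1 - B ((x - (z + c * t)) / \<kappa>))"
        using unit_step_bounds[OF B] by (intro integrable_const_bound[of _ 1]) (auto simp: abs_le_iff intro!: AE_I2 order_trans[OF _ add_increasing])
      show "\<bar>1 - B ((x - (z + c * t)) / \<kappa>)\<bar> \<le> 1" for x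
        using unit_step_bounds[OF B, of "(x - (z + c * t)) / \<kappa>"] by (simp add: abs_le_iff)
    qed simp
    then show ?thesis using prob_space by simp
  qed
  have Jb: "\<bar>J t\<bar> \<le> L / \<kappa> * (\<bar>c\<bar> + v 0)" if t: "t \<in> {0..T}" for t
  proof -
    interpret real_distribution "\<sigma> t" by (rule rd[OF t])
    note [measurable] = Sm[OF t]
    have "(\<lambda>x. b t x * (c - V (S (\<sigma> t) x))) \<in> borel_measurable (\<sigma> t)" unfolding b_def VS by measurable
    then have "integrable (\<sigma> t) (\<lambda>x. b t x * (c - V (S (\<sigma> t) x)))"
      using bvel by (intro integrable_const_bound[of _ "L / \<kappa> * (\<bar>c\<bar> + v 0)"]) auto
    then have "\<bar>J t\<bar> \<le> (LINT x|\<sigma> t. L / \<kappa> * (\<bar>c\<bar> + v 0))" unfolding J_def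
      using bvel by (intro integral_abs_bound_integral) auto
    then show ?thesis using prob_space by simp
  qed
  have pb: "\<bar>p t - q t\<bar> \<le> L / \<epsilon>" and \<theta>b: "0 \<le> \<theta> t" "\<theta> t \<le> 1" for t
  proof -
    have "0 \<le> p t" "p t \<le> L / \<epsilon>" "0 \<le> q t" "q t \<le> L / \<epsilon>" unfolding p_def q_def
      using unit_stepD(4)[OF B] L(2) \<epsilon>(1) by (auto intro: divide_right_mono)
    then show "\<bar>p t - q t\<bar> \<le> L / \<epsilon>" by linarith
    have "(t - s\<^sub>1) / \<epsilon> \<le> (t - s\<^sub>0) / \<epsilon>" using s(2) \<epsilon>(1) by (intro divide_right_mono) auto
    from unit_step_mono[OF B this] show "0 \<le> \<theta> t" by (simp add: \<theta>_def)
    show "\<theta> t \<le> 1" using unit_step_bounds[OF B, of "(t - s\<^sub>0) / \<epsilon>"] unit_step_bounds[OF B, of "(t - s\<^sub>1) / \<epsilon>"] by (simp add: \<theta>_def)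
  qed
  have int: "set_integrable lborel {0..T} (\<lambda>t. (p t - q t) * m t + \<theta> t * J t)"
  proof -
    let ?f = "\<lambda>t. (p t - q t) * (LINT x|\<sigma> (?c t). 1 - B ((x - (z + c * t)) / \<kappa>))
       + \<theta> t * (LINT x|\<sigma> (?c t). b t x * (c - V (S (\<sigma> (?c t)) x)))"
    have f: "?f t = (p t - q t) * m t + \<theta> t * J t" if "t \<in> {0..T}" for t
      unfolding clamp[OF that] m_def J_def ..
    have "set_integrable lborel {0..T} ?f"
      unfolding set_integrable_def
    proof (rule integrableI_bounded_set_indicator[where B = "L / \<epsilon> * 1 + 1 * (L / \<kappa> * (\<bar>c\<bar> + v 0))"])
      show "?f \<in> borel_measurable lborel" using mm Jm by measurable
    show "AE t in lborel. t \<in> {0..T} \<longrightarrow> norm (?f t) \<le> L / \<epsilon> * 1 + 1 * (L / \<kappa> * (\<bar>c\<bar> + v 0))"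
    proof (intro AE_I2 impI)
      fix t assume t: "t \<in> {0..T}"
      have "\<bar>(p t - q t) * m t\<bar> \<le> L / \<epsilon> * 1" unfolding abs_mult using pb mb[OF t] L(1) \<epsilon>(1) by (intro mult_mono) auto
      moreover have "\<bar>\<theta> t * J t\<bar> \<le> 1 * (L / \<kappa> * (\<bar>c\<bar> + v 0))" unfolding abs_mult using \<theta>b Jb[OF t] by (intro mult_mono) auto
      ultimately show "norm (?f t) \<le> L / \<epsilon> * 1 + 1 * (L / \<kappa> * (\<bar>c\<bar> + v 0))" unfolding f[OF t] by simp
    qed
    qed (use T in auto)
    then show ?thesis by (rule set_integrable_cong[THEN iffD1, rotated 3]) (use f in auto)
  qed
  have "set_integrable lborel {0..T} p" "(LBINT t:{0..T}. p t) = 1" "set_integrable lborel {0..T} q" "(LBINT t:{0..T}. q t) = 1"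
    unfolding p_def q_def using integral_unit_step[OF B \<epsilon>(1), of 0 s\<^sub>0 T] integral_unit_step[OF B \<epsilon>(1), of 0 s\<^sub>1 T] s \<epsilon>(1) by auto
  note pqi = this
  have "(LBINT t:{0..T}. (\<mu> + \<gamma>) * p t - (\<mu> - \<gamma>) * q t) \<le> (LBINT t:{0..T}. sg * ((p t - q t) * m t + \<theta> t * J t))"
  proof (rule set_integral_mono)
    fix t assume t': "t \<in> {0..T}"
    have p0: "0 \<le> p t" "0 \<le> q t" unfolding p_def q_def using unit_stepD(4)[OF B] \<epsilon>(1) by auto
    have 1: "(\<mu> + \<gamma>) * p t \<le> sg * m t * p t"
    proof (cases "t \<in> {s\<^sub>0..s\<^sub>0+\<epsilon>}")
      case False
      then have "(t - s\<^sub>0) / \<epsilon> \<le> 0 \<or> 1 \<le> (t - s\<^sub>0) / \<epsilon>" using \<epsilon>(1) by (auto simp: field_simps)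
      then have "p t = 0" unfolding p_def by (simp add: unit_stepD(7)[OF B])
      then show ?thesis by simp
    qed (use m0 p0 in \<open>auto intro: mult_right_mono\<close>)
    have 2: "sg * m t * q t \<le> (\<mu> - \<gamma>) * q t"
    proof (cases "t \<in> {s\<^sub>1..s\<^sub>1+\<epsilon>}")
      case False
      then have "(t - s\<^sub>1) / \<epsilon> \<le> 0 \<or> 1 \<le> (t - s\<^sub>1) / \<epsilon>" using \<epsilon>(1) by (auto simp: field_simps)
      then have "q t = 0" unfolding q_def by (simp add: unit_stepD(7)[OF B])
      then show ?thesis by simp
    qed (use m1 p0 in \<open>auto intro: mult_right_mono\<close>)
    have 3: "0 \<le> \<theta> t * (sg * J t)"
    proof (cases "t \<in> {s\<^sub>0..s\<^sub>1+\<epsilon>}")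
      case True
      have "sg * J t = (LINT x|\<sigma> t. b t x * (sg * (c - V (S (\<sigma> t) x))))"
        unfolding J_def by (subst integral_mult_right_zero[symmetric]) (simp add: mult_ac)
      also have "0 \<le> \<dots>"
      proof (rule Bochner_Integration.integral_nonneg)
        fix x
        show "0 \<le> b t x * (sg * (c - V (S (\<sigma> t) x)))"
        proof (cases "z + c * t \<le> x \<and> x \<le> z + c * t + \<kappa>")
          case True
          then show ?thesis using \<open>t \<in> {s\<^sub>0..s\<^sub>1+\<epsilon>}\<close> zone[of t x] b0[of t x] \<epsilon>(1) by (simp add: s\<^sub>0_def s\<^sub>1_def)
        next
          case False
          then have "(x - (z + c * t)) / \<kappa> \<le> 0 \<or> 1 \<le> (x - (z + c * t)) / \<kappa>" using \<kappa> by (auto simp: field_simps)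
          then have "b t x = 0" unfolding b_def by (simp add: unit_stepD(7)[OF B])
          then show ?thesis by simp
        qed
      qed
      finally show ?thesis using \<theta>b(1) by simp
    next
      case False
      then consider "t < s\<^sub>0" | "s\<^sub>1 + \<epsilon> < t" by auto
      then have "\<theta> t = 0"
      proof cases
        case 1
        then show ?thesis using s \<epsilon>(1) by (simp add: \<theta>_def unit_stepD(5)[OF B] divide_nonpos_pos)
      next
        case 2
        then show ?thesis using s \<epsilon>(1) by (simp add: \<theta>_def unit_stepD(6)[OF B])
      qed
      then show ?thesis by simp
    qed
    have "sg * ((p t - q t) * m t + \<theta> t * J t) = sg * m t * p t - sg * m t * q t + \<theta> t * (sg * J t)"
      by (simp add: algebra_simps)
    then show "(\<mu> + \<gamma>) * p t - (\<mu> - \<gamma>) * q t \<le> sg * ((p t - q t) * m t + \<theta> t * J t)"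
      using 1 2 3 by linarith
  qed (use int pqi in \<open>auto intro!: set_integral_diff set_integrable_mult_right\<close>)
  also have "\<dots> = 0" using eq0 by simp
  also have "(LBINT t:{0..T}. (\<mu> + \<gamma>) * p t - (\<mu> - \<gamma>) * q t) = 2 * \<gamma>"
    using pqi by (subst set_integral_diff) auto
  finally show False using \<gamma> by simp
qed

end

section \<open>Uniqueness of weak solutions\<close>

lemma le_cdf_right_limit:
  assumes \<mu>: "real_distribution \<mu>" and le: "\<And>\<kappa>. 0 < \<kappa> \<Longrightarrow> \<kappa> \<le> k \<Longrightarrow> a \<le> cdf \<mu> (y + \<kappa>)" and k: "0 < k"
  shows "a \<le> cdf \<mu> y"
proof -
  interpret real_distribution \<mu> by fact
  have "(cdf \<mu> \<longlongrightarrow> cdf \<mu> y) (at_right y)" using cdf_is_right_cont[of y] by (simp add: continuous_within)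
  moreover have "\<forall>\<^sub>F x in at_right y. a \<le> cdf \<mu> x"
  proof -
    have "a \<le> cdf \<mu> x" if "y < x" "x < y + k" for x using le[of "x - y"] that by simp
    then show ?thesis using k unfolding eventually_at_right_field by (intro exI[of _ "y + k"]) auto
  qed
  ultimately show ?thesis by (rule tendsto_lowerbound) simp
qed

context nonlocal_flux
begin

lemma moving_step_cdf:
  assumes \<mu>: "real_distribution \<mu>" and \<kappa>: "0 < \<kappa>" and B: "unit_step B B'"
  shows "cdf \<mu> y \<le> (LINT x|\<mu>. 1 - B ((x - y) / \<kappa>))" "(LINT x|\<mu>. 1 - B ((x - y) / \<kappa>)) \<le> cdf \<mu> (y + \<kappa>)"
proof -
  interpret real_distribution \<mu> by fact
  note [measurable] = unit_step_measurable[OF B]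
  have c: "cdf \<mu> a = (LINT x|\<mu>. indicator {..a} x)" for a by (simp add: cdf_def)
  have b: "0 \<le> 1 - B x" "1 - B x \<le> 1" for x using unit_step_bounds[OF B, of x] by auto
  have int: "integrable \<mu> (\<lambda>x. 1 - B ((x - y) / \<kappa>))"
    by (rule integrable_const_bound[of _ 1]) (use b in \<open>auto simp: abs_le_iff intro!: AE_I2 order_trans[OF _ b(1)]\<close>)
  have int': "integrable \<mu> (indicator {..a} :: real \<Rightarrow> real)" for a
    by (rule integrable_const_bound[of _ 1]) auto
  show "cdf \<mu> y \<le> (LINT x|\<mu>. 1 - B ((x - y) / \<kappa>))"
    unfolding c
  proof (rule integral_mono[OF int' int])
    fix x
    have "x \<le> y \<Longrightarrow> B ((x - y) / \<kappa>) = 0" using \<kappa> by (intro unit_stepD(5)[OF B] divide_nonpos_pos) auto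
    then show "indicator {..y} x \<le> 1 - B ((x - y) / \<kappa>)" using b[of "(x - y) / \<kappa>"] by (auto simp: indicator_def)
  qed
  show "(LINT x|\<mu>. 1 - B ((x - y) / \<kappa>)) \<le> cdf \<mu> (y + \<kappa>)"
    unfolding c
  proof (rule integral_mono[OF int int'])
    fix x
    have "y + \<kappa> < x \<Longrightarrow> B ((x - y) / \<kappa>) = 1" using \<kappa> by (intro unit_stepD(6)[OF B]) (simp add: pos_le_divide_eq)
    then show "1 - B ((x - y) / \<kappa>) \<le> indicator {..y + \<kappa>} x" using b[of "(x - y) / \<kappa>"] by (auto simp: indicator_def not_le)
  qed
qed

lemma weak_solution_real_distribution:
  "weak_solution v w \<eta> \<rho>\<^sub>0 T \<sigma> \<Longrightarrow> 0 \<le> t \<Longrightarrow> t \<le> T \<Longrightarrow> real_distribution (\<sigma> t)"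
  by (intro P_c_real_distribution) (simp add: weak_solution_def C0_P_c_def)

lemma upper_barrier:
  assumes weak: "weak_solution v w \<eta> \<rho>\<^sub>0 T \<sigma>" and t: "0 \<le> t" "0 \<le> h" "t + h \<le> T" and \<kappa>: "0 < \<kappa>"
    and zone: "\<And>s x. t \<le> s \<Longrightarrow> s \<le> t + h \<Longrightarrow> y + c * (s - t) \<le> x \<Longrightarrow> x \<le> y + c * (s - t) + \<kappa> \<Longrightarrow> V (S (\<sigma> s) x) \<le> c"
  shows "cdf (\<sigma> t) y \<le> cdf (\<sigma> (t + h)) (y + c * h + \<kappa>)"
proof -
  obtain B B' where B: "unit_step B B'" using smooth_step_exists by (auto simp: unit_step_def)
  let ?z = "y - c * t"
  have eq: "?z + c * s = y + c * (s - t)" for s by (simp add: algebra_simps)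
  have rd: "real_distribution (\<sigma> t)" "real_distribution (\<sigma> (t + h))"
    using weak_solution_real_distribution[OF weak] t by auto
  have "1 * (LINT x|\<sigma> t. 1 - B ((x - (?z + c * t)) / \<kappa>)) \<le> 1 * (LINT x|\<sigma> (t + h). 1 - B ((x - (?z + c * (t + h))) / \<kappa>))"
    by (rule weak_solution_monotone[OF weak _ _ _ \<kappa> B]) (use t zone in \<open>auto simp: eq\<close>)
  then show ?thesis
    using moving_step_cdf[OF rd(1) \<kappa> B, of y] moving_step_cdf[OF rd(2) \<kappa> B, of "y + c * h"] by (simp add: eq)
qed

lemma lower_barrier:
  assumes weak: "weak_solution v w \<eta> \<rho>\<^sub>0 T \<sigma>" and t: "0 \<le> t" "0 \<le> h" "t + h \<le> T" and \<kappa>: "0 < \<kappa>"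
    and zone: "\<And>s x. t \<le> s \<Longrightarrow> s \<le> t + h \<Longrightarrow> y + c * (s - t) \<le> x \<Longrightarrow> x \<le> y + c * (s - t) + \<kappa> \<Longrightarrow> c \<le> V (S (\<sigma> s) x)"
  shows "cdf (\<sigma> (t + h)) (y + c * h) \<le> cdf (\<sigma> t) (y + \<kappa>)"
proof -
  obtain B B' where B: "unit_step B B'" using smooth_step_exists by (auto simp: unit_step_def)
  let ?z = "y - c * t"
  have eq: "?z + c * s = y + c * (s - t)" for s by (simp add: algebra_simps)
  have rd: "real_distribution (\<sigma> t)" "real_distribution (\<sigma> (t + h))"
    using weak_solution_real_distribution[OF weak] t by auto
  have "(-1) * (LINT x|\<sigma> t. 1 - B ((x - (?z + c * t)) / \<kappa>)) \<le> (-1) * (LINT x|\<sigma> (t + h). 1 - B ((x - (?z + c * (t + h))) / \<kappa>))"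
    by (rule weak_solution_monotone[OF weak _ _ _ \<kappa> B]) (use t zone in \<open>auto simp: eq\<close>)
  then show ?thesis
    using moving_step_cdf[OF rd(1) \<kappa> B, of y] moving_step_cdf[OF rd(2) \<kappa> B, of "y + c * h"] by (simp add: eq)
qed

end

context flux_flow
begin

text \<open>\<open>close \<mu> t d\<close>: the monotone rearrangement of \<open>\<mu>\<close> is within distance \<open>d\<close> of \<open>X t\<close>.\<close>

definition close :: "real measure \<Rightarrow> real \<Rightarrow> real \<Rightarrow> bool" where
  "close \<mu> t d \<longleftrightarrow> (\<forall>a\<in>{0..1}. a \<le> cdf \<mu> (X t a + d) \<and> cdf \<mu> (X t a - d) \<le> a)"

lemma close_mono: "real_distribution \<mu> \<Longrightarrow> close \<mu> t d \<Longrightarrow> d \<le> e \<Longrightarrow> close \<mu> t e"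
proof -
  assume \<mu>: "real_distribution \<mu>" and d: "close \<mu> t d" "d \<le> e"
  interpret real_distribution \<mu> by fact
  show "close \<mu> t e"
    unfolding close_def
  proof (intro ballI conjI)
    fix a :: real assume "a \<in> {0..1}"
    then show "a \<le> cdf \<mu> (X t a + e)" "cdf \<mu> (X t a - e) \<le> a"
      using d cdf_nondecreasing[of "X t a + d" "X t a + e"] cdf_nondecreasing[of "X t a - e" "X t a - d"]
      by (force simp: close_def)+
  qed
qed

lemma close_cdf:
  assumes \<mu>: "real_distribution \<mu>" and t: "0 \<le> t" and d: "0 \<le> d" "close \<mu> t d"
  shows "\<bar>cdf \<mu> x - cdf (law (X t)) x\<bar> \<le> M * d"
proof -
  interpret \<mu>: real_distribution \<mu> by fact
  note E = M expand[OF t]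
  interpret \<rho>: real_distribution "law (X t)" by (rule real_distribution_law[OF E])
  have "cdf (law (X t)) (x - d) \<le> cdf \<mu> x"
  proof (rule dense_le)
    fix a assume a: "a < cdf (law (X t)) (x - d)"
    show "a \<le> cdf \<mu> x"
    proof (cases "0 \<le> a")
      case True
      have a1: "a \<le> 1" using a \<rho>.cdf_bounded_prob[of "x - d"] by linarith
      have "X t a \<le> x - d" using cdf_law_le[OF E True, of "x - d"] a by linarith
      then have "cdf \<mu> (X t a + d) \<le> cdf \<mu> x" by (intro \<mu>.cdf_nondecreasing) simp
      moreover have "a \<le> cdf \<mu> (X t a + d)" using d(2) True a1 by (simp add: close_def)
      ultimately show ?thesis by linarith
    qed (use \<mu>.cdf_nonneg[of x] in linarith)
  qed
  moreover have "cdf \<mu> x \<le> cdf (law (X t)) (x + d)"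
  proof (rule dense_ge)
    fix a assume a: "cdf (law (X t)) (x + d) < a"
    show "cdf \<mu> x \<le> a"
    proof (cases "a \<le> 1")
      case True
      have a0: "0 \<le> a" using a \<rho>.cdf_nonneg[of "x + d"] by linarith
      have "x + d < X t a" using cdf_law_ge[OF E True, of "x + d"] a by linarith
      then have "cdf \<mu> x \<le> cdf \<mu> (X t a - d)" by (intro \<mu>.cdf_nondecreasing) simp
      moreover have "cdf \<mu> (X t a - d) \<le> a" using d(2) True a0 by (simp add: close_def)
      ultimately show ?thesis by linarith
    qed (use \<mu>.cdf_bounded_prob[of x] in linarith)
  qed
  ultimately show ?thesis
    using cdf_law_diff[OF E, of "x - d" x] cdf_law_diff[OF E, of x "x + d"] d(1) by (simp add: abs_le_iff)
qed

lemma close_velocity: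
  assumes "real_distribution \<mu>" "0 \<le> t" "0 \<le> d" "close \<mu> t d"
  shows "\<bar>V (S \<mu> x) - U t x\<bar> \<le> K * d"
proof -
  have "\<bar>S \<mu> x - S (law (X t)) x\<bar> \<le> w 0 * (2 * (M * d))"
    by (intro S_cdf_diff close_cdf assms real_distribution_law[OF M expand])
  from V_lipschitz[OF S_nonneg S_nonneg this] show ?thesis by (simp add: U_def K_def mult_ac)
qed

lemma close_transport:
  assumes weak: "weak_solution v w \<eta> \<rho>\<^sub>0 T \<sigma>" and t: "0 \<le> t" "0 \<le> h" "t + h \<le> T"
    and d: "0 \<le> d" "close (\<sigma> t) t d"
  shows "close (\<sigma> (t + h)) (t + h) (d + v 0 * h)"
  unfolding close_def
proof (intro ballI conjI)
  fix a :: real assume a: "a \<in> {0..1}"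
  have rd: "real_distribution (\<sigma> t)" "real_distribution (\<sigma> (t + h))"
    using weak_solution_real_distribution[OF weak] t by auto
  interpret r: real_distribution "\<sigma> (t + h)" by (rule rd)
  have X: "X t a \<le> X (t + h) a" "X (t + h) a \<le> X t a + v 0 * h" using flow_move[of t "t + h" a] t by auto
  have "a \<le> cdf (\<sigma> (t + h)) (X t a + d + v 0 * h)"
  proof (rule le_cdf_right_limit[OF rd(2) _ zero_less_one])
    fix \<kappa> :: real assume \<kappa>: "0 < \<kappa>"
    have "cdf (\<sigma> t) (X t a + d) \<le> cdf (\<sigma> (t + h)) (X t a + d + v 0 * h + \<kappa>)"
      by (rule upper_barrier[OF weak t \<kappa>]) (simp add: V_le S_nonneg)
    then show "a \<le> cdf (\<sigma> (t + h)) (X t a + d + v 0 * h + \<kappa>)" using d(2) a by (force simp: close_def)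
  qed
  also have "\<dots> \<le> cdf (\<sigma> (t + h)) (X (t + h) a + (d + v 0 * h))" using X by (intro r.cdf_nondecreasing) simp
  finally show "a \<le> cdf (\<sigma> (t + h)) (X (t + h) a + (d + v 0 * h))" .
  have "cdf (\<sigma> (t + h)) (X (t + h) a - (d + v 0 * h)) \<le> cdf (\<sigma> (t + h)) (X t a - d + 0 * h)"
    using X by (intro r.cdf_nondecreasing) simp
  also have "\<dots> \<le> cdf (\<sigma> t) (X t a - d)"
  proof (rule le_cdf_right_limit[OF rd(1) _ zero_less_one])
    fix \<kappa> :: real assume \<kappa>: "0 < \<kappa>"
    show "cdf (\<sigma> (t + h)) (X t a - d + 0 * h) \<le> cdf (\<sigma> t) (X t a - d + \<kappa>)"
      by (rule lower_barrier[OF weak t \<kappa>]) (simp add: V_nonneg S_nonneg)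
  qed
  also have "\<dots> \<le> a" using d(2) a by (simp add: close_def)
  finally show "cdf (\<sigma> (t + h)) (X (t + h) a - (d + v 0 * h)) \<le> a" .
qed

text \<open>One step of the stability estimate: a barrier of constant speed moves with \<open>X\<close> up to an
  error that is quadratic in the length of the step.\<close>

lemma close_step:
  assumes weak: "weak_solution v w \<eta> \<rho>\<^sub>0 T \<sigma>" and t: "0 \<le> t" "0 \<le> h" "t + h \<le> T"
    and d: "0 \<le> d" "close (\<sigma> t) t d"
  defines "C \<equiv> K * (5 * v 0 + 2)"
  shows "close (\<sigma> (t + h)) (t + h) (d + h * (C * (d + h)))"
proof (cases "h = 0")
  case False
  then have h: "0 < h" using t by simp
  define E where "E = K * (2 * d + (3 * v 0 + 1) * h)"
  have E0: "0 \<le> E" using K_nonneg d(1) v0_nonneg h by (simp add: E_def)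
  have total: "h * E + h * (2 * K * v 0 * h) \<le> h * (C * (d + h))"
  proof -
    have "C * (d + h) - (E + 2 * K * v 0 * h) = K * (5 * v 0 * d + h)"
      by (simp add: C_def E_def algebra_simps)
    also have "0 \<le> \<dots>" using K_nonneg d(1) v0_nonneg h by simp
    finally have "h * (E + 2 * K * v 0 * h) \<le> h * (C * (d + h))" using h by (intro mult_left_mono) auto
    then show ?thesis by (simp add: distrib_left)
  qed
  have rd: "real_distribution (\<sigma> s)" if "t \<le> s" "s \<le> t + h" for s
    using weak_solution_real_distribution[OF weak, of s] t that by auto
  have vel: "\<bar>V (S (\<sigma> s) x) - U t y\<bar> \<le> E"
    if s: "t \<le> s" "s \<le> t + h" and x: "\<bar>x - y\<bar> \<le> d + v 0 * h + h" for s x y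
  proof -
    have "close (\<sigma> (t + (s - t))) (t + (s - t)) (d + v 0 * (s - t))"
      using s t d by (intro close_transport[OF weak]) auto
    then have c: "close (\<sigma> s) s (d + v 0 * (s - t))" by simp
    have "\<bar>V (S (\<sigma> s) x) - U s x\<bar> \<le> K * (d + v 0 * (s - t))"
      using s t d v0_nonneg by (intro close_velocity[OF rd[OF s] _ _ c]) auto
    also have "\<dots> \<le> K * (d + v 0 * h)" using s K_nonneg v0_nonneg by (intro mult_left_mono add_left_mono) auto
    finally have 1: "\<bar>V (S (\<sigma> s) x) - U s x\<bar> \<le> K * (d + v 0 * h)" .
    have "\<bar>U s x - U t x\<bar> \<le> K * (v 0 * \<bar>s - t\<bar>)" using s t by (intro U_lipschitz_time) auto
    also have "\<dots> \<le> K * (v 0 * h)" using s K_nonneg v0_nonneg by (intro mult_left_mono) auto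
    finally have 2: "\<bar>U s x - U t x\<bar> \<le> K * (v 0 * h)" .
    have "\<bar>U t x - U t y\<bar> \<le> K * \<bar>x - y\<bar>" using t by (intro U_lipschitz)
    also have "\<dots> \<le> K * (d + v 0 * h + h)" using x K_nonneg by (intro mult_left_mono)
    finally have 3: "\<bar>U t x - U t y\<bar> \<le> K * (d + v 0 * h + h)" .
    have "K * (d + v 0 * h) + K * (v 0 * h) + K * (d + v 0 * h + h) = E" by (simp add: E_def algebra_simps)
    then show ?thesis using 1 2 3 by linarith
  qed
  show ?thesis
    unfolding close_def
  proof (intro ballI conjI)
    fix a :: real assume a: "a \<in> {0..1}"
    let ?u = "U t (X t a)"
    interpret r: real_distribution "\<sigma> (t + h)" using h by (intro rd) auto
    have X: "\<bar>X (t + h) a - X t a - h * ?u\<bar> \<le> h * (2 * K * v 0 * h)" using a t by (intro flow_expand) auto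
    define c where "c = min (v 0) (?u + E)"
    have c: "0 \<le> c" "c \<le> v 0" "c \<le> ?u + E" using v0_nonneg U_bounds[of t "X t a"] E0 by (auto simp: c_def)
    have "a \<le> cdf (\<sigma> (t + h)) (X t a + d + c * h)"
    proof (rule le_cdf_right_limit[OF r.real_distribution_axioms _ h])
      fix \<kappa> :: real assume \<kappa>: "0 < \<kappa>" "\<kappa> \<le> h"
      have "cdf (\<sigma> t) (X t a + d) \<le> cdf (\<sigma> (t + h)) (X t a + d + c * h + \<kappa>)"
      proof (rule upper_barrier[OF weak t \<kappa>(1)])
        fix s x assume s: "t \<le> s" "s \<le> t + h" and x: "X t a + d + c * (s - t) \<le> x" "x \<le> X t a + d + c * (s - t) + \<kappa>"
        have "0 \<le> c * (s - t)" "c * (s - t) \<le> v 0 * h" using c s v0_nonneg by (auto intro: mult_mono)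
        then have "\<bar>x - X t a\<bar> \<le> d + v 0 * h + h" using x \<kappa> d(1) by linarith
        from vel[OF s this] show "V (S (\<sigma> s) x) \<le> c" using V_le[OF S_nonneg, of "\<sigma> s" x] by (simp add: c_def abs_le_iff)
      qed
      then show "a \<le> cdf (\<sigma> (t + h)) (X t a + d + c * h + \<kappa>)" using d(2) a by (force simp: close_def)
    qed
    also have "\<dots> \<le> cdf (\<sigma> (t + h)) (X (t + h) a + (d + h * (C * (d + h))))"
    proof (rule r.cdf_nondecreasing)
      have "c * h \<le> (?u + E) * h" using c h by (intro mult_right_mono) auto
      then show "X t a + d + c * h \<le> X (t + h) a + (d + h * (C * (d + h)))"
        using X total by (simp add: abs_le_iff algebra_simps)
    qed
    finally show "a \<le> cdf (\<sigma> (t + h)) (X (t + h) a + (d + h * (C * (d + h))))" .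
    define e where "e = max 0 (?u - E)"
    have e: "0 \<le> e" "e \<le> v 0" "?u - E \<le> e" using v0_nonneg U_bounds[of t "X t a"] E0 by (auto simp: e_def)
    have "cdf (\<sigma> (t + h)) (X (t + h) a - (d + h * (C * (d + h)))) \<le> cdf (\<sigma> (t + h)) (X t a - d + e * h)"
    proof (rule r.cdf_nondecreasing)
      have "(?u - E) * h \<le> e * h" using e h by (intro mult_right_mono) auto
      then show "X (t + h) a - (d + h * (C * (d + h))) \<le> X t a - d + e * h"
        using X total by (simp add: abs_le_iff algebra_simps)
    qed
    also have "\<dots> \<le> cdf (\<sigma> t) (X t a - d)"
    proof (rule le_cdf_right_limit[OF rd _ h])
      fix \<kappa> :: real assume \<kappa>: "0 < \<kappa>" "\<kappa> \<le> h"
      show "cdf (\<sigma> (t + h)) (X t a - d + e * h) \<le> cdf (\<sigma> t) (X t a - d + \<kappa>)"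
      proof (rule lower_barrier[OF weak t \<kappa>(1)])
        fix s x assume s: "t \<le> s" "s \<le> t + h" and x: "X t a - d + e * (s - t) \<le> x" "x \<le> X t a - d + e * (s - t) + \<kappa>"
        have "0 \<le> e * (s - t)" "e * (s - t) \<le> v 0 * h" using e s v0_nonneg by (auto intro: mult_mono)
        then have "\<bar>x - X t a\<bar> \<le> d + v 0 * h + h" using x \<kappa> d(1) by linarith
        from vel[OF s this] show "e \<le> V (S (\<sigma> s) x)" using V_nonneg[OF S_nonneg, of "\<sigma> s" x] by (simp add: e_def abs_le_iff)
      qed
    qed (use h in auto)
    also have "\<dots> \<le> a" using d(2) a by (simp add: close_def)
    finally show "cdf (\<sigma> (t + h)) (X (t + h) a - (d + h * (C * (d + h)))) \<le> a" .
  qed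
qed (use d in simp)

lemma weak_solution_unique:
  assumes weak: "weak_solution v w \<eta> \<rho>\<^sub>0 T \<sigma>" and init: "law (X 0) = measure_with_density \<rho>\<^sub>0" and t: "0 \<le> t" "t \<le> T"
  shows "\<sigma> t = law (X t)"
proof -
  note rd = weak_solution_real_distribution[OF weak]
  define P where "P t d \<longleftrightarrow> 0 \<le> t \<and> t \<le> T \<and> close (\<sigma> t) t d" for t d
  have close: "P t d" if d: "0 * t * exp (K * (5 * v 0 + 2) * t) < d" for d
  proof (rule discrete_gronwall[where T = T, OF _ _ order_refl _ _ t d])
    have "\<sigma> 0 = law (X 0)" using weak init by (simp add: weak_solution_def)
    then show "P 0 0" using t cdf_law_at[OF M expand[of 0]] by (auto simp: P_def close_def)
    show "0 \<le> K * (5 * v 0 + 2)" using K_nonneg v0_nonneg by simp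
    show "P (s + h) (d + h * (K * (5 * v 0 + 2) * (d + h) + 0))"
      if "0 \<le> s" "0 \<le> h" "s + h \<le> T" "0 \<le> d" "P s d" for s h d
      using close_step[OF weak, of s h d] that by (auto simp: P_def)
    show "P s e" if "P s d" "d \<le> e" for s d e
      using close_mono[OF rd[of s]] that by (auto simp: P_def)
  qed
  have "cdf (\<sigma> t) x = cdf (law (X t)) x" for x
  proof (rule ccontr)
    assume ne: "cdf (\<sigma> t) x \<noteq> cdf (law (X t)) x"
    define d where "d = \<bar>cdf (\<sigma> t) x - cdf (law (X t)) x\<bar> / (2 * M)"
    have d: "0 < d" using ne M by (simp add: d_def)
    then have "close (\<sigma> t) t d" using close[of d] by (simp add: P_def)
    from close_cdf[OF rd[OF t] t(1) _ this, of x] have "\<bar>cdf (\<sigma> t) x - cdf (law (X t)) x\<bar> \<le> M * d" using d by simp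
    also have "\<dots> = \<bar>cdf (\<sigma> t) x - cdf (law (X t)) x\<bar> / 2" using M by (simp add: d_def)
    finally show False using ne by simp
  qed
  then show ?thesis
    using t by (intro cdf_unique rd real_distribution_law[OF M expand]) auto
qed

end

section \<open>Existence of weak solutions\<close>

lemma density_bounded_by_const:
  assumes f[measurable]: "f \<in> borel_measurable lborel" and c: "0 \<le> c"
    and le: "\<And>A. A \<in> sets borel \<Longrightarrow> emeasure (density lborel f) A \<le> ennreal c * emeasure lborel A"
    and fin: "emeasure (density lborel f) UNIV < \<infinity>"
  shows "AE x in lborel. f x \<le> ennreal c"
proof -
  define A where "A = {x. ennreal c < f x}"
  have A[measurable]: "A \<in> sets borel" using f unfolding A_def by measurable
  have e: "emeasure (density lborel f) B = (\<integral>\<^sup>+x\<in>B. f x \<partial>lborel)" if "B \<in> sets borel" for B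
    using that by (subst emeasure_density) auto
  have le1: "(\<integral>\<^sup>+x\<in>A. f x \<partial>lborel) \<le> (\<integral>\<^sup>+x. ennreal c * indicator A x \<partial>lborel)"
    using le[OF A] by (simp add: e nn_integral_cmult)
  have "(\<integral>\<^sup>+x. ennreal c * indicator A x \<partial>lborel) \<le> (\<integral>\<^sup>+x\<in>A. f x \<partial>lborel)"
    by (intro nn_integral_mono) (auto simp: A_def indicator_def)
  moreover have "(\<integral>\<^sup>+x\<in>A. f x \<partial>lborel) \<le> emeasure (density lborel f) UNIV"
    unfolding e[OF A, symmetric] by (rule emeasure_mono) auto
  ultimately have fin': "(\<integral>\<^sup>+x. ennreal c * indicator A x \<partial>lborel) \<noteq> \<infinity>" using fin by (auto simp: top_unique)
  have "(\<integral>\<^sup>+x. f x * indicator A x - ennreal c * indicator A x \<partial>lborel)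
     = (\<integral>\<^sup>+x. f x * indicator A x \<partial>lborel) - (\<integral>\<^sup>+x. ennreal c * indicator A x \<partial>lborel)"
    using fin' by (intro nn_integral_diff) (auto simp: A_def indicator_def)
  also have "\<dots> = 0" using le_less_trans[OF le1] fin' le1 by (intro diff_eq_0_ennreal) (auto simp: less_top)
  finally have "AE x in lborel. f x * indicator A x - ennreal c * indicator A x = 0"
    by (subst (asm) nn_integral_0_iff_AE) auto
  then show ?thesis
  proof eventually_elim
    case (elim x)
    have "f x \<le> ennreal c" if "x \<in> A"
    proof -
      have "f x - ennreal c = 0" using elim that by simp
      then show ?thesis by (metis diff_eq_0_iff_ennreal ennreal_neq_top order.refl order_less_imp_le)
    qed
    then show ?case by (cases "x \<in> A") (auto simp: A_def not_less)
  qed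
qed

context
  fixes M :: real and X :: "real \<Rightarrow> real"
  assumes M: "0 < M" and X: "expanding M X"
begin

text \<open>The measure with distribution function \<open>M x - F x\<close> complements \<open>law X\<close> to \<open>M\<close> times Lebesgue
  measure.\<close>

lemma law_le_lborel: "A \<in> sets borel \<Longrightarrow> emeasure (law X) A \<le> ennreal M * emeasure lborel A"
proof -
  assume A: "A \<in> sets borel"
  interpret real_distribution "law X" by (rule real_distribution_law[OF M X])
  let ?F = "cdf (law X)"
  define I where "I = interval_measure (\<lambda>x. M * x - ?F x)"
  define N where "N = measure_of UNIV (sets borel) (\<lambda>A. ennreal (1 / M) * (emeasure (law X) A + emeasure I A))"
  have sets_I: "sets I = sets borel" by (simp add: I_def)
  have sets_N: "sets N = sets borel"
    using sets.sigma_sets_eq[of borel] by (simp add: N_def)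
  have em_N: "emeasure N B = ennreal (1 / M) * (emeasure (law X) B + emeasure I B)" if "B \<in> sets borel" for B
  proof (rule emeasure_measure_of[OF N_def])
    show "countably_additive (sets N) (\<lambda>A. ennreal (1 / M) * (emeasure (law X) A + emeasure I A))"
      unfolding countably_additive_def
    proof safe
      fix B :: "nat \<Rightarrow> real set" assume B: "range B \<subseteq> sets N" "disjoint_family B"
      then have B': "range B \<subseteq> sets (law X)" "range B \<subseteq> sets I" by (auto simp: sets_N sets_I)
      have "(\<Sum>i. ennreal (1 / M) * (emeasure (law X) (B i) + emeasure I (B i)))
        = ennreal (1 / M) * ((\<Sum>i. emeasure (law X) (B i)) + (\<Sum>i. emeasure I (B i)))"
        by (simp add: ennreal_suminf_cmult suminf_add)
      also have "\<dots> = ennreal (1 / M) * (emeasure (law X) (\<Union>i. B i) + emeasure I (\<Union>i. B i))"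
        using suminf_emeasure[OF B'(1) B(2)] suminf_emeasure[OF B'(2) B(2)] by simp
      finally show "(\<Sum>i. ennreal (1 / M) * (emeasure (law X) (B i) + emeasure I (B i))) =
          ennreal (1 / M) * (emeasure (law X) (\<Union>i. B i) + emeasure I (\<Union>i. B i))" .
    qed
  qed (use that in \<open>auto simp: sets_N positive_def\<close>)
  have Icc_I: "emeasure I {l..u} = ennreal (M * u - ?F u - (M * l - ?F l))" if "l \<le> u" for l u
    unfolding I_def
  proof (rule emeasure_interval_measure_Icc[OF that])
    show "M * x - ?F x \<le> M * y - ?F y" if "x \<le> y" for x y
      using cdf_law_diff[OF M X that] by (simp add: algebra_simps)
    have "M-lipschitz_on UNIV ?F"
      using cdf_law_lipschitz[OF M X] M by (intro lipschitz_onI) (auto simp: dist_real_def)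
    from lipschitz_on_continuous_on[OF this] show "continuous_on UNIV (\<lambda>x. M * x - ?F x)"
      by (intro continuous_intros)
  qed
  have Icc_law: "emeasure (law X) {l..u} = ennreal (?F u - ?F l)" if "l \<le> u" for l u
    using measure_law_Icc[OF M X, of "u - l" l] that by (simp add: emeasure_eq_measure)
  have em_Icc: "emeasure N {l..u} = ennreal (u - l)" if "l \<le> u" for l u
  proof -
    have "0 \<le> ?F u - ?F l" "0 \<le> M * u - ?F u - (M * l - ?F l)"
      using cdf_nondecreasing[OF that] cdf_law_diff[OF M X that] by (simp_all add: algebra_simps)
    then have "emeasure N {l..u} = ennreal (1 / M) * ennreal (M * (u - l))"
      using that by (simp add: em_N Icc_I Icc_law flip: ennreal_plus) (simp add: algebra_simps)
    also have "\<dots> = ennreal (u - l)" using M that by (simp flip: ennreal_mult)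
    finally show ?thesis .
  qed
  have "lborel = N"
  proof (rule lborel_eqI)
    fix l u :: real assume "\<And>b. b \<in> Basis \<Longrightarrow> l \<bullet> b \<le> u \<bullet> b"
    then have lu: "l \<le> u" by simp
    have "{l, u} \<in> null_sets N"
    proof -
      have "{x} \<in> null_sets N" for x using em_Icc[of x x] by (auto simp: null_sets_def sets_N)
      from null_sets.Un[OF this[of l] this[of u]] show ?thesis by (simp add: insert_commute)
    qed
    then have "emeasure N ({l..u} - {l, u}) = emeasure N {l..u}"
      by (rule emeasure_Diff_null_set) (simp add: sets_N)
    moreover have "{l..u} - {l, u} = box l u" by auto
    ultimately show "emeasure N (box l u) = ennreal (\<Prod>b\<in>Basis. (u - l) \<bullet> b)" using em_Icc[OF lu] by simp
  qed (simp add: sets_N)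
  then have "emeasure lborel A = ennreal (1 / M) * (emeasure (law X) A + emeasure I A)" using em_N[OF A] by simp
  then have "ennreal M * emeasure lborel A = emeasure (law X) A + emeasure I A"
    using M by (simp add: mult.assoc[symmetric] flip: ennreal_mult)
  then show ?thesis by simp
qed

lemma law_density:
  "\<exists>r\<in>borel_measurable borel. law X = measure_with_density r \<and> (AE x in lborel. 0 \<le> r x \<and> r x \<le> M)"
proof -
  interpret real_distribution "law X" by (rule real_distribution_law[OF M X])
  have "absolutely_continuous lborel (law X)"
    unfolding absolutely_continuous_def
  proof
    fix A :: "real set" assume "A \<in> null_sets lborel"
    then show "A \<in> null_sets (law X)" using law_le_lborel[of A] by (auto simp: null_sets_def)
  qed
  then obtain f where f: "f \<in> borel_measurable lborel" "density lborel f = law X"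
    using sigma_finite_measure.Radon_Nikodym[OF sigma_finite_lborel, of "law X"] by auto
  have le: "AE x in lborel. f x \<le> ennreal M"
    by (rule density_bounded_by_const[OF f(1)]) (use M law_le_lborel emeasure_space_1 in \<open>auto simp: f(2)\<close>)
  let ?r = "\<lambda>x. enn2real (f x)"
  have r: "?r \<in> borel_measurable borel" using f(1) by simp
  have "law X = measure_with_density ?r"
    unfolding measure_with_density_def f(2)[symmetric]
  proof (rule density_cong)
    show "AE x in lborel. f x = ennreal (enn2real (f x))"
      using le by eventually_elim (metis ennreal_enn2real ennreal_less_top le_less_trans)
  qed (use f(1) r in auto)
  moreover have "AE x in lborel. 0 \<le> ?r x \<and> ?r x \<le> M"
    using le by eventually_elim (use M in \<open>auto intro: enn2real_leI\<close>)
  ultimately show ?thesis using r by blast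
qed

end

lemma law_cong:
  assumes [measurable]: "X \<in> borel_measurable borel" "Y \<in> borel_measurable borel" and eq: "\<And>a. a \<in> {0..1} \<Longrightarrow> X a = Y a"
  shows "law X = law Y"
  unfolding law_def
proof (rule distr_cong_AE)
  have "AE a in uniform_measure lborel {0..1::real}. a \<in> {0..1}" by (rule AE_uniform_measureI) auto
  then show "AE a in uniform_measure lborel {0..1}. X a = Y a" by eventually_elim (rule eq)
qed auto

lemma C0_P_c_cong:
  assumes \<mu>: "\<mu> \<in> C0_P_c T" and eq: "\<And>t. t \<in> {0..T} \<Longrightarrow> \<nu> t = \<mu> t"
  shows "\<nu> \<in> C0_P_c T"
  unfolding C0_P_c_def mem_Collect_eq
proof (intro ballI conjI)
  fix t assume t: "t \<in> {0..T}"
  show "\<nu> t \<in> P_c" using \<mu> t eq by (simp add: C0_P_c_def)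
  have "((\<lambda>s. W_inf (\<mu> s) (\<mu> t)) \<longlongrightarrow> 0) (at t within {0..T})" using \<mu> t by (simp add: C0_P_c_def)
  then show "((\<lambda>s. W_inf (\<nu> s) (\<nu> t)) \<longlongrightarrow> 0) (at t within {0..T})"
    by (rule Lim_transform_eventually) (use t eq in \<open>auto simp: eventually_at_filter\<close>)
qed

lemma test_function_derivatives:
  assumes \<phi>: "\<phi> \<in> test_functions T"
  obtains D\<^sub>1 D\<^sub>2 :: "real \<times> real \<Rightarrow> real" and B where
    "\<And>t x. deriv (\<lambda>s. \<phi> (s, x)) t = D\<^sub>1 (t, x)" "\<And>t x. deriv (\<lambda>y. \<phi> (t, y)) x = D\<^sub>2 (t, x)"
    "D\<^sub>1 \<in> borel_measurable borel" "D\<^sub>2 \<in> borel_measurable borel" "0 \<le> B" "\<And>p. \<bar>D\<^sub>1 p\<bar> \<le> B" "\<And>p. \<bar>D\<^sub>2 p\<bar> \<le> B"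
    "\<And>t x. (\<phi> has_derivative (\<lambda>h. fst h * D\<^sub>1 (t, x) + snd h * D\<^sub>2 (t, x))) (at (t, x))"
proof -
  have C1: "C_k (Suc 0) \<phi>" and cpt: "compact (supp \<phi>)"
    using \<phi> by (auto simp: test_functions_def C_infinity_def)
  define D where "D h p = frechet_derivative \<phi> (at p) h" for h p
  have "\<phi> differentiable (at p)" for p using C1 unfolding C_k.simps by blast
  then have d: "(\<phi> has_derivative (\<lambda>h. D h p)) (at p)" for p
    unfolding D_def frechet_derivative_works .
  have cont: "continuous_on UNIV (D h)" for h using C1 unfolding C_k.simps D_def[abs_def] by blast
  have lin: "linear (\<lambda>h. D h p)" for p using d by (rule has_derivative_linear)
  have D: "D h p = fst h * D (1, 0) p + snd h * D (0, 1) p" for h p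
  proof -
    have "D (fst h *\<^sub>R (1, 0) + snd h *\<^sub>R (0, 1)) p = fst h *\<^sub>R D (1, 0) p + snd h *\<^sub>R D (0, 1) p"
      by (simp only: linear_add[OF lin] linear_cmul[OF lin])
    then show ?thesis by simp
  qed
  have out: "D h p = 0" if "p \<notin> supp \<phi>" for h p
  proof -
    have "open (- supp \<phi>)" unfolding supp_def by auto
    moreover have "\<phi> q = 0" if "q \<in> - supp \<phi>" for q using that closure_subset[of "{x. \<phi> x \<noteq> 0}"] by (auto simp: supp_def)
    ultimately have "(\<phi> has_derivative (\<lambda>h. 0)) (at p)"
      using that by (intro has_derivative_transform_within_open[OF has_derivative_const[of 0]]) auto
    from has_derivative_unique[OF this d] show ?thesis by metis
  qed
  have bd: "\<exists>B. \<forall>p. \<bar>D h p\<bar> \<le> B" for h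
  proof -
    have "compact (D h ` supp \<phi>)" by (intro compact_continuous_image cpt continuous_on_subset[OF cont]) simp
    then obtain B where B: "\<forall>y\<in>D h ` supp \<phi>. \<bar>y\<bar> \<le> B" using compact_imp_bounded bounded_real by blast
    have "\<bar>D h p\<bar> \<le> max B 0" for p
      using B out[of p h] by (cases "p \<in> supp \<phi>") (auto simp: le_max_iff_disj)
    then show ?thesis by blast
  qed
  obtain B1 B2 where B: "\<forall>p. \<bar>D (1, 0) p\<bar> \<le> B1" "\<forall>p. \<bar>D (0, 1) p\<bar> \<le> B2" using bd by metis
  show thesis
  proof (rule that[of "D (1, 0)" "D (0, 1)" "max B1 B2"])
    show "deriv (\<lambda>s. \<phi> (s, x)) t = D (1, 0) (t, x)" for t x
    proof (rule DERIV_imp_deriv)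
      have "((\<lambda>s. (s, x)) has_derivative (\<lambda>h. (h, 0))) (at t)" by (auto intro!: derivative_eq_intros)
      from has_derivative_compose[OF this d]
      have "((\<lambda>s. \<phi> (s, x)) has_derivative (\<lambda>h. h * D (1, 0) (t, x))) (at t)" by (subst (asm) D) simp
      then show "((\<lambda>s. \<phi> (s, x)) has_real_derivative D (1, 0) (t, x)) (at t)"
        by (simp add: has_field_derivative_def mult.commute[of _ "D (1, 0) (t, x)"])
    qed
    show "deriv (\<lambda>y. \<phi> (t, y)) x = D (0, 1) (t, x)" for t x
    proof (rule DERIV_imp_deriv)
      have "((\<lambda>y. (t, y)) has_derivative (\<lambda>h. (0, h))) (at x)" by (auto intro!: derivative_eq_intros)
      from has_derivative_compose[OF this d]
      have "((\<lambda>y. \<phi> (t, y)) has_derivative (\<lambda>h. h * D (0, 1) (t, x))) (at x)" by (subst (asm) D) simp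
      then show "((\<lambda>y. \<phi> (t, y)) has_real_derivative D (0, 1) (t, x)) (at x)"
        by (simp add: has_field_derivative_def mult.commute[of _ "D (0, 1) (t, x)"])
    qed
    show "(\<phi> has_derivative (\<lambda>h. fst h * D (1, 0) (t, x) + snd h * D (0, 1) (t, x))) (at (t, x))" for t x
      using d[of "(t, x)"] by (subst (asm) D)
    show "D (1, 0) \<in> borel_measurable borel" "D (0, 1) \<in> borel_measurable borel"
      by (intro borel_measurable_continuous_onI cont)+
    show "0 \<le> max B1 B2" using B(1) abs_ge_zero[of "D (1, 0) undefined"] by (meson le_max_iff_disj order_trans)
    show "\<bar>D (1, 0) p\<bar> \<le> max B1 B2" "\<bar>D (0, 1) p\<bar> \<le> max B1 B2" for p
      using B[THEN spec, of p] by (simp_all add: le_max_iff_disj)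
  qed
qed

context flux_flow
begin

definition Y :: "real \<Rightarrow> real \<Rightarrow> real" where "Y t a = X t (max 0 (min 1 a))"

lemma Y_measurable: "0 \<le> t \<Longrightarrow> Y t \<in> borel_measurable borel"
  using expanding_mono[OF M expand] by (intro borel_measurable_mono monoI) (auto simp: Y_def)

lemma law_Y: "0 \<le> t \<Longrightarrow> law (X t) = law (Y t)"
  by (rule law_cong) (auto simp: Y_measurable expanding_measurable[OF M expand] Y_def)

lemma Y_deriv: "0 \<le> t \<Longrightarrow> ((\<lambda>s. Y s a) has_real_derivative U t (Y t a)) (at t within {0..})"
  unfolding Y_def by (rule flow_label) auto

lemma Y_bounded: "\<exists>R. \<forall>t\<in>{0..T}. \<forall>a. \<bar>Y t a\<bar> \<le> R"
proof (intro exI ballI allI)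
  fix t a :: real assume t: "t \<in> {0..T}"
  let ?c = "max 0 (min 1 a)"
  have "X 0 0 \<le> X 0 ?c" "X 0 ?c \<le> X 0 1" using expanding_mono[OF M expand[of 0]] by auto
  moreover have "X 0 ?c \<le> X t ?c" "X t ?c \<le> X 0 ?c + v 0 * t" using flow_move[of 0 t ?c] t by auto
  moreover have "v 0 * t \<le> v 0 * T" "0 \<le> v 0 * t" using t v0_nonneg by (auto intro: mult_left_mono)
  ultimately show "\<bar>Y t a\<bar> \<le> \<bar>X 0 0\<bar> + \<bar>X 0 1\<bar> + v 0 * T" unfolding Y_def by linarith
qed

lemma law_C0_P_c: "(\<lambda>t. law (X t)) \<in> C0_P_c T"
proof -
  have "(\<lambda>t. distr (uniform_measure lborel {0..1}) borel (Y t)) \<in> C0_P_c T"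
  proof (rule distr_curve_C0_P_c[OF prob_space_unit])
    show "\<bar>Y s a - Y t a\<bar> \<le> v 0 * \<bar>s - t\<bar>" if "s \<in> {0..T}" "t \<in> {0..T}" for s t a
      unfolding Y_def using that by (intro flow_lipschitz) auto
    show "\<exists>R. \<forall>a\<in>space (uniform_measure lborel {0..1}). \<bar>Y t a\<bar> \<le> R" if "t \<in> {0..T}" for t
      using Y_bounded[of T] that by blast
    show "Y t \<in> borel_measurable (uniform_measure lborel {0..1})" if "t \<in> {0..T}" for t
      using Y_measurable[of t] that by simp
  qed
  then show ?thesis by (rule C0_P_c_cong) (use law_Y in \<open>simp add: law_def\<close>)
qed

lemma weak_formulation:
  assumes \<phi>: "\<phi> \<in> test_functions T" and T: "0 < T"
  shows "(LBINT t:{0..T}. (LINT x|law (X t). deriv (\<lambda>s. \<phi> (s, x)) t +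
     deriv (\<lambda>y. \<phi> (t, y)) x * nonlocal_velocity v w \<eta> (law (X t)) x)) = 0"
proof -
  obtain D1 D2 B where
    D: "\<And>t x. deriv (\<lambda>s. \<phi> (s, x)) t = D1 (t, x)" "\<And>t x. deriv (\<lambda>y. \<phi> (t, y)) x = D2 (t, x)"
    and Dm[measurable]: "D1 \<in> borel_measurable borel" "D2 \<in> borel_measurable borel"
    and B: "0 \<le> B" "\<And>p. \<bar>D1 p\<bar> \<le> B" "\<And>p. \<bar>D2 p\<bar> \<le> B"
    and d\<phi>: "\<And>t x. (\<phi> has_derivative (\<lambda>h. fst h * D1 (t, x) + snd h * D2 (t, x))) (at (t, x))"
    by (rule test_function_derivatives[OF \<phi>]) (rule that)
  let ?U = "uniform_measure lborel {0..1::real}"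
  interpret P: prob_space ?U by (rule prob_space_unit)
  define g where "g t x = D1 (t, x) + D2 (t, x) * U t x" for t x
  define j where "j t = (LINT a|?U. g t (Y t a))" for t
  define J where "J t = (LINT a|?U. \<phi> (t, Y t a))" for t
  define C where "C = B + B * v 0"
  have gb: "\<bar>g t x\<bar> \<le> C" for t x
  proof -
    have "\<bar>D2 (t, x) * U t x\<bar> \<le> B * v 0" unfolding abs_mult using B U_bounds[of t x] by (intro mult_mono) auto
    then show ?thesis using B(2)[of "(t, x)"] unfolding g_def C_def by linarith
  qed
  have \<phi>cont: "continuous_on UNIV \<phi>"
    using has_derivative_continuous[OF d\<phi>] by (auto intro!: continuous_at_imp_continuous_on)
  have \<phi>m: "\<phi> \<in> borel_measurable borel" by (rule borel_measurable_continuous_onI[OF \<phi>cont])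
  have pair: "(\<lambda>a. (t, Y t a)) \<in> borel \<rightarrow>\<^sub>M borel" if "0 \<le> t" for t
    using Y_measurable[OF that] unfolding borel_prod[symmetric] by simp
  have pd: "((\<lambda>s. \<phi> (s, Y s a)) has_real_derivative g t (Y t a)) (at t within {0..})" if "0 \<le> t" for t a
  proof -
    have "((\<lambda>s. (s, Y s a)) has_derivative (\<lambda>h. (h, h * U t (Y t a)))) (at t within {0..})"
      using Y_deriv[OF that, of a]
      by (auto intro!: derivative_eq_intros simp: has_field_derivative_def mult.commute)
    from has_derivative_compose[OF this d\<phi>]
    have "((\<lambda>s. \<phi> (s, Y s a)) has_derivative (\<lambda>h. h * D1 (t, Y t a) + h * U t (Y t a) * D2 (t, Y t a))) (at t within {0..})" by simp
    then show ?thesis unfolding has_field_derivative_def g_def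
      by (rule has_derivative_eq_rhs) (simp add: fun_eq_iff algebra_simps)
  qed
  have lip: "\<bar>\<phi> (s, Y s a) - \<phi> (t, Y t a)\<bar> \<le> C * \<bar>s - t\<bar>" if "0 \<le> s" "0 \<le> t" for s t a
  proof -
    have *: "\<bar>\<phi> (s, Y s a) - \<phi> (t, Y t a)\<bar> \<le> C * \<bar>s - t\<bar>" if "0 \<le> t" "t \<le> s" for s t
    proof -
      have "\<exists>r\<in>{t..s}. \<phi> (s, Y s a) - \<phi> (t, Y t a) = (s - t) * g r (Y r a)"
      proof (rule has_real_derivative_mvt)
        show "((\<lambda>s. \<phi> (s, Y s a)) has_real_derivative g r (Y r a)) (at r within {0..})" if "r \<in> {t..s}" for r
          using \<open>0 \<le> t\<close> that by (intro pd) auto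
      qed (use that in auto)
      then obtain r where r: "\<phi> (s, Y s a) - \<phi> (t, Y t a) = (s - t) * g r (Y r a)" by blast
      have "(s - t) * \<bar>g r (Y r a)\<bar> \<le> (s - t) * C" using gb that by (intro mult_left_mono) auto
      then show ?thesis using that by (simp add: r abs_mult mult.commute)
    qed
    show ?thesis using *[of t s] *[of s t] that by (cases "t \<le> s") (auto simp: abs_minus_commute)
  qed
  have \<phi>int: "integrable ?U (\<lambda>a. \<phi> (t, Y t a))" if "0 \<le> t" for t
  proof -
    have "\<bar>\<phi> (t, Y t a)\<bar> \<le> C * t + \<bar>\<phi> (0, Y 0 a)\<bar>" for a using lip[of t 0 a] that by simp
    moreover have "\<phi> (0, y) = 0" for y
      using \<phi> closure_subset[of "{x. \<phi> x \<noteq> 0}"] by (auto simp: test_functions_def supp_def)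
    ultimately show ?thesis
      using measurable_compose[OF pair[OF that] \<phi>m] by (intro P.integrable_const_bound[of _ "C * t"]) auto
  qed
  have dJ: "(J has_real_derivative j t) (at t within {0..T})" if t: "t \<in> {0..T}" for t
    unfolding has_field_derivative_iff tendsto_at_iff_sequentially
  proof (intro allI impI)
    fix s :: "nat \<Rightarrow> real" assume s: "\<forall>i. s i \<in> {0..T} - {t}" "s \<longlonglongrightarrow> t"
    let ?q = "\<lambda>i a. (\<phi> (s i, Y (s i) a) - \<phi> (t, Y t a)) / (s i - t)"
    have eq: "(J (s i) - J t) / (s i - t) = (LINT a|?U. ?q i a)" for i
      using \<phi>int[of "s i"] \<phi>int[of t] s(1) t by (simp add: J_def)
    have "(\<lambda>i. LINT a|?U. ?q i a) \<longlonglongrightarrow> j t"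
      unfolding j_def
    proof (rule integral_dominated_convergence)
      have lim: "(\<lambda>i. ?q i a) \<longlonglongrightarrow> g t (Y t a)" for a
      proof -
        have "((\<lambda>r. (\<phi> (r, Y r a) - \<phi> (t, Y t a)) / (r - t)) \<longlongrightarrow> g t (Y t a)) (at t within {0..})"
          using pd[of t a] t by (simp add: has_field_derivative_iff)
        then show "(\<lambda>i. ?q i a) \<longlonglongrightarrow> g t (Y t a)"
          using s t unfolding tendsto_at_iff_sequentially comp_def by (auto dest: spec[of _ s])
      qed
      then show "AE a in ?U. (\<lambda>i. ?q i a) \<longlonglongrightarrow> g t (Y t a)" by (intro AE_I2)
      have m: "(\<lambda>a. \<phi> (r, Y r a)) \<in> borel_measurable ?U" if "0 \<le> r" for r
        using measurable_compose[OF pair[OF that] \<phi>m] by simp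
      show q: "?q i \<in> borel_measurable ?U" for i
        using m[of "s i"] m[of t] s(1) t by (intro borel_measurable_divide borel_measurable_diff borel_measurable_const) auto
      show "(\<lambda>a. g t (Y t a)) \<in> borel_measurable ?U"
        by (rule borel_measurable_LIMSEQ_metric[of ?q]) (use q lim in auto)
      show "AE a in ?U. norm (?q i a) \<le> C" for i
      proof (rule AE_I2)
        fix a
        have "\<bar>\<phi> (s i, Y (s i) a) - \<phi> (t, Y t a)\<bar> \<le> C * \<bar>s i - t\<bar>" using s(1) t by (intro lip) auto
        then show "norm (?q i a) \<le> C" using s(1) by (simp add: abs_divide pos_divide_le_eq)
      qed
    qed simp
    then show "((\<lambda>r. (J r - J t) / (r - t)) \<circ> s) \<longlonglongrightarrow> j t" by (simp add: comp_def eq)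
  qed
  have J0: "J t = 0" if "t \<notin> {0<..<T}" for t
  proof -
    have "\<phi> (t, x) = 0" for x
      using \<phi> closure_subset[of "{x. \<phi> x \<noteq> 0}"] that by (auto simp: test_functions_def supp_def)
    then show ?thesis by (simp add: J_def)
  qed
  have "(j has_integral (J T - J 0)) {0..T}"
    using dJ T by (intro fundamental_theorem_of_calculus) (auto simp flip: has_real_derivative_iff_has_vector_derivative)
  then have j0: "integral {0..T} j = 0" by (simp add: J0 integral_unique)
  have inner: "(LINT x|law (X t). deriv (\<lambda>s. \<phi> (s, x)) t + deriv (\<lambda>y. \<phi> (t, y)) x * nonlocal_velocity v w \<eta> (law (X t)) x)
     = (LINT x|law (X t). g t x)" for t
    unfolding D nonlocal_velocity_eq g_def U_def ..
  let ?c = "\<lambda>t. max 0 (min T t)"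
  have gm: "(\<lambda>(t, x). g (?c t) x) \<in> borel_measurable (borel \<Otimes>\<^sub>M borel)"
  proof -
    have VS: "V (S \<nu> x) = V (max 0 (S \<nu> x))" for \<nu> x using S_nonneg[of \<nu> x] by (simp add: max_def)
    have "(\<lambda>p. S (law (X (?c (fst p)))) (snd p)) \<in> borel_measurable (borel \<Otimes>\<^sub>M borel)"
      using S_curve_measurable[OF law_C0_P_c less_imp_le[OF T]] by (simp add: case_prod_beta')
    note [measurable] = this
    have "(\<lambda>p. (?c (fst p), snd p)) \<in> borel \<Otimes>\<^sub>M borel \<rightarrow>\<^sub>M (borel :: (real \<times> real) measure)"
      unfolding borel_prod[symmetric] by measurable
    note [measurable] = measurable_compose[OF this Dm(1)] measurable_compose[OF this Dm(2)]
    show ?thesis unfolding g_def U_def VS case_prod_beta' by measurable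
  qed
  have jeq: "(LINT x|law (X t). g t x) = j t" if t: "t \<in> {0..T}" for t
  proof -
    have "?c t = t" using t by auto
    then have gt: "g t \<in> borel_measurable borel" using measurable_Pair2[OF gm, of t] by simp
    have "(LINT x|law (X t). g t x) = (LINT x|law (Y t). g t x)" using law_Y t by simp
    also have "\<dots> = j t"
      unfolding j_def law_def using Y_measurable[of t] t gt by (intro integral_distr) auto
    finally show ?thesis .
  qed
  have km: "(\<lambda>t. law (X (?c t))) \<in> borel \<rightarrow>\<^sub>M subprob_algebra borel"
    by (rule C0_P_c_measurable[OF law_C0_P_c]) (use T in simp)
  have "set_integrable lborel {0..T} (\<lambda>t. LINT x|law (X (?c t)). g (?c t) x)"
    unfolding set_integrable_def
  proof (rule integrableI_bounded_set_indicator[where B = C])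
    show "(\<lambda>t. LINT x|law (X (?c t)). g (?c t) x) \<in> borel_measurable lborel"
      using bounded_integral_measurable_kernel[OF km gm gb] by simp
    show "AE t in lborel. t \<in> {0..T} \<longrightarrow> norm (LINT x|law (X (?c t)). g (?c t) x) \<le> C"
    proof (intro AE_I2 impI)
      fix t assume "t \<in> {0..T}"
      then have t: "?c t = t" "t \<in> {0..T}" by auto
      interpret real_distribution "law (X t)" using t by (intro real_distribution_law[OF M expand]) auto
      have "g t \<in> borel_measurable (law (X t))" using measurable_Pair2[OF gm, of t] t by simp
      then have "integrable (law (X t)) (g t)" using gb by (intro integrable_const_bound[of _ C]) auto
      then have "\<bar>LINT x|law (X t). g t x\<bar> \<le> (LINT x|law (X t). C)" using gb by (intro integral_abs_bound_integral) auto
      then show "norm (LINT x|law (X (?c t)). g (?c t) x) \<le> C" unfolding t using prob_space by simp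
    qed
  qed (use T in auto)
  then have "set_integrable lborel {0..T} j"
    by (rule set_integrable_cong[THEN iffD1, rotated 3]) (use jeq in \<open>auto simp: max_def min_def\<close>)
  then have "(LBINT t:{0..T}. j t) = 0" using set_borel_integral_eq_integral(2) j0 by metis
  moreover have "(LBINT t:{0..T}. (LINT x|law (X t). g t x)) = (LBINT t:{0..T}. j t)"
    by (rule set_lebesgue_integral_cong) (use jeq in auto)
  ultimately show ?thesis unfolding inner by simp
qed

lemma law_weak_solution:
  assumes "law (X 0) = measure_with_density \<rho>\<^sub>0" "0 < T"
  shows "weak_solution v w \<eta> \<rho>\<^sub>0 T (\<lambda>t. law (X t))"
  unfolding weak_solution_def using assms law_C0_P_c weak_formulation by blast

end

section \<open>The particle system\<close>

definition separated :: "real \<Rightarrow> nat \<Rightarrow> (nat \<Rightarrow> real) \<Rightarrow> bool" where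
  "separated l n x \<longleftrightarrow> (\<forall>i\<in>{1..<n}. l \<le> x (Suc i) - x i)"

lemma separated_diff:
  assumes "separated l n x" "1 \<le> i" "i \<le> j" "j \<le> n" "0 \<le> l"
  shows "real (j - i) * l \<le> x j - x i"
  using assms(3,4)
proof (induction j rule: dec_induct)
  case (step j)
  have "l \<le> x (Suc j) - x j" using assms(1,2) step by (simp add: separated_def)
  then show ?case using step by (simp add: Suc_diff_le distrib_right)
qed simp

lemma separated_diff_ge:
  assumes "separated l n x" "1 \<le> i" "i < j" "j \<le> n" "0 \<le> l"
  shows "l \<le> x j - x i"
proof -
  have "1 * l \<le> real (j - i) * l" using assms by (intro mult_right_mono) auto
  then show ?thesis using separated_diff[OF assms(1,2) less_imp_le[OF assms(3)] assms(4,5)] by simp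
qed

context nonlocal_flux
begin

lemma reg_kernel_eq:
  assumes l: "0 < l"
  shows "reg_kernel w \<eta> l z = w (max 0 (min \<eta> z)) - w 0 * max 0 (min 1 (- (2 * z / l)))
     - w \<eta> * max 0 (min 1 (2 * (z - \<eta>) / l))"
proof -
  have c: "1 \<le> x \<Longrightarrow> max 0 (min 1 x) = 1" "x \<le> 0 \<Longrightarrow> max 0 (min 1 x) = 0"
    "0 \<le> x \<Longrightarrow> x \<le> 1 \<Longrightarrow> max 0 (min 1 x) = x" for x :: real by auto
  consider "z < - l / 2" | "- l / 2 \<le> z" "z \<le> 0" | "0 < z" "z \<le> \<eta>" | "\<eta> < z" "z \<le> \<eta> + l / 2" | "\<eta> + l / 2 < z"
    using \<eta> l by linarith
  then show ?thesis
  proof cases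
    case 1
    have "1 \<le> - (2 * z / l)" "2 * (z - \<eta>) / l \<le> 0" using 1 l \<eta> by (auto simp: field_simps)
    moreover have "max 0 (min \<eta> z) = 0" "reg_kernel w \<eta> l z = 0" using 1 l \<eta> by (auto simp: reg_kernel_def)
    ultimately show ?thesis using c by simp
  next
    case 2
    have 3: "0 \<le> - (2 * z / l)" "- (2 * z / l) \<le> 1" "2 * (z - \<eta>) / l \<le> 0" using 2 l \<eta> by (auto simp: field_simps)
    moreover have "max 0 (min \<eta> z) = 0" using 2 \<eta> by auto
    moreover have "reg_kernel w \<eta> l z = w 0 * ((l + 2 * z) / l)" using 2 by (simp add: reg_kernel_def)
    moreover have "(l + 2 * z) / l = 1 - (- (2 * z / l))" using l by (simp add: field_simps)
    ultimately show ?thesis by (simp only: c(2)[OF 3(3)] c(3)[OF 3(1,2)]) (simp add: right_diff_distrib distrib_left)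
  next
    case 3
    have "- (2 * z / l) \<le> 0" "2 * (z - \<eta>) / l \<le> 0" using 3 l \<eta> by (auto simp: field_simps)
    moreover have "max 0 (min \<eta> z) = z" "reg_kernel w \<eta> l z = w z" using 3 by (auto simp: reg_kernel_def)
    ultimately show ?thesis by (simp only: c(2))
  next
    case 4
    have 5: "- (2 * z / l) \<le> 0" "0 \<le> 2 * (z - \<eta>) / l" "2 * (z - \<eta>) / l \<le> 1" using 4 l \<eta> by (auto simp: field_simps)
    moreover have "max 0 (min \<eta> z) = \<eta>" using 4 \<eta> by auto
    moreover have "reg_kernel w \<eta> l z = w \<eta> * ((2 * \<eta> + l - 2 * z) / l)" using 4 \<eta> by (simp add: reg_kernel_def)
    moreover have "(2 * \<eta> + l - 2 * z) / l = 1 - 2 * (z - \<eta>) / l" using l by (simp add: field_simps)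
    ultimately show ?thesis by (simp only: c(2)[OF 5(1)] c(3)[OF 5(2,3)]) (simp add: right_diff_distrib)
  next
    case 5
    have 6: "- (2 * z / l) \<le> 0" "1 \<le> 2 * (z - \<eta>) / l" using 5 l \<eta> by (auto simp: field_simps)
    moreover have "max 0 (min \<eta> z) = \<eta>" "reg_kernel w \<eta> l z = 0" using 5 l \<eta> by (auto simp: reg_kernel_def)
    ultimately show ?thesis by (simp only: c(2)[OF 6(1)] c(1)[OF 6(2)])
  qed
qed

lemma w_eta: "0 \<le> w \<eta>" "w \<eta> \<le> w 0" using w_nonneg[of \<eta>] w_mono[of 0 \<eta>] \<eta> by auto

lemma reg_kernel_bounds:
  assumes l: "0 < l" shows "0 \<le> reg_kernel w \<eta> l z" "reg_kernel w \<eta> l z \<le> w 0"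
proof -
  have le: "0 \<le> c * d" "c * d \<le> w 0" if "0 \<le> c" "c \<le> w 0" "0 \<le> d" "d \<le> 1" for c d
    using that mult_left_le[of d c] by auto
  consider "z \<in> {-l/2..0}" | "z \<notin> {-l/2..0}" "z \<in> {0..\<eta>}" | "z \<notin> {-l/2..0}" "z \<notin> {0..\<eta>}" "z \<in> {\<eta>..\<eta> + l/2}"
    | "z \<notin> {-l/2..0}" "z \<notin> {0..\<eta>}" "z \<notin> {\<eta>..\<eta> + l/2}" by blast
  then have "0 \<le> reg_kernel w \<eta> l z \<and> reg_kernel w \<eta> l z \<le> w 0"
  proof cases
    case 1
    then have "0 \<le> (l + 2 * z) / l" "(l + 2 * z) / l \<le> 1" using l by (auto simp: field_simps)
    then show ?thesis using le[OF w0 order_refl] 1 unfolding reg_kernel_def by (simp only: if_True)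
  next
    case 2
    then show ?thesis using w_nonneg[of z] w_mono[of 0 z] unfolding reg_kernel_def by (simp only: if_True if_False) simp
  next
    case 3
    then have "0 \<le> (2 * \<eta> + l - 2 * z) / l" "(2 * \<eta> + l - 2 * z) / l \<le> 1" using l by (auto simp: field_simps)
    then show ?thesis using le[OF w_eta] 3 unfolding reg_kernel_def by (simp only: if_True if_False)
  next
    case 4
    then show ?thesis using w0 unfolding reg_kernel_def by (simp only: if_False) simp
  qed
  then show "0 \<le> reg_kernel w \<eta> l z" "reg_kernel w \<eta> l z \<le> w 0" by auto
qed

lemma reg_kernel_antimono:
  assumes l: "0 < l" and xy: "0 \<le> x" "x \<le> y" shows "reg_kernel w \<eta> l y \<le> reg_kernel w \<eta> l x"
proof -
  define p where "p z = max 0 (min 1 (2 * (z - \<eta>) / l))" for z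
  have eq: "reg_kernel w \<eta> l z = w (max 0 (min \<eta> z)) - w \<eta> * p z" if "0 \<le> z" for z
  proof -
    have "- (2 * z / l) \<le> 0" using that l by simp
    then have "max 0 (min 1 (- (2 * z / l))) = 0" by linarith
    then show ?thesis using reg_kernel_eq[OF l, of z] by (simp only: p_def)
  qed
  have "w (max 0 (min \<eta> y)) \<le> w (max 0 (min \<eta> x))" using xy \<eta> by (intro w_mono) auto
  moreover have "2 * (x - \<eta>) / l \<le> 2 * (y - \<eta>) / l" using xy l by (intro divide_right_mono) auto
  then have "p x \<le> p y" unfolding p_def by linarith
  then have "w \<eta> * p x \<le> w \<eta> * p y" by (rule mult_left_mono[OF _ w_eta(1)])
  ultimately show ?thesis using eq[of x] eq[of y] xy by linarith
qed

lemma reg_kernel_lipschitz: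
  assumes l: "0 < l" and Lw: "Lw-lipschitz_on {0..\<eta>} w"
  shows "\<exists>\<Lambda>\<ge>0. \<forall>x y. \<bar>reg_kernel w \<eta> l x - reg_kernel w \<eta> l y\<bar> \<le> \<Lambda> * \<bar>x - y\<bar>"
proof (intro exI conjI allI)
  let ?\<Lambda> = "Lw + w 0 * (2 / l) + w \<eta> * (2 / l)"
  define p where "p z = max 0 (min 1 (2 * (z - \<eta>) / l))" for z
  define q where "q z = max 0 (min 1 (- (2 * z / l)))" for z
  have Lw0: "0 \<le> Lw" using Lw by (rule lipschitz_on_nonneg)
  then show "0 \<le> ?\<Lambda>" using w0 w_eta l by simp
  fix x y
  have c: "\<bar>max 0 (min b x) - max 0 (min b y)\<bar> \<le> \<bar>x - y\<bar>" for b x y :: real by (auto simp: max_def min_def)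
  have "\<bar>w (max 0 (min \<eta> x)) - w (max 0 (min \<eta> y))\<bar> \<le> Lw * \<bar>max 0 (min \<eta> x) - max 0 (min \<eta> y)\<bar>"
    using lipschitz_onD[OF Lw, of "max 0 (min \<eta> x)" "max 0 (min \<eta> y)"] \<eta> by (simp add: dist_real_def)
  also have "\<dots> \<le> Lw * \<bar>x - y\<bar>" by (rule mult_left_mono[OF c Lw0])
  finally have 1: "\<bar>w (max 0 (min \<eta> x)) - w (max 0 (min \<eta> y))\<bar> \<le> Lw * \<bar>x - y\<bar>" .
  have e: "2 * (x - \<eta>) / l - 2 * (y - \<eta>) / l = (2 / l) * (x - y)" "- (2 * x / l) - - (2 * y / l) = (2 / l) * (y - x)"
    using l by (auto simp: field_simps)
  have "\<bar>p x - p y\<bar> \<le> \<bar>(2 / l) * (x - y)\<bar>" unfolding p_def e(1)[symmetric] by (rule c)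
  then have "\<bar>p x - p y\<bar> \<le> 2 / l * \<bar>x - y\<bar>" unfolding abs_mult using l by simp
  from mult_left_mono[OF this w_eta(1)]
  have 2: "\<bar>w \<eta> * p x - w \<eta> * p y\<bar> \<le> w \<eta> * (2 / l * \<bar>x - y\<bar>)"
    unfolding right_diff_distrib[symmetric] abs_mult using w_eta(1) by simp
  have "\<bar>q x - q y\<bar> \<le> \<bar>(2 / l) * (y - x)\<bar>" unfolding q_def e(2)[symmetric] by (rule c)
  then have "\<bar>q x - q y\<bar> \<le> 2 / l * \<bar>x - y\<bar>" unfolding abs_mult abs_minus_commute[of y x] using l by simp
  from mult_left_mono[OF this w0]
  have 3: "\<bar>w 0 * q x - w 0 * q y\<bar> \<le> w 0 * (2 / l * \<bar>x - y\<bar>)"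
    unfolding right_diff_distrib[symmetric] abs_mult using w0 by simp
  have "?\<Lambda> * \<bar>x - y\<bar> = Lw * \<bar>x - y\<bar> + w 0 * (2 / l * \<bar>x - y\<bar>) + w \<eta> * (2 / l * \<bar>x - y\<bar>)"
    by (simp only: distrib_right mult.assoc)
  moreover have "\<bar>(a - b - c) - (a' - b' - c')\<bar> \<le> A + B + C"
    if "\<bar>a - a'\<bar> \<le> A" "\<bar>b - b'\<bar> \<le> B" "\<bar>c - c'\<bar> \<le> C" for a b c a' b' c' A B C :: real using that by linarith
  from this[OF 1 3 2] have "\<bar>reg_kernel w \<eta> l x - reg_kernel w \<eta> l y\<bar>
    \<le> Lw * \<bar>x - y\<bar> + w 0 * (2 / l * \<bar>x - y\<bar>) + w \<eta> * (2 / l * \<bar>x - y\<bar>)"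
    by (simp only: reg_kernel_eq[OF l] p_def q_def)
  ultimately show "\<bar>reg_kernel w \<eta> l x - reg_kernel w \<eta> l y\<bar> \<le> ?\<Lambda> * \<bar>x - y\<bar>" by (simp only:)
qed

lemma reg_kernel_left: "0 < l \<Longrightarrow> z \<le> - l / 2 \<Longrightarrow> reg_kernel w \<eta> l z = 0"
  using \<eta> by (auto simp: reg_kernel_def)

lemma particle_velocity_bounds:
  assumes "0 < l" shows "0 \<le> particle_velocity v w \<eta> l n x i" "particle_velocity v w \<eta> l n x i \<le> v 0"
  using reg_kernel_bounds[OF assms] unfolding particle_velocity_def
  by (auto intro!: V_nonneg V_le divide_nonneg_nonneg sum_nonneg)

lemma particle_velocity_lipschitz:
  assumes l: "0 < l" and n: "1 \<le> n" and \<Lambda>: "0 \<le> \<Lambda>" "\<And>x y. \<bar>reg_kernel w \<eta> l x - reg_kernel w \<eta> l y\<bar> \<le> \<Lambda> * \<bar>x - y\<bar>"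
    and i: "i \<in> {1..n}" and d: "\<And>j. j \<in> {1..n} \<Longrightarrow> \<bar>x j - y j\<bar> \<le> d"
  shows "\<bar>particle_velocity v w \<eta> l n x i - particle_velocity v w \<eta> l n y i\<bar> \<le> Lv * (\<Lambda> * 2) * d"
proof (cases "i = n")
  case True
  have "0 \<le> d" using d[OF i] by linarith
  then show ?thesis using True Lv_nonneg \<Lambda>(1) by (simp add: particle_velocity_def)
next
  case False
  let ?s = "\<lambda>x. (1 / real n) * (\<Sum>j=1..n. reg_kernel w \<eta> l (x j - x i))"
  have "\<bar>(\<Sum>j=1..n. reg_kernel w \<eta> l (x j - x i)) - (\<Sum>j=1..n. reg_kernel w \<eta> l (y j - y i))\<bar>
      \<le> (\<Sum>j=1..n. \<bar>reg_kernel w \<eta> l (x j - x i) - reg_kernel w \<eta> l (y j - y i)\<bar>)"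
    unfolding sum_subtractf[symmetric] by (rule sum_abs)
  also have "\<dots> \<le> (\<Sum>j=1..n. \<Lambda> * (2 * d))"
  proof (rule sum_mono)
    fix j assume j: "j \<in> {1..n}"
    have "\<bar>reg_kernel w \<eta> l (x j - x i) - reg_kernel w \<eta> l (y j - y i)\<bar> \<le> \<Lambda> * \<bar>(x j - x i) - (y j - y i)\<bar>" by (rule \<Lambda>)
    also have "\<dots> \<le> \<Lambda> * (2 * d)" using d[OF j] d[OF i] by (intro mult_left_mono \<Lambda>) linarith
    finally show "\<bar>reg_kernel w \<eta> l (x j - x i) - reg_kernel w \<eta> l (y j - y i)\<bar> \<le> \<Lambda> * (2 * d)" .
  qed
  also have "\<dots> = real n * (\<Lambda> * (2 * d))" by simp
  finally have "\<bar>?s x - ?s y\<bar> \<le> (1 / real n) * (real n * (\<Lambda> * (2 * d)))"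
    unfolding right_diff_distrib[symmetric] abs_mult by (intro mult_mono) auto
  also have "\<dots> = \<Lambda> * 2 * d" using n by simp
  finally have s: "\<bar>?s x - ?s y\<bar> \<le> \<Lambda> * 2 * d" .
  have "0 \<le> ?s x" for x using reg_kernel_bounds[OF l] by (intro mult_nonneg_nonneg sum_nonneg) auto
  from V_lipschitz[OF this this s] show ?thesis using False by (simp add: particle_velocity_def mult_ac)
qed

lemma particle_velocity_order:
  assumes l: "0 < l" and \<Lambda>: "0 \<le> \<Lambda>" "\<And>x y. \<bar>reg_kernel w \<eta> l x - reg_kernel w \<eta> l y\<bar> \<le> \<Lambda> * \<bar>x - y\<bar>"
    and sep: "separated l n x" and i: "i \<in> {1..<n}"
  shows "particle_velocity v w \<eta> l n x i \<le> particle_velocity v w \<eta> l n x (Suc i) + Lv * (\<Lambda> * (x (Suc i) - x i - l))"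
proof -
  define \<delta> where "\<delta> = x (Suc i) - x i - l"
  have \<delta>: "0 \<le> \<delta>" using sep i by (simp add: \<delta>_def separated_def)
  show ?thesis
  proof (cases "Suc i = n")
    case True
    have "particle_velocity v w \<eta> l n x i \<le> v 0" by (rule particle_velocity_bounds[OF l])
    moreover have "particle_velocity v w \<eta> l n x (Suc i) = v 0" using True by (simp add: particle_velocity_def extend_v_def)
    moreover have "0 \<le> Lv * (\<Lambda> * \<delta>)" using Lv_nonneg \<Lambda>(1) \<delta> by simp
    ultimately show ?thesis unfolding \<delta>_def by linarith
  next
    case False
    let ?R = "reg_kernel w \<eta> l"
    have n: "0 < real n" using i by simp
    have mono: "x a \<le> x b" if "1 \<le> a" "a \<le> b" "b \<le> n" for a b
    proof -
      have "0 \<le> real (b - a) * l" using l by simp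
      then show ?thesis using separated_diff[OF sep that less_imp_le[OF l]] by linarith
    qed
    have "(\<Sum>j=1..n. ?R (x j - x (Suc i))) = (\<Sum>j=Suc i..n. ?R (x j - x (Suc i)))"
    proof (rule sum.mono_neutral_right)
      show "\<forall>j\<in>{1..n} - {Suc i..n}. ?R (x j - x (Suc i)) = 0"
      proof
        fix j assume "j \<in> {1..n} - {Suc i..n}"
        then have "l \<le> x (Suc i) - x j" using i l by (intro separated_diff_ge[OF sep]) auto
        then show "?R (x j - x (Suc i)) = 0" using l by (intro reg_kernel_left) auto
      qed
    qed (use i in auto)
    also have "\<dots> = (\<Sum>j=i..n-1. ?R (x (Suc j) - x (Suc i)))"
      using i sum.shift_bounds_cl_Suc_ivl[of "\<lambda>j. ?R (x j - x (Suc i))" i "n - 1"] by simp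
    also have "\<dots> \<le> (\<Sum>j=i..n-1. ?R (x j - x i) + \<Lambda> * \<delta>)"
    proof (rule sum_mono)
      fix j assume j: "j \<in> {i..n-1}"
      have gap: "l \<le> x (Suc j) - x j" using sep i j by (auto simp: separated_def)
      have p: "0 \<le> x (Suc j) - x (Suc i)" "0 \<le> x j - x i" using mono[of "Suc i" "Suc j"] mono[of i j] i j by auto
      have "?R (x (Suc j) - x (Suc i)) \<le> ?R (max 0 (x j - x i - \<delta>))"
        using gap p by (intro reg_kernel_antimono[OF l]) (auto simp: \<delta>_def)
      also have "\<dots> \<le> ?R (x j - x i) + \<Lambda> * \<bar>max 0 (x j - x i - \<delta>) - (x j - x i)\<bar>"
        using \<Lambda>(2)[of "max 0 (x j - x i - \<delta>)" "x j - x i"] by linarith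
      also have "\<dots> \<le> ?R (x j - x i) + \<Lambda> * \<delta>" using p \<delta> by (intro add_left_mono mult_left_mono \<Lambda>) auto
      finally show "?R (x (Suc j) - x (Suc i)) \<le> ?R (x j - x i) + \<Lambda> * \<delta>" .
    qed
    also have "\<dots> = (\<Sum>j=i..n-1. ?R (x j - x i)) + real (n - i) * (\<Lambda> * \<delta>)" using i by (simp add: sum.distrib)
    also have "\<dots> \<le> (\<Sum>j=1..n. ?R (x j - x i)) + real n * (\<Lambda> * \<delta>)"
      using i \<Lambda>(1) \<delta> by (intro add_mono sum_mono2 reg_kernel_bounds[OF l] mult_right_mono) auto
    finally have "(1 / real n) * (\<Sum>j=1..n. ?R (x j - x (Suc i))) \<le> (1 / real n) * ((\<Sum>j=1..n. ?R (x j - x i)) + real n * (\<Lambda> * \<delta>))"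
      using n by (intro mult_left_mono) auto
    also have "\<dots> = (1 / real n) * (\<Sum>j=1..n. ?R (x j - x i)) + \<Lambda> * \<delta>" using n by (simp add: distrib_left)
    finally have le: "(1 / real n) * (\<Sum>j=1..n. ?R (x j - x (Suc i))) \<le> (1 / real n) * (\<Sum>j=1..n. ?R (x j - x i)) + \<Lambda> * \<delta>" .
    have s0: "0 \<le> (1 / real n) * (\<Sum>j=1..n. ?R (x j - x k))" for k
      using reg_kernel_bounds[OF l] by (intro mult_nonneg_nonneg sum_nonneg) auto
    have "V ((1 / real n) * (\<Sum>j=1..n. ?R (x j - x i))) \<le> V ((1 / real n) * (\<Sum>j=1..n. ?R (x j - x (Suc i)))) + Lv * (\<Lambda> * \<delta>)"
      using \<Lambda>(1) \<delta> by (intro V_one_sided s0 le) simp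
    then show ?thesis using False i by (simp add: particle_velocity_def \<delta>_def)
  qed
qed

lemma particle_flow_exists:
  assumes l: "0 < l" and n: "1 \<le> n" and Lw: "Lw-lipschitz_on {0..\<eta>} w" and x0: "separated l n x0"
  shows "\<exists>x. (\<forall>i. x i 0 = x0 i) \<and> (\<forall>t\<ge>0. separated l n (\<lambda>j. x j t)) \<and>
    (\<forall>t\<ge>0. \<forall>i\<in>{1..n}. (x i has_real_derivative particle_velocity v w \<eta> l n (\<lambda>j. x j t) i) (at t within {0..}))"
proof -
  obtain \<Lambda> where \<Lambda>: "0 \<le> \<Lambda>" "\<And>x y. \<bar>reg_kernel w \<eta> l x - reg_kernel w \<eta> l y\<bar> \<le> \<Lambda> * \<bar>x - y\<bar>"
    using reg_kernel_lipschitz[OF l Lw] by blast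
  let ?F = "particle_velocity v w \<eta> l n"
  let ?G = "\<lambda>x i. if i \<in> {1..n} then ?F x i else 0"
  have "\<exists>Z. Z 0 = x0 \<and> (\<forall>t\<ge>0. Z t \<in> {x. separated l n x}) \<and>
     (\<forall>t\<ge>0. \<forall>a. ((\<lambda>s. Z s a) has_real_derivative ?G (Z t) a) (at t within {0..}))"
  proof (rule euler_flow[where C = "v 0" and L = "Lv * (\<Lambda> * 2)" and h\<^sub>0 = "1 / (1 + Lv * \<Lambda>)"])
    have pos: "0 \<le> Lv * \<Lambda>" using Lv_nonneg \<Lambda>(1) by simp
    then show "0 < 1 / (1 + Lv * \<Lambda>)" "0 \<le> Lv * (\<Lambda> * 2)" by simp_all
    show "x0 \<in> {x. separated l n x}" using x0 by simp
    show "\<bar>?G x i\<bar> \<le> v 0" for x i using particle_velocity_bounds[OF l] v_nonneg[of 0] by auto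
    show "\<bar>?G x i - ?G y i\<bar> \<le> Lv * (\<Lambda> * 2) * d" if "\<And>j. \<bar>x j - y j\<bar> \<le> d" for x y d i
    proof (cases "i \<in> {1..n}")
      case True
      then show ?thesis using particle_velocity_lipschitz[OF l n \<Lambda> True, of x y d] that by simp
    next
      case False
      have "0 \<le> d" using that[of 0] by linarith
      then have "0 \<le> Lv * (\<Lambda> * 2) * d" using Lv_nonneg \<Lambda>(1) by simp
      then show ?thesis by (simp only: if_not_P[OF False] diff_self abs_zero)
    qed
    show "Z \<in> {x. separated l n x}"
      if Y: "\<And>k. Y k \<in> {x. separated l n x}" "\<And>a. (\<lambda>k. Y k a) \<longlonglongrightarrow> Z a" for Y :: "nat \<Rightarrow> nat \<Rightarrow> real" and Z
      unfolding mem_Collect_eq separated_def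
    proof
      fix i assume i: "i \<in> {1..<n}"
      have "(\<lambda>k. Y k (Suc i) - Y k i) \<longlonglongrightarrow> Z (Suc i) - Z i" by (intro tendsto_intros Y)
      then show "l \<le> Z (Suc i) - Z i"
        using Y(1) i by (intro LIMSEQ_le_const) (auto simp: separated_def)
    qed
    show "(\<lambda>a. x a + h * ?G x a) \<in> {x. separated l n x}"
      if sep: "x \<in> {x. separated l n x}" and h: "0 \<le> h" "h \<le> 1 / (1 + Lv * \<Lambda>)" for x h
      unfolding mem_Collect_eq separated_def
    proof
      fix i assume i: "i \<in> {1..<n}"
      let ?\<delta> = "x (Suc i) - x i - l"
      have \<delta>: "0 \<le> ?\<delta>" using sep i by (simp add: separated_def)
      have "?F x i - ?F x (Suc i) \<le> Lv * (\<Lambda> * ?\<delta>)"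
        using particle_velocity_order[OF l \<Lambda> CollectD[OF sep] i] by linarith
      then have "h * (?F x i - ?F x (Suc i)) \<le> h * (Lv * (\<Lambda> * ?\<delta>))" using h(1) by (rule mult_left_mono)
      also have "\<dots> = (h * (Lv * \<Lambda>)) * ?\<delta>" by (simp add: mult_ac)
      also have "\<dots> \<le> 1 * ?\<delta>"
      proof (rule mult_right_mono[OF _ \<delta>])
        have "h * (1 + Lv * \<Lambda>) \<le> 1" using h pos by (simp add: pos_le_divide_eq)
        then show "h * (Lv * \<Lambda>) \<le> 1" using h by (simp add: distrib_left)
      qed
      finally show "l \<le> x (Suc i) + h * ?G x (Suc i) - (x i + h * ?G x i)"
        using i by (simp add: right_diff_distrib)
    qed
  qed
  then obtain Z where Z: "Z 0 = x0" "\<forall>t\<ge>0. separated l n (Z t)"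
    "\<forall>t\<ge>0. \<forall>a. ((\<lambda>s. Z s a) has_real_derivative ?G (Z t) a) (at t within {0..})" by auto
  have "((\<lambda>t. Z t i) has_real_derivative ?F (\<lambda>j. Z t j) i) (at t within {0..})" if "0 \<le> t" "i \<in> {1..n}" for t i
    using Z(3)[rule_format, OF that(1), of i] by (simp only: if_P[OF that(2)])
  then show ?thesis using Z(1,2) by (intro exI[of _ "\<lambda>i t. Z t i"]) simp
qed

lemma particle_solution_move:
  assumes l: "0 < l" and i: "i \<in> {1..n}" and st: "0 \<le> s" "s \<le> t" "t \<le> T"
    and x: "\<And>t. t \<in> {0..T} \<Longrightarrow> (x i has_real_derivative particle_velocity v w \<eta> l n (\<lambda>j. x j t) i) (at t within {0..T})"
  shows "0 \<le> x i t - x i s" "x i t - x i s \<le> v 0 * (t - s)"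
proof -
  have "\<exists>r\<in>{s..t}. x i t - x i s = (t - s) * particle_velocity v w \<eta> l n (\<lambda>j. x j r) i"
  proof (rule has_real_derivative_mvt)
    show "{s..t} \<subseteq> {0..T}" using st by auto
    show "(x i has_real_derivative particle_velocity v w \<eta> l n (\<lambda>j. x j r) i) (at r within {0..T})" if "r \<in> {s..t}" for r
      using that st by (intro x) auto
  qed (rule st)
  then obtain r where r: "x i t - x i s = (t - s) * particle_velocity v w \<eta> l n (\<lambda>j. x j r) i" by blast
  let ?p = "particle_velocity v w \<eta> l n (\<lambda>j. x j r) i"
  have "0 \<le> (t - s) * ?p" "(t - s) * ?p \<le> (t - s) * v 0"
    using particle_velocity_bounds[OF l, of n _ i] st by (auto intro: mult_left_mono)
  then show "0 \<le> x i t - x i s" "x i t - x i s \<le> v 0 * (t - s)" using r by (simp_all add: mult.commute)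
qed

lemma particle_solution_unique:
  assumes l: "0 < l" and n: "1 \<le> n" and Lw: "Lw-lipschitz_on {0..\<eta>} w"
    and x: "\<And>i t. i \<in> {1..n} \<Longrightarrow> t \<in> {0..T} \<Longrightarrow>
      (x i has_real_derivative particle_velocity v w \<eta> l n (\<lambda>j. x j t) i) (at t within {0..T})"
    and y: "\<And>i t. i \<in> {1..n} \<Longrightarrow> t \<in> {0..T} \<Longrightarrow>
      (y i has_real_derivative particle_velocity v w \<eta> l n (\<lambda>j. y j t) i) (at t within {0..T})"
    and init: "\<And>i. i \<in> {1..n} \<Longrightarrow> x i 0 = y i 0" and i: "i \<in> {1..n}" and t: "t \<in> {0..T}"
  shows "x i t = y i t"
proof -
  obtain \<Lambda> where \<Lambda>: "0 \<le> \<Lambda>" "\<And>x y. \<bar>reg_kernel w \<eta> l x - reg_kernel w \<eta> l y\<bar> \<le> \<Lambda> * \<bar>x - y\<bar>"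
    using reg_kernel_lipschitz[OF l Lw] by blast
  let ?F = "particle_velocity v w \<eta> l n"
  define L where "L = Lv * (\<Lambda> * 2)"
  have L: "0 \<le> L" using Lv_nonneg \<Lambda>(1) by (simp add: L_def)
  have v0: "0 \<le> v 0" using v_nonneg by simp
  define P where "P t d \<longleftrightarrow> (\<forall>i\<in>{1..n}. \<bar>x i t - y i t\<bar> \<le> d)" for t d
  have P: "P t d" if d: "0 * t * exp (L * (2 * v 0 + 1) * t) < d" for d
  proof (rule discrete_gronwall[where T = T, OF _ _ order_refl _ _ _ _ d])
    show "P 0 0" using init by (simp add: P_def)
    show "0 \<le> L * (2 * v 0 + 1)" using L v0 by simp
    show "P s e" if "P s d" "d \<le> e" for s d e using that by (force simp: P_def)
    show "P (s + h) (d + h * (L * (2 * v 0 + 1) * (d + h) + 0))"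
      if s: "0 \<le> s" "0 \<le> h" "s + h \<le> T" and d: "0 \<le> d" "P s d" for s h d
      unfolding P_def
    proof
      fix i assume i: "i \<in> {1..n}"
      have "\<exists>r\<in>{s..s+h}. (x i (s + h) - y i (s + h)) - (x i s - y i s) = (s + h - s) * (?F (\<lambda>j. x j r) i - ?F (\<lambda>j. y j r) i)"
      proof (rule has_real_derivative_mvt)
        show "{s..s+h} \<subseteq> {0..T}" using s by auto
        show "((\<lambda>t. x i t - y i t) has_real_derivative ?F (\<lambda>j. x j r) i - ?F (\<lambda>j. y j r) i) (at r within {0..T})" if "r \<in> {s..s+h}" for r
          using that s i by (intro DERIV_diff x y) auto
      qed (use s in simp)
      then obtain r where r: "r \<in> {s..s+h}"
        "(x i (s + h) - y i (s + h)) - (x i s - y i s) = h * (?F (\<lambda>j. x j r) i - ?F (\<lambda>j. y j r) i)" by auto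
      have near: "\<bar>x j r - y j r\<bar> \<le> d + 2 * v 0 * h" if j: "j \<in> {1..n}" for j
      proof -
        have "v 0 * (r - s) \<le> v 0 * h" using r(1) v0 by (intro mult_left_mono) auto
        moreover have "0 \<le> x j r - x j s" "x j r - x j s \<le> v 0 * (r - s)"
          using r(1) s by (intro particle_solution_move[OF l j _ _ _ x[OF j]]; simp)+
        moreover have "0 \<le> y j r - y j s" "y j r - y j s \<le> v 0 * (r - s)"
          using r(1) s by (intro particle_solution_move[OF l j _ _ _ y[OF j]]; simp)+
        moreover have "\<bar>x j s - y j s\<bar> \<le> d" using d(2) j by (simp add: P_def)
        moreover have "0 \<le> v 0 * h" using v0 s by simp
        ultimately show ?thesis by linarith
      qed
      have "\<bar>?F (\<lambda>j. x j r) i - ?F (\<lambda>j. y j r) i\<bar> \<le> L * (d + 2 * v 0 * h)"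
        unfolding L_def by (rule particle_velocity_lipschitz[OF l n \<Lambda> i near])
      also have "\<dots> \<le> L * ((2 * v 0 + 1) * (d + h))"
        using L v0 d s by (intro mult_left_mono) (simp_all add: algebra_simps)
      finally have "h * \<bar>?F (\<lambda>j. x j r) i - ?F (\<lambda>j. y j r) i\<bar> \<le> h * (L * (2 * v 0 + 1) * (d + h))"
        using s(2) by (simp add: mult_left_mono mult.assoc)
      then have "\<bar>(x i (s + h) - y i (s + h)) - (x i s - y i s)\<bar> \<le> h * (L * (2 * v 0 + 1) * (d + h))"
        using s(2) by (simp only: r(2) abs_mult abs_of_nonneg)
      moreover have "\<bar>x i s - y i s\<bar> \<le> d" using d(2) i by (simp add: P_def)
      ultimately show "\<bar>x i (s + h) - y i (s + h)\<bar> \<le> d + h * (L * (2 * v 0 + 1) * (d + h) + 0)" by simp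
    qed
  qed (use t in auto)
  have "\<bar>x i t - y i t\<bar> \<le> 0"
  proof (rule field_le_epsilon)
    fix e :: real assume "0 < e"
    then show "\<bar>x i t - y i t\<bar> \<le> 0 + e" using P[of e] i by (simp add: P_def)
  qed
  then show ?thesis by simp
qed

lemma empirical_curve_C0_P_c:
  assumes l: "0 < l" and n: "1 \<le> n"
    and x: "\<And>i t. i \<in> {1..n} \<Longrightarrow> t \<in> {0..T} \<Longrightarrow>
      (x i has_real_derivative particle_velocity v w \<eta> l n (\<lambda>j. x j t) i) (at t within {0..T})"
  shows "empirical_measure n x \<in> C0_P_c T"
  unfolding empirical_measure_def[abs_def]
proof (rule distr_curve_C0_P_c)
  show "prob_space (uniform_count_measure {1..n})" using n by (intro prob_space_uniform_count_measure) auto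
  show "\<bar>x i s - x i t\<bar> \<le> v 0 * \<bar>s - t\<bar>"
    if "s \<in> {0..T}" "t \<in> {0..T}" "i \<in> space (uniform_count_measure {1..n})" for s t i
  proof -
    have i: "i \<in> {1..n}" using that by (simp add: space_uniform_count_measure)
    show ?thesis
      using particle_solution_move[OF l i, of s t T x, OF _ _ _ x[OF i]] particle_solution_move[OF l i, of t s T x, OF _ _ _ x[OF i]] that
      by (cases "s \<le> t") auto
  qed
  show "\<exists>R. \<forall>i\<in>space (uniform_count_measure {1..n}). \<bar>x i t\<bar> \<le> R" for t
    by (intro exI[of _ "\<Sum>i\<in>{1..n}. \<bar>x i t\<bar>"]) (auto simp: space_uniform_count_measure intro: member_le_sum)
qed simp

end

section \<open>Convergence of the particle approximation\<close>

lemma real_distribution_empirical: "1 \<le> n \<Longrightarrow> real_distribution (empirical_measure n x t)"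
  unfolding empirical_measure_def real_distribution_def real_distribution_axioms_def
  by (auto intro!: prob_space.prob_space_distr prob_space_uniform_count_measure)

lemma cdf_empirical:
  assumes n: "1 \<le> n"
  shows "cdf (empirical_measure n x t) y = real (card {i\<in>{1..n}. x i t \<le> y}) / real n"
proof -
  have "(\<Sum>i=1..n. measure (return borel (x i t)) {..y}) = (\<Sum>i\<in>{1..n}. if x i t \<le> y then 1 else 0)"
    by (rule sum.cong) (auto simp: measure_return indicator_def)
  also have "\<dots> = real (card {i\<in>{1..n}. x i t \<le> y})" by (simp add: sum.If_cases Int_def)
  finally show ?thesis unfolding cdf_def by (subst measure_empirical_measure[OF n]) auto
qed

lemma weak_conv_m_if_uniform:
  assumes "\<And>n y. 1 \<le> n \<Longrightarrow> \<bar>cdf (\<mu> n) y - cdf \<nu> y\<bar> \<le> e n" and "e \<longlonglongrightarrow> 0"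
  shows "weak_conv_m \<mu> \<nu>"
  unfolding weak_conv_m_def weak_conv_def
proof (intro allI impI)
  fix y
  show "(\<lambda>n. cdf (\<mu> n) y) \<longlonglongrightarrow> cdf \<nu> y"
  proof (rule LIM_zero_cancel, rule Lim_null_comparison[OF _ assms(2)])
    show "\<forall>\<^sub>F n in sequentially. norm (cdf (\<mu> n) y - cdf \<nu> y) \<le> e n"
      using eventually_ge_at_top[of 1] by eventually_elim (simp add: assms(1))
  qed
qed

context nonlocal_flux
begin

lemma S_empirical:
  assumes n: "1 \<le> n" shows "S (empirical_measure n x t) z = (1 / real n) * (\<Sum>j=1..n. W (x j t - z))"
proof -
  have "S (empirical_measure n x t) z = (LINT i|uniform_count_measure {1..n}. W (x i t - z))"
    unfolding S_eq empirical_measure_def by (rule integral_distr) auto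
  also have "\<dots> = (\<Sum>j=1..n. W (x j t - z)) / real n"
    by (subst integral_uniform_count_measure) auto
  finally show ?thesis by simp
qed

text \<open>The regularization only affects particles at distance between \<open>\<eta>\<close> and \<open>\<eta> + l / 2\<close> ahead,
  and there is at most one of them.\<close>

lemma reg_kernel_sum_diff:
  assumes l: "0 < l" and sep: "separated l n x" and i: "i \<in> {1..n}"
  shows "\<bar>(\<Sum>j=1..n. reg_kernel w \<eta> l (x j - x i)) - (\<Sum>j=1..n. W (x j - x i))\<bar> \<le> w 0"
proof -
  let ?R = "reg_kernel w \<eta> l"
  define B where "B = {j\<in>{1..n}. i < j \<and> \<eta> < x j - x i \<and> x j - x i \<le> \<eta> + l / 2}"
  have eq: "?R (x j - x i) = W (x j - x i)" if j: "j \<in> {1..n} - B" for j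
  proof -
    consider "j < i" | "j = i" | "i < j" by linarith
    then show ?thesis
    proof cases
      case 1
      then have "l \<le> x i - x j" using i j l by (intro separated_diff_ge[OF sep]) auto
      then show ?thesis using l by (subst reg_kernel_left[OF l]) (auto simp: W_def)
    next
      case 2
      then show ?thesis using l \<eta> by (simp add: reg_kernel_def W_def)
    next
      case 3
      then have "l \<le> x j - x i" using i j l by (intro separated_diff_ge[OF sep]) auto
      moreover have "x j - x i \<le> \<eta> \<or> \<eta> + l / 2 < x j - x i" using j 3 by (auto simp: B_def)
      ultimately show ?thesis using l by (auto simp: reg_kernel_def W_def)
    qed
  qed
  have card: "card B \<le> 1"
  proof -
    have False if "j \<in> B" "k \<in> B" "j < k" for j k
    proof -
      have "l \<le> x k - x j" using that l by (intro separated_diff_ge[OF sep]) (auto simp: B_def)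
      moreover have "\<eta> < x j - x i" "x k - x i \<le> \<eta> + l / 2" using that by (auto simp: B_def)
      ultimately show False using l by linarith
    qed
    then have "j = k" if "j \<in> B" "k \<in> B" for j k using that by (meson nat_neq_iff)
    then show ?thesis by (simp add: card_le_Suc0_iff_eq B_def)
  qed
  have "\<bar>(\<Sum>j=1..n. ?R (x j - x i)) - (\<Sum>j=1..n. W (x j - x i))\<bar> \<le> (\<Sum>j=1..n. \<bar>?R (x j - x i) - W (x j - x i)\<bar>)"
    unfolding sum_subtractf[symmetric] by (rule sum_abs)
  also have "\<dots> = (\<Sum>j\<in>B. \<bar>?R (x j - x i) - W (x j - x i)\<bar>)"
    by (rule sum.mono_neutral_right) (use eq in \<open>auto simp: B_def\<close>)
  also have "\<dots> \<le> (\<Sum>j\<in>B. w 0)"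
  proof (rule sum_mono)
    fix j
    show "\<bar>?R (x j - x i) - W (x j - x i)\<bar> \<le> w 0"
      using reg_kernel_bounds[OF l, of "x j - x i"] W_bounds[of "x j - x i"] by linarith
  qed
  also have "\<dots> \<le> 1 * w 0" unfolding sum_constant using card w0 by (intro mult_right_mono) auto
  finally show ?thesis by simp
qed

lemma particle_velocity_empirical:
  assumes l: "0 < l" and n: "1 \<le> n" and sep: "separated l n (\<lambda>j. x j t)" and i: "i \<in> {1..n}"
  shows "\<bar>particle_velocity v w \<eta> l n (\<lambda>j. x j t) i - V (S (empirical_measure n x t) (x i t))\<bar> \<le> Lv * (w 0 / real n)"
proof (cases "i = n")
  case True
  have "(\<Sum>j=1..n. W (x j t - x i t)) = (\<Sum>j\<in>{n}. W (x j t - x i t))"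
  proof (rule sum.mono_neutral_right)
    show "\<forall>j\<in>{1..n} - {n}. W (x j t - x i t) = 0"
    proof
      fix j assume "j \<in> {1..n} - {n}"
      then have "l \<le> x i t - x j t" using l True by (intro separated_diff_ge[OF sep]) auto
      then show "W (x j t - x i t) = 0" using l by (simp add: W_def)
    qed
  qed (use n in auto)
  then have "S (empirical_measure n x t) (x i t) = w 0 / real n"
    using True \<eta> by (simp add: S_empirical[OF n] W_def)
  then show ?thesis
    using V_lipschitz[of 0 "w 0 / real n" "w 0 / real n"] w0 True by (simp add: particle_velocity_def)
next
  case False
  have s0: "0 \<le> (1 / real n) * (\<Sum>j=1..n. reg_kernel w \<eta> l (x j t - x i t))"
    using reg_kernel_bounds[OF l] by (intro mult_nonneg_nonneg sum_nonneg) auto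
  have "\<bar>(1 / real n) * (\<Sum>j=1..n. reg_kernel w \<eta> l (x j t - x i t)) - S (empirical_measure n x t) (x i t)\<bar> \<le> (1 / real n) * w 0"
    unfolding S_empirical[OF n] right_diff_distrib[symmetric] abs_mult
    using reg_kernel_sum_diff[OF l sep i] by (simp add: divide_right_mono)
  from V_lipschitz[OF s0 S_nonneg this] show ?thesis using False by (simp add: particle_velocity_def)
qed

end

context flux_flow
begin

lemma cdf_empirical_near:
  assumes t: "0 \<le> t" and n: "1 \<le> n" and d: "\<And>i. i \<in> {1..n} \<Longrightarrow> \<bar>x i t - X t (real i / real n)\<bar> \<le> d"
  shows "\<bar>cdf (empirical_measure n x t) y - cdf (law (X t)) y\<bar> \<le> M * d + 1 / real n"
proof -
  note E = M expand[OF t]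
  interpret real_distribution "law (X t)" by (rule real_distribution_law[OF E])
  have n0: "0 < real n" using n by simp
  have d0: "0 \<le> d" using d[of 1] n by (smt (verit) atLeastAtMost_iff order_refl)
  let ?F = "cdf (law (X t))" and ?A = "{i\<in>{1..n}. x i t \<le> y}"
  have "?A \<subseteq> {1..nat \<lfloor>real n * ?F (y + d)\<rfloor>}"
  proof
    fix i assume i: "i \<in> ?A"
    then have "X t (real i / real n) \<le> y + d" using d[of i] by auto
    then have "real i / real n \<le> ?F (y + d)" using i n0 by (intro cdf_law_ge[OF E]) auto
    then have "real i \<le> real n * ?F (y + d)" using n0 by (simp add: field_simps)
    then show "i \<in> {1..nat \<lfloor>real n * ?F (y + d)\<rfloor>}" using i by (simp add: le_nat_floor)
  qed
  then have "card ?A \<le> nat \<lfloor>real n * ?F (y + d)\<rfloor>" using card_mono[of "{1..nat \<lfloor>real n * ?F (y + d)\<rfloor>}"] by force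
  also have "real \<dots> \<le> real n * ?F (y + d)" using n0 cdf_nonneg by simp
  finally have "real (card ?A) / real n \<le> ?F (y + d)" using n0 by (simp add: field_simps)
  moreover have "?F (y + d) \<le> ?F y + M * d" using cdf_law_diff[OF E, of y "y + d"] d0 by simp
  ultimately have upper: "cdf (empirical_measure n x t) y \<le> ?F y + M * d" by (simp add: cdf_empirical[OF n])
  have "{1..<nat \<lceil>real n * ?F (y - d)\<rceil>} \<subseteq> ?A"
  proof
    fix i assume i: "i \<in> {1..<nat \<lceil>real n * ?F (y - d)\<rceil>}"
    then have "real i < real n * ?F (y - d)" by (simp add: nat_less_iff less_ceiling_iff zless_nat_eq_int_zless)
    then have *: "real i / real n < ?F (y - d)" using n0 by (simp add: field_simps)
    then have "real i / real n < 1" using cdf_bounded_prob[of "y - d"] by linarith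
    then have "i \<in> {1..n}" using i n0 by simp
    moreover have "X t (real i / real n) \<le> y - d" using cdf_law_le[OF E, of "real i / real n" "y - d"] * n0 by force
    ultimately show "i \<in> ?A" using d[of i] by auto
  qed
  then have "card {1..<nat \<lceil>real n * ?F (y - d)\<rceil>} \<le> card ?A" by (intro card_mono) auto
  then have "real n * ?F (y - d) - 1 \<le> real (card ?A)" by (simp) linarith
  then have "(real n * ?F (y - d) - 1) / real n \<le> real (card ?A) / real n" using n0 by (intro divide_right_mono) auto
  then have "?F (y - d) - 1 / real n \<le> real (card ?A) / real n" using n0 by (simp add: diff_divide_distrib)
  moreover have "?F y - M * d \<le> ?F (y - d)" using cdf_law_diff[OF E, of "y - d" y] d0 by simp
  ultimately have "?F y - M * d - 1 / real n \<le> cdf (empirical_measure n x t) y" by (simp add: cdf_empirical[OF n])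
  moreover have "0 \<le> 1 / real n" by simp
  ultimately show ?thesis using upper by linarith
qed

lemma particle_velocity_near:
  assumes t: "0 \<le> t" and n: "1 \<le> n" and d: "\<And>i. i \<in> {1..n} \<Longrightarrow> \<bar>x i t - X t (real i / real n)\<bar> \<le> d"
    and l: "0 < l" and sep: "separated l n (\<lambda>j. x j t)" and i: "i \<in> {1..n}"
  shows "\<bar>particle_velocity v w \<eta> l n (\<lambda>j. x j t) i - U t (X t (real i / real n))\<bar> \<le> 2 * K * d + 3 * Lv * w 0 / real n"
proof -
  have "\<bar>S (empirical_measure n x t) (x i t) - S (law (X t)) (x i t)\<bar> \<le> w 0 * (2 * (M * d + 1 / real n))"
    by (intro S_cdf_diff cdf_empirical_near t n d real_distribution_empirical real_distribution_law[OF M expand])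
  from V_lipschitz[OF S_nonneg S_nonneg this]
  have 1: "\<bar>V (S (empirical_measure n x t) (x i t)) - U t (x i t)\<bar> \<le> Lv * (w 0 * (2 * (M * d + 1 / real n)))"
    by (simp add: U_def)
  have "\<bar>U t (x i t) - U t (X t (real i / real n))\<bar> \<le> K * \<bar>x i t - X t (real i / real n)\<bar>" by (rule U_lipschitz[OF t])
  also have "\<dots> \<le> K * d" using d[OF i] K_nonneg by (intro mult_left_mono)
  finally have 2: "\<bar>U t (x i t) - U t (X t (real i / real n))\<bar> \<le> K * d" .
  have "Lv * (w 0 / real n) + Lv * (w 0 * (2 * (M * d + 1 / real n))) + K * d = 2 * K * d + 3 * Lv * w 0 / real n"
    by (simp add: K_def algebra_simps add_divide_distrib)
  then show ?thesis using particle_velocity_empirical[where x = x and t = t, OF l n sep i] 1 2 by linarith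
qed

lemma particles_near_flow:
  assumes n: "1 \<le> n" and l: "0 < l"
    and x: "\<And>i t. i \<in> {1..n} \<Longrightarrow> t \<in> {0..T} \<Longrightarrow>
      (x i has_real_derivative particle_velocity v w \<eta> l n (\<lambda>j. x j t) i) (at t within {0..T})"
    and sep: "\<And>t. t \<in> {0..T} \<Longrightarrow> separated l n (\<lambda>j. x j t)"
    and init: "\<And>i. i \<in> {1..n} \<Longrightarrow> x i 0 = X 0 (real i / real n)"
    and t: "t \<in> {0..T}" and d: "3 * Lv * w 0 / real n * t * exp (2 * K * (2 * v 0 + 1) * t) < d" and i: "i \<in> {1..n}"
  shows "\<bar>x i t - X t (real i / real n)\<bar> \<le> d"
proof -
  define P where "P t d \<longleftrightarrow> (\<forall>i\<in>{1..n}. \<bar>x i t - X t (real i / real n)\<bar> \<le> d)" for t d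
  let ?\<epsilon> = "3 * Lv * w 0 / real n" and ?C = "2 * K * (2 * v 0 + 1)"
  have "P t d"
  proof (rule discrete_gronwall[where T = T, OF _ _ _ _ _ _ _ d])
    show "P 0 0" using init by (simp add: P_def)
    show "0 \<le> ?C" using K_nonneg v0_nonneg by simp
    show "0 \<le> ?\<epsilon>" using Lv_nonneg w0 by simp
    show "P s e" if "P s d" "d \<le> e" for s d e using that by (force simp: P_def)
    show "P (s + h) (d + h * (?C * (d + h) + ?\<epsilon>))"
      if s: "0 \<le> s" "0 \<le> h" "s + h \<le> T" and d: "0 \<le> d" "P s d" for s h d
      unfolding P_def
    proof
      fix i assume i: "i \<in> {1..n}"
      have lab: "real j / real n \<in> {0..1}" if "j \<in> {1..n}" for j using that by auto
      have "\<exists>r\<in>{s..s+h}. (x i (s + h) - X (s + h) (real i / real n)) - (x i s - X s (real i / real n))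
        = (s + h - s) * (particle_velocity v w \<eta> l n (\<lambda>j. x j r) i - U r (X r (real i / real n)))"
      proof (rule has_real_derivative_mvt)
        show "{s..s+h} \<subseteq> {0..T}" using s by auto
        show "((\<lambda>t. x i t - X t (real i / real n)) has_real_derivative
            particle_velocity v w \<eta> l n (\<lambda>j. x j r) i - U r (X r (real i / real n))) (at r within {0..T})"
          if "r \<in> {s..s+h}" for r
        proof (rule DERIV_diff)
          show "((\<lambda>t. X t (real i / real n)) has_real_derivative U r (X r (real i / real n))) (at r within {0..T})"
            using that s by (intro has_field_derivative_subset[OF flow_label[OF _ lab[OF i]]]) auto
        qed (use that s i x in auto)
      qed (use s in simp)
      then obtain r where r: "r \<in> {s..s+h}"
        "(x i (s + h) - X (s + h) (real i / real n)) - (x i s - X s (real i / real n))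
          = h * (particle_velocity v w \<eta> l n (\<lambda>j. x j r) i - U r (X r (real i / real n)))" by auto
      have near: "\<bar>x j r - X r (real j / real n)\<bar> \<le> d + 2 * v 0 * h" if j: "j \<in> {1..n}" for j
      proof -
        have "v 0 * (r - s) \<le> v 0 * h" using r(1) v0_nonneg by (intro mult_left_mono) auto
        moreover have "0 \<le> x j r - x j s" "x j r - x j s \<le> v 0 * (r - s)"
          using r(1) s by (intro particle_solution_move[OF l j _ _ _ x[OF j]]; simp)+
        moreover have "X s (real j / real n) \<le> X r (real j / real n)"
          "X r (real j / real n) \<le> X s (real j / real n) + v 0 * (r - s)"
          using r(1) s by (intro flow_move; simp)+
        moreover have "\<bar>x j s - X s (real j / real n)\<bar> \<le> d" using d(2) j by (simp add: P_def)
        moreover have "0 \<le> v 0 * h" using v0_nonneg s by simp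
        ultimately show ?thesis by linarith
      qed
      have "\<bar>particle_velocity v w \<eta> l n (\<lambda>j. x j r) i - U r (X r (real i / real n))\<bar> \<le> 2 * K * (d + 2 * v 0 * h) + ?\<epsilon>"
      proof (rule particle_velocity_near[where x = x and t = r])
        show "separated l n (\<lambda>j. x j r)" using r(1) s by (intro sep) auto
      qed (use r(1) s n l i near in auto)
      also have "\<dots> \<le> ?C * (d + h) + ?\<epsilon>"
      proof -
        have "0 \<le> K * (v 0 * d + h)" using K_nonneg v0_nonneg d(1) s by simp
        then have "0 \<le> K * (v 0 * d)" "0 \<le> K * h" using K_nonneg v0_nonneg d(1) s by simp_all
        then show ?thesis by (simp add: algebra_simps)
      qed
      finally have "h * \<bar>particle_velocity v w \<eta> l n (\<lambda>j. x j r) i - U r (X r (real i / real n))\<bar> \<le> h * (?C * (d + h) + ?\<epsilon>)"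
        using s(2) by (rule mult_left_mono)
      then have "\<bar>(x i (s + h) - X (s + h) (real i / real n)) - (x i s - X s (real i / real n))\<bar> \<le> h * (?C * (d + h) + ?\<epsilon>)"
        using s(2) by (simp only: r(2) abs_mult abs_of_nonneg)
      moreover have "\<bar>x i s - X s (real i / real n)\<bar> \<le> d" using d(2) i by (simp add: P_def)
      ultimately show "\<bar>x i (s + h) - X (s + h) (real i / real n)\<bar> \<le> d + h * (?C * (d + h) + ?\<epsilon>)" by linarith
    qed
  qed (use t in auto)
  then show ?thesis using i by (simp add: P_def)
qed

lemma empirical_weak_conv:
  assumes l: "\<And>n. 1 \<le> n \<Longrightarrow> 0 < l n"
    and x: "\<And>n i t. 1 \<le> n \<Longrightarrow> i \<in> {1..n} \<Longrightarrow> t \<in> {0..T} \<Longrightarrow>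
      (x n i has_real_derivative particle_velocity v w \<eta> (l n) n (\<lambda>j. x n j t) i) (at t within {0..T})"
    and sep: "\<And>n t. 1 \<le> n \<Longrightarrow> t \<in> {0..T} \<Longrightarrow> separated (l n) n (\<lambda>j. x n j t)"
    and init: "\<And>n i. 1 \<le> n \<Longrightarrow> i \<in> {1..n} \<Longrightarrow> x n i 0 = X 0 (real i / real n)"
    and t: "t \<in> {0..T}"
  shows "weak_conv_m (\<lambda>n. empirical_measure n (x n) t) (law (X t))"
proof (rule weak_conv_m_if_uniform)
  define E where "E = 3 * Lv * w 0 * t * exp (2 * K * (2 * v 0 + 1) * t) + 1"
  show "\<bar>cdf (empirical_measure n (x n) t) y - cdf (law (X t)) y\<bar> \<le> M * (E / real n) + 1 / real n" if n: "1 \<le> n" for n y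
  proof (rule cdf_empirical_near[OF _ n])
    fix i assume i: "i \<in> {1..n}"
    show "\<bar>x n i t - X t (real i / real n)\<bar> \<le> E / real n"
    proof (rule particles_near_flow[OF n l[OF n] x[OF n] sep[OF n] init[OF n] t _ i])
      have "3 * Lv * w 0 / real n * t * exp (2 * K * (2 * v 0 + 1) * t) = (E - 1) / real n" by (simp add: E_def)
      also have "\<dots> < E / real n" using n by (intro divide_strict_right_mono) auto
      finally show "3 * Lv * w 0 / real n * t * exp (2 * K * (2 * v 0 + 1) * t) < E / real n" .
    qed
  qed (use t in auto)
  have "(\<lambda>n. M * (E / real n) + 1 / real n) \<longlonglongrightarrow> M * 0 + 0" by (intro tendsto_intros lim_const_over_n)
  then show "(\<lambda>n. M * (E / real n) + 1 / real n) \<longlonglongrightarrow> 0" by simp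
qed

end

section \<open>The initial datum\<close>

locale initial_density =
  fixes \<rho>\<^sub>0 :: "real \<Rightarrow> real" and M R :: real
  assumes int: "integrable lborel \<rho>\<^sub>0" and nonneg: "AE x in lborel. 0 \<le> \<rho>\<^sub>0 x" and le_M: "AE x in lborel. \<rho>\<^sub>0 x \<le> M"
    and M: "0 < M" and R: "0 < R" and supp: "AE x in lborel. x \<notin> {-R<..<R} \<longrightarrow> \<rho>\<^sub>0 x = 0"
    and mass: "(LINT x|lborel. \<rho>\<^sub>0 x) = 1"
begin

definition F :: "real \<Rightarrow> real" where "F x = (LBINT y:{..x}. \<rho>\<^sub>0 y)"

lemma set_int: "A \<in> sets borel \<Longrightarrow> set_integrable lborel A \<rho>\<^sub>0"
  unfolding set_integrable_def using integrable_mult_indicator[OF _ int, of A] by simp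

lemma F_diff: "x \<le> y \<Longrightarrow> F y - F x = (LBINT t:{x<..y}. \<rho>\<^sub>0 t)"
proof -
  assume "x \<le> y"
  then have "{..y} = {..x} \<union> {x<..y}" by auto
  then have "F y = F x + (LBINT t:{x<..y}. \<rho>\<^sub>0 t)"
    unfolding F_def by (simp only:) (rule set_integral_Un; auto intro: set_int)
  then show ?thesis by simp
qed

lemma F_mono: "x \<le> y \<Longrightarrow> F x \<le> F y"
proof -
  assume "x \<le> y"
  moreover have "0 \<le> (LBINT t:{x<..y}. \<rho>\<^sub>0 t)"
    unfolding set_lebesgue_integral_def by (rule integral_nonneg_AE) (use nonneg in eventually_elim, simp)
  ultimately show ?thesis using F_diff by fastforce
qed

lemma F_lipschitz: "x \<le> y \<Longrightarrow> F y - F x \<le> M * (y - x)"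
proof -
  assume xy: "x \<le> y"
  have "(LBINT t:{x<..y}. \<rho>\<^sub>0 t) \<le> (LBINT t:{x<..y}. M)"
    unfolding set_lebesgue_integral_def
  proof (rule integral_mono_AE)
    show "AE t in lborel. indicator {x<..y} t *\<^sub>R \<rho>\<^sub>0 t \<le> indicator {x<..y} t *\<^sub>R M"
      using le_M by eventually_elim (simp add: mult_left_mono)
    show "integrable lborel (\<lambda>t. indicator {x<..y} t *\<^sub>R \<rho>\<^sub>0 t)" using set_int[of "{x<..y}"] by (simp add: set_integrable_def)
    have "integrable lborel (indicat_real {x<..y})" using xy by (intro integrable_real_indicator) auto
    then show "integrable lborel (\<lambda>t. indicator {x<..y} t *\<^sub>R M)" by simp
  qed
  also have "\<dots> = M * (y - x)" using xy by (simp add: set_lebesgue_integral_def)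
  finally show ?thesis using F_diff[OF xy] by simp
qed

lemma F_left: "x \<le> - R \<Longrightarrow> F x = 0"
  unfolding F_def set_lebesgue_integral_def
proof (rule integral_eq_zero_AE)
  assume "x \<le> - R"
  show "AE t in lborel. indicator {..x} t *\<^sub>R \<rho>\<^sub>0 t = 0"
    using supp by eventually_elim (use \<open>x \<le> - R\<close> in \<open>auto simp: indicator_def\<close>)
qed

lemma F_right: "R \<le> x \<Longrightarrow> F x = 1"
proof -
  assume x: "R \<le> x"
  have "F x = (LINT t|lborel. \<rho>\<^sub>0 t)"
    unfolding F_def set_lebesgue_integral_def
  proof (rule integral_cong_AE)
    show "AE t in lborel. indicator {..x} t *\<^sub>R \<rho>\<^sub>0 t = \<rho>\<^sub>0 t"
      using supp by eventually_elim (use x in \<open>auto simp: indicator_def\<close>)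
    show "(\<lambda>t. indicator {..x} t *\<^sub>R \<rho>\<^sub>0 t) \<in> borel_measurable lborel"
      using set_int[of "{..x}"] by (auto simp: set_integrable_def)
  qed (use int in auto)
  then show ?thesis by (simp add: mass)
qed

lemma F_bounds: "0 \<le> F x" "F x \<le> 1"
  using F_mono[of "min x (-R)" x] F_mono[of x "max x R"] F_left[of "min x (-R)"] F_right[of "max x R"] by auto

text \<open>Adding constant density \<open>M\<close> outside of the support makes the quantile function finite for
  every real label.\<close>

definition clip :: "real \<Rightarrow> real" where "clip x = max (-R) (min R x)"

definition Fe :: "real \<Rightarrow> real" where "Fe x = F (clip x) + M * (x - clip x)"

definition quantile :: "real \<Rightarrow> real" where "quantile a = Sup {x. Fe x < a}"

lemma clip_mono: "x \<le> y \<Longrightarrow> clip x \<le> clip y" "x \<le> y \<Longrightarrow> clip y - clip x \<le> y - x"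
  using R by (auto simp: clip_def)

lemma Fe_mono: "x \<le> y \<Longrightarrow> Fe x \<le> Fe y"
proof -
  assume xy: "x \<le> y"
  have "0 \<le> M * ((y - x) - (clip y - clip x))" using M clip_mono(2)[OF xy] by simp
  then show ?thesis using F_mono[OF clip_mono(1)[OF xy]] by (simp add: Fe_def algebra_simps)
qed

lemma Fe_lipschitz: "x \<le> y \<Longrightarrow> Fe y - Fe x \<le> M * (y - x)"
proof -
  assume xy: "x \<le> y"
  show ?thesis using F_lipschitz[OF clip_mono(1)[OF xy]] by (simp add: Fe_def algebra_simps)
qed

lemma Fe_inside: "- R \<le> x \<Longrightarrow> x \<le> R \<Longrightarrow> Fe x = F x" by (simp add: Fe_def clip_def)

lemma Fe_left: "x < - R \<Longrightarrow> Fe x = M * (x + R)" using R F_left[of "-R"] by (simp add: Fe_def clip_def)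

lemma Fe_right: "R < x \<Longrightarrow> Fe x = 1 + M * (x - R)" using R F_right[of R] by (simp add: Fe_def clip_def)

lemma quantile_set: "{x. Fe x < a} \<noteq> {}" "bdd_above {x. Fe x < a}"
proof -
  define b where "b = (\<bar>a\<bar> + 1) / M"
  have b: "0 < b" "M * b = \<bar>a\<bar> + 1" using M by (auto simp: b_def intro: divide_pos_pos)
  have "Fe (- R - b) = - (\<bar>a\<bar> + 1)" using b by (subst Fe_left) auto
  then have "- R - b \<in> {x. Fe x < a}" by simp
  then show "{x. Fe x < a} \<noteq> {}" by blast
  have r: "Fe (R + b) = \<bar>a\<bar> + 2" using b by (subst Fe_right) auto
  show "bdd_above {x. Fe x < a}"
  proof (rule bdd_aboveI)
    fix x assume "x \<in> {x. Fe x < a}"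
    then show "x \<le> R + b" using Fe_mono[of "R + b" x] r by (cases "x \<le> R + b") auto
  qed
qed

lemma Fe_quantile: "Fe (quantile a) = a"
proof (rule antisym)
  show "Fe (quantile a) \<le> a"
  proof (rule field_le_epsilon)
    fix e :: real assume e: "0 < e"
    have "quantile a - e / M < Sup {x. Fe x < a}" using e M by (simp add: quantile_def)
    then obtain x where x: "Fe x < a" "quantile a - e / M < x"
      using less_cSup_iff[OF quantile_set] by auto
    show "Fe (quantile a) \<le> a + e"
    proof (cases "x \<le> quantile a")
      case True
      have "M * (quantile a - x) \<le> M * (e / M)" using x M by (intro mult_left_mono) auto
      then show ?thesis using Fe_lipschitz[OF True] x M by simp
    next
      case False
      then show ?thesis using Fe_mono[of "quantile a" x] x e by simp
    qed
  qed
  show "a \<le> Fe (quantile a)"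
  proof (rule field_le_epsilon)
    fix e :: real assume e: "0 < e"
    then have lt: "quantile a < quantile a + e / M" using M by simp
    have "quantile a + e / M \<notin> {x. Fe x < a}"
    proof
      assume "quantile a + e / M \<in> {x. Fe x < a}"
      then have "quantile a + e / M \<le> quantile a" unfolding quantile_def[of a] by (rule cSup_upper[OF _ quantile_set(2)])
      then show False using lt by simp
    qed
    then show "a \<le> Fe (quantile a) + e" using Fe_lipschitz[OF less_imp_le[OF lt]] M by simp
  qed
qed

lemma quantile_le_iff: "quantile a \<le> x \<longleftrightarrow> a \<le> Fe x"
proof
  assume "quantile a \<le> x"
  then show "a \<le> Fe x" using Fe_mono[of "quantile a" x] by (simp add: Fe_quantile)
next
  assume a: "a \<le> Fe x"
  show "quantile a \<le> x"
    unfolding quantile_def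
  proof (rule cSup_least[OF quantile_set(1)])
    fix y assume "y \<in> {x. Fe x < a}"
    then show "y \<le> x" using a Fe_mono[of x y] by (cases "y \<le> x") auto
  qed
qed

lemma expanding_quantile: "expanding M quantile"
  unfolding expanding_def
proof (intro allI impI)
  fix a b :: real assume ab: "a \<le> b"
  then have "quantile a \<le> quantile b" by (simp add: quantile_le_iff Fe_quantile)
  from Fe_lipschitz[OF this] show "b - a \<le> M * (quantile b - quantile a)" by (simp add: Fe_quantile)
qed

lemma Fe_less_iff: "0 < a \<Longrightarrow> a \<le> 1 \<Longrightarrow> Fe x < a \<longleftrightarrow> F x < a"
proof -
  assume a: "0 < a" "a \<le> 1"
  consider "x < - R" | "- R \<le> x" "x \<le> R" | "R < x" by linarith
  then show ?thesis
  proof cases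
    case 1
    then have "M * (x + R) < 0" using M by (simp add: mult_less_0_iff)
    then show ?thesis using 1 a by (simp add: Fe_left F_left)
  next
    case 3
    then have "0 < M * (x - R)" using M by simp
    then show ?thesis using 3 a by (simp add: Fe_right F_right)
  qed (simp add: Fe_inside)
qed

lemma F_quantile: "0 \<le> a \<Longrightarrow> a \<le> 1 \<Longrightarrow> F (quantile a) = a"
proof -
  assume a: "0 \<le> a" "a \<le> 1"
  let ?x = "quantile a"
  consider "?x < - R" | "- R \<le> ?x" "?x \<le> R" | "R < ?x" by linarith
  then show ?thesis
  proof cases
    case 1
    then have "M * (?x + R) < 0" using M by (simp add: mult_less_0_iff)
    then show ?thesis using Fe_left[OF 1] a by (simp add: Fe_quantile)
  next
    case 2
    then show ?thesis using Fe_inside[of ?x] by (simp add: Fe_quantile)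
  next
    case 3
    then have "0 < M * (?x - R)" using M by simp
    then show ?thesis using Fe_right[OF 3] a by (simp add: Fe_quantile)
  qed
qed

lemma cdf_initial: "cdf (measure_with_density \<rho>\<^sub>0) x = F x" "emeasure (measure_with_density \<rho>\<^sub>0) UNIV = 1"
proof -
  have e: "emeasure (measure_with_density \<rho>\<^sub>0) A = ennreal (LBINT t:A. \<rho>\<^sub>0 t)" if [measurable]: "A \<in> sets borel" for A
  proof -
    have [measurable]: "\<rho>\<^sub>0 \<in> borel_measurable borel" using int by auto
    have "emeasure (measure_with_density \<rho>\<^sub>0) A = (\<integral>\<^sup>+t. ennreal (\<rho>\<^sub>0 t) * indicator A t \<partial>lborel)"
      unfolding measure_with_density_def by (rule emeasure_density) auto
    also have "\<dots> = (\<integral>\<^sup>+t. ennreal (indicator A t *\<^sub>R \<rho>\<^sub>0 t) \<partial>lborel)"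
      by (intro nn_integral_cong) (auto simp: indicator_def)
    also have "\<dots> = ennreal (LBINT t:A. \<rho>\<^sub>0 t)"
      unfolding set_lebesgue_integral_def
    proof (rule nn_integral_eq_integral)
      show "integrable lborel (\<lambda>t. indicator A t *\<^sub>R \<rho>\<^sub>0 t)" using set_int[OF that] by (simp add: set_integrable_def)
      show "AE t in lborel. 0 \<le> indicator A t *\<^sub>R \<rho>\<^sub>0 t" using nonneg by eventually_elim simp
    qed
    finally show ?thesis .
  qed
  show "cdf (measure_with_density \<rho>\<^sub>0) x = F x"
    using e[of "{..x}"] F_bounds(1)[of x] unfolding F_def cdf_def by (simp add: measure_def)
  show "emeasure (measure_with_density \<rho>\<^sub>0) UNIV = 1" using e[of UNIV] mass by (simp add: set_lebesgue_integral_def)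
qed

lemma law_quantile: "law quantile = measure_with_density \<rho>\<^sub>0"
proof (rule cdf_unique)
  note E = M expanding_quantile
  show "real_distribution (law quantile)" by (rule real_distribution_law[OF E])
  then interpret real_distribution "law quantile" .
  show "real_distribution (measure_with_density \<rho>\<^sub>0)"
    using cdf_initial(2)
    by (auto simp: real_distribution_def real_distribution_axioms_def measure_with_density_def intro!: prob_spaceI)
  have "cdf (law quantile) x = F x" for x
  proof (rule antisym)
    show "F x \<le> cdf (law quantile) x"
    proof (cases "x < - R")
      case False
      then have "F x \<le> Fe x" using M by (cases "x \<le> R") (simp_all add: Fe_inside Fe_right F_right)
      then show ?thesis using F_bounds by (intro cdf_law_ge[OF E]) (simp_all add: quantile_le_iff)
    qed (use F_left cdf_nonneg in simp)
    show "cdf (law quantile) x \<le> F x"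
    proof (cases "R < x")
      case False
      then have le: "Fe x \<le> F x"
        using M by (cases "x < - R") (simp_all add: Fe_inside Fe_left F_left mult_le_0_iff)
      show ?thesis
      proof (rule dense_ge)
        fix a assume a: "F x < a"
        then have "x < quantile a" using le quantile_le_iff[of a x] by linarith
        then show "cdf (law quantile) x \<le> a" using a F_bounds(1)[of x] by (intro cdf_law_le[OF E]) auto
      qed
    qed (use F_right cdf_bounded_prob in simp)
  qed
  then show "cdf (law quantile) = cdf (measure_with_density \<rho>\<^sub>0)" by (simp add: fun_eq_iff cdf_initial)
qed

lemma initial_position_eq:
  assumes "1 \<le> i" "i \<le> n"
  shows "initial_position \<rho>\<^sub>0 n i = quantile (real i / real n)"
  using assms
proof (induction i rule: dec_induct)
  case base
  then have "0 < 1 / real n" "1 / real n \<le> 1" by auto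
  from Fe_less_iff[OF this] show ?case by (simp add: quantile_def flip: F_def One_nat_def) (simp add: F_def)
next
  case (step i)
  then have n: "0 < real n" and i: "1 \<le> i" "i < n" by auto
  then obtain k where k: "i = Suc k" by (cases i) auto
  let ?q = "quantile (real i / real n)"
  have Fq: "F ?q = real i / real n" using i n by (intro F_quantile) auto
  have "(LBINT y=ereal ?q..ereal x. \<rho>\<^sub>0 y) = F x - F ?q" for x
  proof (cases "?q \<le> x")
    case True
    then show ?thesis by (simp add: interval_integral_Ioc F_diff)
  next
    case False
    then have "(LBINT y=ereal x..ereal ?q. \<rho>\<^sub>0 y) = F ?q - F x" by (simp add: interval_integral_Ioc F_diff)
    then show ?thesis by (subst interval_integral_endpoints_reverse) simp
  qed
  then have "initial_position \<rho>\<^sub>0 n (Suc i) = Sup {x. F x - real i / real n < 1 / real n}"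
    using step i by (simp add: k Fq[unfolded k of_nat_Suc])
  also have "{x. F x - real i / real n < 1 / real n} = {x. F x < real (Suc i) / real n}"
    by (auto simp: add_divide_distrib)
  also have "\<dots> = {x. Fe x < real (Suc i) / real n}" using i n by (subst Fe_less_iff) auto
  finally show ?case by (simp add: quantile_def)
qed

lemma separated_initial:
  assumes n: "1 \<le> n" shows "separated (1 / (real n * M)) n (initial_position \<rho>\<^sub>0 n)"
  unfolding separated_def
proof
  fix i assume i: "i \<in> {1..<n}"
  have "real (Suc i) / real n - real i / real n \<le> M * (quantile (real (Suc i) / real n) - quantile (real i / real n))"
    by (intro expanding_le[OF expanding_quantile] divide_right_mono) auto
  then have "1 / real n \<le> M * (quantile (real (Suc i) / real n) - quantile (real i / real n))"
    by (simp add: add_divide_distrib)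
  then have "1 / real n / M \<le> quantile (real (Suc i) / real n) - quantile (real i / real n)"
    by (subst pos_divide_le_eq[OF M]) (simp add: mult.commute)
  then show "1 / (real n * M) \<le> initial_position \<rho>\<^sub>0 n (Suc i) - initial_position \<rho>\<^sub>0 n i"
    using i by (simp add: initial_position_eq)
qed

end

lemma Linf_norm_properties:
  fixes \<rho>\<^sub>0 :: "real \<Rightarrow> real"
  assumes int: "integrable lborel \<rho>\<^sub>0" and range: "AE x in lborel. \<rho>\<^sub>0 x \<in> {0..1}" and mass: "(LINT x|lborel. \<rho>\<^sub>0 x) = 1"
  shows "esssup lborel (\<lambda>x. ereal (\<rho>\<^sub>0 x)) = ereal (Linf_norm \<rho>\<^sub>0)" "AE x in lborel. \<rho>\<^sub>0 x \<le> Linf_norm \<rho>\<^sub>0" "0 < Linf_norm \<rho>\<^sub>0"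
proof -
  have [measurable]: "\<rho>\<^sub>0 \<in> borel_measurable borel" using int by auto
  let ?e = "esssup lborel (\<lambda>x. ereal \<bar>\<rho>\<^sub>0 x\<bar>)"
  have eq: "esssup lborel (\<lambda>x. ereal (\<rho>\<^sub>0 x)) = ?e"
    by (rule esssup_AE_cong) (use range in \<open>auto elim: eventually_mono\<close>)
  have "?e \<le> 1"
    by (rule esssup_I) (use range in \<open>auto elim: eventually_mono\<close>)
  moreover have "0 \<le> ?e"
  proof -
    have "esssup lborel (\<lambda>x::real. 0 :: ereal) \<le> ?e" by (rule esssup_mono) auto
    then show ?thesis by (subst (asm) esssup_const) auto
  qed
  ultimately have e: "?e = ereal (Linf_norm \<rho>\<^sub>0)" unfolding Linf_norm_def by (cases ?e) auto
  then show "esssup lborel (\<lambda>x. ereal (\<rho>\<^sub>0 x)) = ereal (Linf_norm \<rho>\<^sub>0)" using eq by simp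
  have "AE x in lborel. ereal \<bar>\<rho>\<^sub>0 x\<bar> \<le> ?e" by (rule esssup_AE)
  then show le: "AE x in lborel. \<rho>\<^sub>0 x \<le> Linf_norm \<rho>\<^sub>0" unfolding e by eventually_elim simp
  show "0 < Linf_norm \<rho>\<^sub>0"
  proof (rule ccontr)
    assume "\<not> 0 < Linf_norm \<rho>\<^sub>0"
    have "AE x in lborel. \<rho>\<^sub>0 x = 0" using le range by eventually_elim (use \<open>\<not> 0 < Linf_norm \<rho>\<^sub>0\<close> in auto)
    then have "(LINT x|lborel. \<rho>\<^sub>0 x) = 0" by (rule integral_eq_zero_AE)
    then show False using mass by simp
  qed
qed

theorem theorem33:
  fixes v w \<rho>\<^sub>0 :: "real \<Rightarrow> real" and \<eta> :: real
  assumes v_range: "\<forall>x\<in>{0..1}. v x \<ge> 0"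
    and v_Lipschitz: "\<exists>L. L-lipschitz_on {0..1} v"
    and v_antimono: "antimono_on {0..1} v"
    and v_1: "v 1 = 0"
    and eta: "\<eta> > 0"
    and w_range: "\<forall>x\<in>{0..\<eta>}. w x \<ge> 0"
    and w_antimono: "antimono_on {0..\<eta>} w"
    and w_Lipschitz: "\<exists>L. L-lipschitz_on {0..\<eta>} w"
    and w_mass: "(LBINT x:{0..\<eta>}. w x) = 1"
    and rho0_BV: "BV \<rho>\<^sub>0"
    and rho0_range: "AE x in lborel. \<rho>\<^sub>0 x \<in> {0..1}"
    and rho0_support: "\<exists>K. compact K \<and> (AE x in lborel. x \<notin> K \<longrightarrow> \<rho>\<^sub>0 x = 0)"
    and rho0_mass: "(LINT x|lborel. \<rho>\<^sub>0 x) = 1"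
  shows "(\<forall>T>0. \<forall>n\<ge>1. \<exists>x. particle_solution v w \<eta> \<rho>\<^sub>0 n T x
            \<and> (\<forall>y. particle_solution v w \<eta> \<rho>\<^sub>0 n T y \<longrightarrow> (\<forall>i\<in>{1..n}. \<forall>t\<in>{0..T}. y i t = x i t))
            \<and> empirical_measure n x \<in> C0_P_c T)
       \<and> (\<exists>\<rho>. (\<forall>T>0. weak_solution v w \<eta> \<rho>\<^sub>0 T \<rho>
                 \<and> (\<forall>\<sigma>. weak_solution v w \<eta> \<rho>\<^sub>0 T \<sigma> \<longrightarrow> (\<forall>t\<in>{0..T}. \<sigma> t = \<rho> t))
                 \<and> (\<forall>x. (\<forall>n\<ge>1. particle_solution v w \<eta> \<rho>\<^sub>0 n T (x n)) \<longrightarrow>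
                      (\<forall>t\<in>{0..T}. weak_conv_m (\<lambda>n. empirical_measure n (x n) t) (\<rho> t))))
             \<and> (\<forall>t>0. \<exists>r\<in>borel_measurable borel. \<rho> t = measure_with_density r
                 \<and> (AE x in lborel. 0 \<le> r x \<and> ereal (r x) \<le> esssup lborel (\<lambda>y. ereal (\<rho>\<^sub>0 y)))))"
proof -
  obtain Lv where Lv: "Lv-lipschitz_on {0..1} v" using v_Lipschitz by blast
  obtain Lw where Lw: "Lw-lipschitz_on {0..\<eta>} w" using w_Lipschitz by blast
  interpret nonlocal_flux v w \<eta> Lv
    using v_range Lv v_antimono v_1 eta w_range w_antimono lipschitz_on_continuous_on[OF Lw]
    by unfold_locales auto
  have int: "integrable lborel \<rho>\<^sub>0" using rho0_BV by (simp add: BV_def)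
  define M where "M = Linf_norm \<rho>\<^sub>0"
  note Linf = Linf_norm_properties[OF int rho0_range rho0_mass, folded M_def]
  obtain K where K: "compact K" "AE x in lborel. x \<notin> K \<longrightarrow> \<rho>\<^sub>0 x = 0" using rho0_support by blast
  obtain B where B: "\<forall>x\<in>K. \<bar>x\<bar> \<le> B" using compact_imp_bounded[OF K(1)] bounded_real by blast
  interpret initial_density \<rho>\<^sub>0 M "\<bar>B\<bar> + 1"
  proof
    show "AE x in lborel. 0 \<le> \<rho>\<^sub>0 x" using rho0_range by (auto elim: eventually_mono)
    show "AE x in lborel. x \<notin> {- (\<bar>B\<bar> + 1)<..<\<bar>B\<bar> + 1} \<longrightarrow> \<rho>\<^sub>0 x = 0"
      using K(2) by eventually_elim (use B in force)
  qed (use int Linf rho0_mass in auto)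
  define l where "l n = 1 / (real n * M)" for n
  have l: "0 < l n" if "1 \<le> n" for n using that Linf(3) by (simp add: l_def)
  have sol: "particle_solution v w \<eta> \<rho>\<^sub>0 n T x \<longleftrightarrow>
      (\<forall>i\<in>{1..n}. x i 0 = initial_position \<rho>\<^sub>0 n i \<and> (\<forall>t\<in>{0..T}. (x i has_real_derivative
         particle_velocity v w \<eta> (l n) n (\<lambda>j. x j t) i) (at t within {0..T})))" for n T x
    by (simp add: particle_solution_def l_def M_def)
  have unique: "y i t = x i t"
    if "1 \<le> n" "particle_solution v w \<eta> \<rho>\<^sub>0 n T y" "particle_solution v w \<eta> \<rho>\<^sub>0 n T x" "i \<in> {1..n}" "t \<in> {0..T}" for n T x y i t
    by (rule particle_solution_unique[OF l[OF that(1)] that(1) Lw]) (use that in \<open>auto simp: sol\<close>)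
  have exist: "\<exists>x. particle_solution v w \<eta> \<rho>\<^sub>0 n T x \<and> (\<forall>t\<in>{0..T}. separated (l n) n (\<lambda>j. x j t))"
    if n: "1 \<le> n" for n T
  proof -
    obtain x where "\<forall>i. x i 0 = initial_position \<rho>\<^sub>0 n i" "\<forall>t\<ge>0. separated (l n) n (\<lambda>j. x j t)"
      and d: "\<forall>t\<ge>0. \<forall>i\<in>{1..n}.
        (x i has_real_derivative particle_velocity v w \<eta> (l n) n (\<lambda>j. x j t) i) (at t within {0..})"
      using particle_flow_exists[OF l[OF n] n Lw separated_initial[OF n, folded l_def]] by blast
    moreover have "(x i has_real_derivative particle_velocity v w \<eta> (l n) n (\<lambda>j. x j t) i) (at t within {0..T})"
      if "t \<in> {0..T}" "i \<in> {1..n}" for t i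
      using that by (intro has_field_derivative_subset[OF d[rule_format]]) auto
    ultimately show ?thesis by (intro exI[of _ x]) (simp add: sol)
  qed
  have particles: "\<exists>x. particle_solution v w \<eta> \<rho>\<^sub>0 n T x
      \<and> (\<forall>y. particle_solution v w \<eta> \<rho>\<^sub>0 n T y \<longrightarrow> (\<forall>i\<in>{1..n}. \<forall>t\<in>{0..T}. y i t = x i t))
      \<and> empirical_measure n x \<in> C0_P_c T" if n: "1 \<le> n" for n T
  proof -
    obtain x where x: "particle_solution v w \<eta> \<rho>\<^sub>0 n T x" using exist[OF n] by blast
    have "empirical_measure n x \<in> C0_P_c T"
      by (rule empirical_curve_C0_P_c[OF l[OF n] n]) (use x in \<open>simp add: sol\<close>)
    then show ?thesis using x unique[OF n] by blast
  qed
  obtain X where X: "X 0 = quantile" "\<forall>t\<ge>0. expanding M (X t)"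
    "\<forall>t\<ge>0. \<forall>a. ((\<lambda>s. X s a) has_real_derivative V (S (law (X t)) (X t (max 0 (min 1 a))))) (at t within {0..})"
    using continuum_flow_exists[OF Linf(3) expanding_quantile] by blast
  interpret flux_flow v w \<eta> Lv M X
    by unfold_locales (use X Linf(3) in auto)
  have init: "law (X 0) = measure_with_density \<rho>\<^sub>0" by (simp add: X(1) law_quantile)
  have conv: "weak_conv_m (\<lambda>n. empirical_measure n (x n) t) (law (X t))"
    if x: "\<forall>n\<ge>1. particle_solution v w \<eta> \<rho>\<^sub>0 n T (x n)" and t: "t \<in> {0..T}" for x T t
  proof (rule empirical_weak_conv[OF l _ _ _ t])
    fix n :: nat assume n: "1 \<le> n"
    show "(x n i has_real_derivative particle_velocity v w \<eta> (l n) n (\<lambda>j. x n j t) i) (at t within {0..T})"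
      if "i \<in> {1..n}" "t \<in> {0..T}" for i t using x n that by (simp add: sol)
    show "x n i 0 = X 0 (real i / real n)" if "i \<in> {1..n}" for i
      using x n that by (simp add: sol X(1) initial_position_eq)
    fix t assume t: "t \<in> {0..T}"
    obtain z where z: "particle_solution v w \<eta> \<rho>\<^sub>0 n T z" "separated (l n) n (\<lambda>j. z j t)" using exist[OF n] t by blast
    have "x n i t = z i t" if "i \<in> {1..n}" for i using unique[OF n _ z(1) that t] x n by blast
    then show "separated (l n) n (\<lambda>j. x n j t)" using z(2) by (simp add: separated_def)
  qed
  show ?thesis
  proof (intro conjI exI[of _ "\<lambda>t. law (X t)"] allI impI ballI)
    fix T :: real and n :: nat assume "0 < T" "1 \<le> n"
    then show "\<exists>x. particle_solution v w \<eta> \<rho>\<^sub>0 n T x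
      \<and> (\<forall>y. particle_solution v w \<eta> \<rho>\<^sub>0 n T y \<longrightarrow> (\<forall>i\<in>{1..n}. \<forall>t\<in>{0..T}. y i t = x i t))
      \<and> empirical_measure n x \<in> C0_P_c T" by (intro particles)
  next
    fix T :: real assume "0 < T"
    then show "weak_solution v w \<eta> \<rho>\<^sub>0 T (\<lambda>t. law (X t))" by (rule law_weak_solution[OF init])
  next
    fix T \<sigma> t assume "weak_solution v w \<eta> \<rho>\<^sub>0 T \<sigma>" "t \<in> {0..T}"
    then show "\<sigma> t = law (X t)" using weak_solution_unique[OF _ init] by simp
  next
    fix T x t assume "\<forall>n\<ge>1. particle_solution v w \<eta> \<rho>\<^sub>0 n T (x n)" "t \<in> {0..T}"
    then show "weak_conv_m (\<lambda>n. empirical_measure n (x n) t) (law (X t))" by (rule conv)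
  next
    fix t :: real assume "0 < t"
    then obtain r where "r \<in> borel_measurable borel" "law (X t) = measure_with_density r" "AE x in lborel. 0 \<le> r x \<and> r x \<le> M"
      using law_density[OF Linf(3) expand[of t]] by auto
    then show "\<exists>r\<in>borel_measurable borel. law (X t) = measure_with_density r
        \<and> (AE x in lborel. 0 \<le> r x \<and> ereal (r x) \<le> esssup lborel (\<lambda>y. ereal (\<rho>\<^sub>0 y)))"
      by (auto simp: Linf(1))
  qed
qed

end
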